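(* Let $T:\Delta\to\Delta$ be the tower map of an aperiodic induced weak Gibbs Markov (WGM) map $f^R:\Delta_0\to\Delta_0$ with a coprime block and $R\in L^1(m)$, and let $\beta_0\in(0,1)$ be a constant for which the Gibbs property of $f^R$ holds. Let $\nu$ be the unique mixing $T$-invariant probability measure such that $\frac{d\nu}{dm}\in\mathcal F_{\beta_0}^+(\Delta)$. Let $0<\beta<1$. Then: (1) if $m\{R>n\}\le Cn^{-a}$ (for all $n\ge1$) for some $C>0$ and $a>1$, then for any probability measure $\lambda$ on $\Delta$ with $\frac{d\lambda}{dm}\in\mathcal F_\beta^+(\Delta)$ there exists $C'>0$ such that for all $n\ge1$ $$|T_*^n\lambda-\nu|\le C'n^{-a+1};$$ (2) if $m\{R>n\}\le Ce^{-cn^a}$ (for all $n\ge1$) for some $C,c>0$ and $0<a\le1$, then, given $0<\beta<1$, there is $c'>0$ such that for any probability measure $\lambda$ on $\Delta$ with $\frac{d\lambda}{dm}\in\mathcal F_\beta^+(\Delta)$ there is some $C'>0$ such that for all $n\ge1$ $$|T_*^n\lambda-\nu|\le C'e^{-c'n^a}.$$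
   Context: **WGM map.** Let $(\Delta_0,\mathcal A,m)$ be a measure space with $0<m(\Delta_0)<\infty$, $F:\Delta_0\to\Delta_0$ measurable, and $\mathcal P_0$ a finite or countable ($m$ mod 0) partition of $\Delta_0$ into invertibility domains of $F$ ($F$ is a bijection from each $\omega\in\mathcal P_0$ onto $F(\omega)$ with measurable inverse). Put $\mathcal P_0^n=\bigvee_{i=0}^{n-1}F^{-i}(\mathcal P_0)$. $F$ is a weak Gibbs Markov (WGM) map with respect to $\mathcal P_0$ if: (W1) Markov: $F$ maps each $\omega\in\mathcal P_0$ bijectively to an ($m$ mod 0) union of elements of $\mathcal P_0$; (W2) Separability: the sequence $(\mathcal P_0^n)_n$ generates $\mathcal A$ ($m$ mod 0) and $\bigvee_{i=0}^\infty F^{-i}(\mathcal P_0)$ is the partition into single points; (W3) Nonsingular: there is a strictly positive measurable function $J_F$ on $\Delta_0$ with $m(F(A))=\int_AJ_F\,dm$ for each measurable $A\subset\omega\in\mathcal P_0$; (W4) Gibbs: there are $C_F>0$ and $0<\beta_0<1$ such that for all $\omega\in\mathcal P_0$ and $x,y\in\omega$, $\log\frac{J_F(x)}{J_F(y)}\le C_F\beta_0^{s(F(x),F(y))}$, where $s(x,y)=\min\{n\ge0: F^n(x)\text{ and }F^n(y)\text{ lie in distinct elements of }\mathcal P_0\}$; (W5) Long branches: there is $\delta_0>0$ with $m(F(\omega))\ge\delta_0$ for all $\omega\in\mathcal P_0$. **Induced map.** Let $(M,\mathcal B,m)$ be a measure space, $f:M\to M$ measurable, $\Delta_0\subset M$.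 $F:\Delta_0\to\Delta_0$ is an induced map for $f$, denoted $f^R$, if there are a countable ($m$ mod 0) partition $\mathcal P_0$ of $\Delta_0$ and a measurable $R:\Delta_0\to\mathbb N$, constant on elements of $\mathcal P_0$, with $F|_\omega=f^{R(\omega)}|_\omega$ for $\omega\in\mathcal P_0$. The restriction of $m$ to $\Delta_0$ is also denoted $m$. - *Aperiodic*: for all $\omega_1,\omega_2\in\mathcal P_0$ there is $k_0\in\mathbb N$ such that $m(\omega_1\cap(f^R)^{-n}(\omega_2))>0$ for all $n\ge k_0$. - *Coprime block*: there exist $N\ge2$ and $\omega_1,\dots,\omega_N\in\mathcal P_0$ with $\gcd\{R(\omega_i)\}_i=1$ and $f^R(\omega_i)\supseteq\omega_1\cup\cdots\cup\omega_N$ ($m$ mod 0) for all $i=1,\dots,N$. **Tower.** $\Delta=\{(x,\ell):x\in\Delta_0,\ R(x)>\ell\ge0\}$, and $T(x,\ell)=(x,\ell+1)$ if $R(x)>\ell+1$, $T(x,\ell)=(f^R(x),0)$ if $R(x)=\ell+1$. The $\ell$th level $\Delta_\ell=\{(x,\ell)\in\Delta\}$ is identified with $\{R>\ell\}\subset\Delta_0$ (level $0$ with $\Delta_0$), and $\mathcal A$ and $m$ are extended to $\Delta$ through these identifications; $m(\Delta)=\int_{\Delta_0}R\,dm$. With $\mathcal P_0=\{\Delta_{0,i}\}_i$, the partition $\eta$ of $\Delta$ consists of the sets $\Delta_{\ell,i}=\{(x,\ell)\in\Delta_\ell:(x,0)\in\Delta_{0,i}\}$. Separation time on $\Delta$: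 if $x=T^\ell(x_0)$, $y=T^\ell(y_0)$ lie in the same level $\Delta_\ell$ with $x_0,y_0\in\Delta_0$, then $s(x,y)=s(x_0,y_0)$; otherwise $s(x,y)=0$. For $0<\beta<1$, $\mathcal F_\beta(\Delta)$ is the set of $\varphi:\Delta\to\mathbb R$ for which there is $C_\varphi>0$ with $|\varphi(x)-\varphi(y)|\le C_\varphi\beta^{s(x,y)}$ for all $x,y\in\Delta$; $\mathcal F_\beta^+(\Delta)$ is the set of $\varphi\in\mathcal F_\beta(\Delta)$ for which there is $C'_\varphi>0$ with $\varphi(x)>0$ and $\left|\frac{\varphi(x)}{\varphi(y)}-1\right|\le C'_\varphi\beta^{s(x,y)}$ for all $x,y\in\omega\in\eta$. $|\cdot|$ denotes the total variation norm of a signed measure. *)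

theory Defs
  imports "HOL-Probability.Probability"
begin

section \<open>Partitions modulo null sets\<close>

text \<open>
  The cells are exactly disjoint; only the covering of the space is modulo a null set.
  The points left over, which belong to no cell, are handled explicitly in \<open>sep_time\<close> below.
\<close>

definition mod0_partition :: "'a measure \<Rightarrow> 'a set set \<Rightarrow> bool" where
  "mod0_partition m P \<longleftrightarrow>
     countable P \<and> P \<subseteq> sets m \<and> disjoint P \<and> space m - \<Union>P \<in> null_sets m"

definition join_partition :: "'a set \<Rightarrow> ('a \<Rightarrow> 'a) \<Rightarrow> 'a set set \<Rightarrow> nat \<Rightarrow> 'a set set" where
  "join_partition X F P n =
     {X \<inter> (\<Inter>i<n. (F ^^ i) -` \<omega> i) | \<omega>. \<forall>i<n. \<omega> i \<in> P} - {{}}"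

definition join_partition_inf :: "'a set \<Rightarrow> ('a \<Rightarrow> 'a) \<Rightarrow> 'a set set \<Rightarrow> 'a set set" where
  "join_partition_inf X F P =
     {X \<inter> (\<Inter>i. (F ^^ i) -` \<omega> i) | \<omega>. \<forall>i. \<omega> i \<in> P} - {{}}"


section \<open>Separation time\<close>

text \<open>
  Two points count as separated as soon as no single cell contains both. For points of cells this
  says that they lie in distinct cells; in addition, a point lying in no cell is separated from
  every point. The infimum of the empty set is \<open>\<infinity>\<close>, and \<open>\<beta>\<close> to the power \<open>\<infinity>\<close> is \<open>0\<close>.
\<close>

definition sep_time :: "('a \<Rightarrow> 'a) \<Rightarrow> 'a set set \<Rightarrow> 'a \<Rightarrow> 'a \<Rightarrow> enat" where
  "sep_time F P x y = Inf {enat n | n. \<not> (\<exists>\<omega>\<in>P. (F ^^ n) x \<in> \<omega> \<and> (F ^^ n) y \<in> \<omega>)}"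

definition enat_power :: "real \<Rightarrow> enat \<Rightarrow> real" where
  "enat_power \<beta> s = (case s of enat n \<Rightarrow> \<beta> ^ n | \<infinity> \<Rightarrow> 0)"


section \<open>Weak Gibbs Markov maps\<close>

definition invertibility_domain :: "'a measure \<Rightarrow> ('a \<Rightarrow> 'a) \<Rightarrow> 'a set \<Rightarrow> bool" where
  "invertibility_domain m F \<omega> \<longleftrightarrow>
     inj_on F \<omega> \<and> F ` \<omega> \<in> sets m \<and>
     the_inv_into \<omega> F \<in> restrict_space m (F ` \<omega>) \<rightarrow>\<^sub>M restrict_space m \<omega>"

definition markov_property :: "'a measure \<Rightarrow> ('a \<Rightarrow> 'a) \<Rightarrow> 'a set set \<Rightarrow> bool" where
  "markov_property m F P \<longleftrightarrow>
     (\<forall>\<omega>\<in>P. inj_on F \<omega> \<and> (\<exists>Q\<subseteq>P. (F ` \<omega> - \<Union>Q) \<union> (\<Union>Q - F ` \<omega>) \<in> null_sets m))"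

definition separability :: "'a measure \<Rightarrow> ('a \<Rightarrow> 'a) \<Rightarrow> 'a set set \<Rightarrow> bool" where
  "separability m F P \<longleftrightarrow>
     (\<forall>A\<in>sets m. \<exists>B\<in>sigma_sets (space m) (\<Union>n. join_partition (space m) F P n).
        (A - B) \<union> (B - A) \<in> null_sets m) \<and>
     (\<forall>A\<in>join_partition_inf (space m) F P. \<exists>x. A = {x})"

definition is_jacobian :: "'a measure \<Rightarrow> ('a \<Rightarrow> 'a) \<Rightarrow> 'a set set \<Rightarrow> ('a \<Rightarrow> real) \<Rightarrow> bool" where
  "is_jacobian m F P J \<longleftrightarrow>
     J \<in> borel_measurable m \<and> (\<forall>x\<in>space m. 0 < J x) \<and>
     (\<forall>\<omega>\<in>P. \<forall>A\<in>sets m. A \<subseteq> \<omega> \<longrightarrow> emeasure m (F ` A) = (\<integral>\<^sup>+x\<in>A. ennreal (J x) \<partial>m))"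

definition gibbs_property ::
    "('a \<Rightarrow> 'a) \<Rightarrow> 'a set set \<Rightarrow> ('a \<Rightarrow> real) \<Rightarrow> real \<Rightarrow> bool" where
  "gibbs_property F P J \<beta>\<^sub>0 \<longleftrightarrow>
     (\<exists>C>0. \<forall>\<omega>\<in>P. \<forall>x\<in>\<omega>. \<forall>y\<in>\<omega>.
        ln (J x / J y) \<le> C * enat_power \<beta>\<^sub>0 (sep_time F P (F x) (F y)))"

definition long_branches :: "'a measure \<Rightarrow> ('a \<Rightarrow> 'a) \<Rightarrow> 'a set set \<Rightarrow> bool" where
  "long_branches m F P \<longleftrightarrow> (\<exists>\<delta>>0. \<forall>\<omega>\<in>P. \<delta> \<le> measure m (F ` \<omega>))"

definition wgm_map :: "'a measure \<Rightarrow> ('a \<Rightarrow> 'a) \<Rightarrow> 'a set set \<Rightarrow> bool" where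
  "wgm_map m F P \<longleftrightarrow>
     0 < emeasure m (space m) \<and> emeasure m (space m) < \<infinity> \<and>
     F \<in> m \<rightarrow>\<^sub>M m \<and>
     mod0_partition m P \<and> (\<forall>\<omega>\<in>P. invertibility_domain m F \<omega>) \<and>
     markov_property m F P \<and> separability m F P \<and>
     (\<exists>J. is_jacobian m F P J \<and> (\<exists>\<beta>\<^sub>0. 0 < \<beta>\<^sub>0 \<and> \<beta>\<^sub>0 < 1 \<and> gibbs_property F P J \<beta>\<^sub>0)) \<and>
     long_branches m F P"


section \<open>Induced maps\<close>

text \<open>
  The values of \<open>R\<close> are positive, so that level \<open>0\<close> of the tower is all of \<open>\<Delta>\<^sub>0\<close>. The map \<open>F\<close> is
  kept as a separate parameter because off the cells it need not be an iterate of \<open>f\<close>.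
\<close>

definition induced_map ::
    "'a measure \<Rightarrow> ('a \<Rightarrow> 'a) \<Rightarrow> 'a set \<Rightarrow> ('a \<Rightarrow> 'a) \<Rightarrow> 'a set set \<Rightarrow> ('a \<Rightarrow> nat) \<Rightarrow> bool" where
  "induced_map M f \<Delta>\<^sub>0 F P R \<longleftrightarrow>
     f \<in> M \<rightarrow>\<^sub>M M \<and> \<Delta>\<^sub>0 \<in> sets M \<and> F \<in> \<Delta>\<^sub>0 \<rightarrow> \<Delta>\<^sub>0 \<and>
     mod0_partition (restrict_space M \<Delta>\<^sub>0) P \<and>
     R \<in> restrict_space M \<Delta>\<^sub>0 \<rightarrow>\<^sub>M count_space UNIV \<and>
     (\<forall>x\<in>\<Delta>\<^sub>0. 1 \<le> R x) \<and>
     (\<forall>\<omega>\<in>P. \<exists>k. \<forall>x\<in>\<omega>. R x = k \<and> F x = (f ^^ k) x)"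

definition aperiodic :: "'a measure \<Rightarrow> ('a \<Rightarrow> 'a) \<Rightarrow> 'a set set \<Rightarrow> bool" where
  "aperiodic m F P \<longleftrightarrow>
     (\<forall>\<omega>1\<in>P. \<forall>\<omega>2\<in>P. \<exists>k\<^sub>0. \<forall>n\<ge>k\<^sub>0. 0 < emeasure m (\<omega>1 \<inter> (F ^^ n) -` \<omega>2))"

text \<open>Since \<open>R\<close> is constant on cells, \<open>R ` (\<Union>i\<in>{1..N}. \<omega> i)\<close> is the set of the values \<open>R(\<omega>\<^sub>i)\<close>.\<close>

definition coprime_block ::
    "'a measure \<Rightarrow> ('a \<Rightarrow> 'a) \<Rightarrow> 'a set set \<Rightarrow> ('a \<Rightarrow> nat) \<Rightarrow> bool" where
  "coprime_block m F P R \<longleftrightarrow>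
     (\<exists>N\<ge>2. \<exists>\<omega> :: nat \<Rightarrow> 'a set.
        (\<forall>i\<in>{1..N}. \<omega> i \<in> P) \<and>
        Gcd (R ` (\<Union>i\<in>{1..N}. \<omega> i)) = 1 \<and>
        (\<forall>i\<in>{1..N}. (\<Union>j\<in>{1..N}. \<omega> j) - F ` \<omega> i \<in> null_sets m))"


section \<open>The tower\<close>

definition tower_set :: "'a set \<Rightarrow> ('a \<Rightarrow> nat) \<Rightarrow> ('a \<times> nat) set" where
  "tower_set \<Delta>\<^sub>0 R = {(x, l). x \<in> \<Delta>\<^sub>0 \<and> l < R x}"

definition tower_map :: "('a \<Rightarrow> 'a) \<Rightarrow> ('a \<Rightarrow> nat) \<Rightarrow> 'a \<times> nat \<Rightarrow> 'a \<times> nat" where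
  "tower_map F R = (\<lambda>(x, l). if l + 1 < R x then (x, l + 1) else (F x, 0))"

text \<open>
  Counting measure on the levels makes each level carry a copy of the base measure on \<open>{R > l}\<close>.
\<close>

definition tower_measure :: "'a measure \<Rightarrow> ('a \<Rightarrow> nat) \<Rightarrow> ('a \<times> nat) measure" where
  "tower_measure m R = restrict_space (m \<Otimes>\<^sub>M count_space UNIV) (tower_set (space m) R)"

definition tower_partition ::
    "'a set \<Rightarrow> 'a set set \<Rightarrow> ('a \<Rightarrow> nat) \<Rightarrow> ('a \<times> nat) set set" where
  "tower_partition \<Delta>\<^sub>0 P R = {tower_set \<Delta>\<^sub>0 R \<inter> (\<omega> \<times> {l}) | \<omega> l. \<omega> \<in> P}"

text \<open>
  A point \<open>(x, l)\<close> of the tower is the image of \<open>(x, 0)\<close> under \<open>l\<close> steps of the tower map, and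
  \<open>(x, 0)\<close> is the only point of the base with this property.
\<close>

definition tower_sep_time ::
    "('a \<Rightarrow> 'a) \<Rightarrow> 'a set set \<Rightarrow> 'a \<times> nat \<Rightarrow> 'a \<times> nat \<Rightarrow> enat" where
  "tower_sep_time F P = (\<lambda>(x, k) (y, l). if k = l then sep_time F P x y else 0)"

definition F_space ::
    "'a set \<Rightarrow> ('a \<Rightarrow> 'a) \<Rightarrow> 'a set set \<Rightarrow> ('a \<Rightarrow> nat) \<Rightarrow> real \<Rightarrow> ('a \<times> nat \<Rightarrow> real) set" where
  "F_space \<Delta>\<^sub>0 F P R \<beta> =
     {\<phi>. \<exists>C>0. \<forall>x\<in>tower_set \<Delta>\<^sub>0 R. \<forall>y\<in>tower_set \<Delta>\<^sub>0 R.
           \<bar>\<phi> x - \<phi> y\<bar> \<le> C * enat_power \<beta> (tower_sep_time F P x y)}"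

definition F_plus_space ::
    "'a set \<Rightarrow> ('a \<Rightarrow> 'a) \<Rightarrow> 'a set set \<Rightarrow> ('a \<Rightarrow> nat) \<Rightarrow> real \<Rightarrow> ('a \<times> nat \<Rightarrow> real) set" where
  "F_plus_space \<Delta>\<^sub>0 F P R \<beta> =
     {\<phi> \<in> F_space \<Delta>\<^sub>0 F P R \<beta>.
        \<exists>C>0. \<forall>\<omega>\<in>tower_partition \<Delta>\<^sub>0 P R. \<forall>x\<in>\<omega>. \<forall>y\<in>\<omega>.
           0 < \<phi> x \<and> \<bar>\<phi> x / \<phi> y - 1\<bar> \<le> C * enat_power \<beta> (tower_sep_time F P x y)}"


section \<open>Measures on the tower\<close>

text \<open>
  Densities are determined almost everywhere only: the condition asks for some version in the class.
\<close>

definition has_density_in :: "'a measure \<Rightarrow> 'a measure \<Rightarrow> ('a \<Rightarrow> real) set \<Rightarrow> bool" where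
  "has_density_in \<mu> m H \<longleftrightarrow>
     (\<exists>\<phi>\<in>H. \<phi> \<in> borel_measurable m \<and> \<mu> = density m (\<lambda>x. ennreal (\<phi> x)))"

definition invariant_measure :: "('a \<Rightarrow> 'a) \<Rightarrow> 'a measure \<Rightarrow> bool" where
  "invariant_measure T \<mu> \<longleftrightarrow> T \<in> \<mu> \<rightarrow>\<^sub>M \<mu> \<and> distr \<mu> \<mu> T = \<mu>"

definition mixing_measure :: "('a \<Rightarrow> 'a) \<Rightarrow> 'a measure \<Rightarrow> bool" where
  "mixing_measure T \<mu> \<longleftrightarrow>
     (\<forall>A\<in>sets \<mu>. \<forall>B\<in>sets \<mu>.
        (\<lambda>n. measure \<mu> (A \<inter> (T ^^ n) -` B)) \<longlonglongrightarrow> measure \<mu> A * measure \<mu> B)"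

text \<open>
  Total variation norm of a signed measure \<open>\<kappa>\<close> (a real set function on the measurable sets of \<open>M\<close>):
  the supremum of \<open>\<Sum>\<bar>\<kappa>(A)\<bar>\<close> over finite measurable partitions of the space. In particular
  the norm of a difference of probability measures ranges up to \<open>2\<close>.
\<close>

definition tv_norm :: "'a measure \<Rightarrow> ('a set \<Rightarrow> real) \<Rightarrow> ennreal" where
  "tv_norm M \<kappa> =
     (SUP Q\<in>{Q. finite Q \<and> disjoint Q \<and> Q \<subseteq> sets M \<and> \<Union>Q = space M}. ennreal (\<Sum>A\<in>Q. \<bar>\<kappa> A\<bar>))"


section \<open>The tower map is measurable\<close>

lemma space_tower_measure: "space (tower_measure m R) = tower_set (space m) R"
  by (auto simp: tower_measure_def space_restrict_space space_pair_measure tower_set_def)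

lemma measurable_level_less:
  fixes R :: "'a \<Rightarrow> nat" and j :: nat
  assumes [measurable]: "R \<in> m \<rightarrow>\<^sub>M count_space UNIV"
  shows "Measurable.pred (m \<Otimes>\<^sub>M count_space UNIV) (\<lambda>p. snd p + j < R (fst p))"
  by (rule measurable_compose_countable[where f = "\<lambda>l p. l + j < R (fst p)" and g = snd]) measurable

lemma measurable_tower_map:
  assumes F [measurable]: "F \<in> m \<rightarrow>\<^sub>M m" and R [measurable]: "R \<in> m \<rightarrow>\<^sub>M count_space UNIV"
    and pos: "\<And>x. x \<in> space m \<Longrightarrow> 1 \<le> R x"
  shows "tower_map F R \<in> tower_measure m R \<rightarrow>\<^sub>M tower_measure m R"
proof -
  note [measurable] = measurable_level_less[OF R, of 1]
  have "(\<lambda>p. if snd p + 1 < R (fst p) then (fst p, snd p + 1) else (F (fst p), 0))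
      \<in> m \<Otimes>\<^sub>M count_space UNIV \<rightarrow>\<^sub>M m \<Otimes>\<^sub>M count_space UNIV"
    by measurable
  then have "tower_map F R \<in> m \<Otimes>\<^sub>M count_space UNIV \<rightarrow>\<^sub>M m \<Otimes>\<^sub>M count_space UNIV"
    by (simp add: tower_map_def case_prod_beta')
  moreover have "tower_map F R \<in> tower_set (space m) R \<rightarrow> tower_set (space m) R"
    using pos measurable_space[OF F] by (fastforce simp: tower_map_def tower_set_def)
  ultimately show ?thesis
    unfolding tower_measure_def
    by (intro measurable_restrict_space3) auto
qed

lemma emeasure_tower_measure_space:
  assumes "finite_measure m" and R [measurable]: "R \<in> m \<rightarrow>\<^sub>M count_space UNIV"
  shows "emeasure (tower_measure m R) (space (tower_measure m R)) = (\<integral>\<^sup>+x. of_nat (R x) \<partial>m)"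
proof -
  interpret finite_measure m by fact
  interpret N: sigma_finite_measure "count_space (UNIV :: nat set)"
    by (rule sigma_finite_measure_count_space)
  let ?D = "tower_set (space m) R"
  have D: "?D = {p \<in> space (m \<Otimes>\<^sub>M count_space UNIV). snd p < R (fst p)}"
    by (auto simp: tower_set_def space_pair_measure)
  have D_sets: "?D \<in> sets (m \<Otimes>\<^sub>M count_space UNIV)"
    unfolding D using measurable_level_less[OF R, of 0] by simp
  have "emeasure (tower_measure m R) ?D = emeasure (m \<Otimes>\<^sub>M count_space UNIV) ?D"
    unfolding tower_measure_def using D_sets
    by (subst emeasure_restrict_space) (auto dest: sets.sets_into_space)
  also have "\<dots> = (\<integral>\<^sup>+x. emeasure (count_space UNIV) (Pair x -` ?D) \<partial>m)"
    by (rule N.emeasure_pair_measure_alt[OF D_sets])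
  also have "\<dots> = (\<integral>\<^sup>+x. of_nat (R x) \<partial>m)"
  proof (rule nn_integral_cong)
    fix x assume "x \<in> space m"
    then have "Pair x -` ?D = {..<R x}" by (auto simp: tower_set_def)
    then show "emeasure (count_space UNIV) (Pair x -` ?D) = of_nat (R x)" by simp
  qed
  finally show ?thesis by (simp add: space_tower_measure)
qed

end

theory Submission
  imports Defs "HOL-Real_Asymp.Real_Asymp"
begin

text \<open>
  Write \<open>\<phi>\<close> and \<open>\<chi>\<close> for the densities of \<open>\<lambda>\<close> and \<open>\<nu>\<close>. By invariance, \<open>T\<^sub>*\<^sup>n \<lambda> - \<nu>\<close> is the image under \<open>T\<^sup>n\<close> of
  \<open>(\<phi> - \<chi>) \<mu> = a ((1 + \<phi>/a) \<mu> - (1 + \<chi>/a) \<mu>)\<close>, and for a large constant \<open>a\<close> both \<open>1 + \<phi>/a\<close> and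
  \<open>1 + \<chi>/a\<close> are bounded away from \<open>0\<close> and have logarithms that are Hoelder, with respect to separation
  time, with a constant as small as desired. So it is enough to compare two densities of equal mass
  that lie in one fixed regularity class; this is why the rate \<open>c'\<close> in the second part does not
  depend on \<open>\<lambda>\<close>, which enters through \<open>a\<close> only.

  Distortion makes the class almost invariant under the transfer operator: a return to the base
  contracts the Hoelder constant by the factor \<open>\<beta>\<close> and adds the Gibbs constant. The slack gained
  allows one to subtract, at every time divisible by a fixed \<open>N\<close>, a fixed fraction of the mass on a
  reference cell \<open>star\<close> of the base, in the form of a multiple of the uniform density \<open>\<kappa>\<close> of that cell
  (\<open>strip_regular\<close>). A density thus turns into released quanta \<open>p\<^sub>k\<close> of \<open>\<kappa>\<close> at the times \<open>kN\<close> plus a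
  residual, and \<open>\<kappa>\<close> itself releases quanta \<open>q\<^sub>k\<close> (\<open>decomposition\<close>). With generating functions
  \<open>P\<^sub>1, P\<^sub>2, Q\<close> and the residuals \<open>E\<close> of \<open>\<kappa>\<close>, the difference of the two evolutions at time \<open>nN\<close>
  is the \<open>n\<close>-th coefficient of \<open>(P\<^sub>1 - P\<^sub>2) / (1 - Q) * E\<close> plus two residuals. Everything is
  reduced to the decay of scalar sequences.

  The residual mass decays (\<open>drain_rate\<close>) because every mass that returns to the base loses a
  fixed fraction within \<open>2N\<close> steps: long branches spread a returning density over one of finitely
  many cells, and from each of these the cell \<open>star\<close> is met at all large times with positive
  measure, since \<open>\<nu>\<close> is mixing with a density that is positive on cells. The coefficients of
  \<open>(P\<^sub>1 - P\<^sub>2) / (1 - Q)\<close> decay (\<open>renewal_coupling\<close>) by coupling two renewal processes: whichever lags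
  behind is run until it passes the other one, hits it exactly with probability bounded below, and
  otherwise overshoots by an amount whose tail is that of the summed tails of \<open>q\<close>. In units of \<open>N\<close>
  the renewal process has no period, because \<open>q\<^sub>1 > 0\<close>.

  Both decay estimates come from one inequality, \<open>Z(m) \<le> A \<psi>(m) + \<Sum>\<^sub>k y\<^sub>k Z(m - k)\<close> with a kernel \<open>y\<close> of
  mass less than \<open>1\<close> and tail of order \<open>\<psi>\<close>. Its solutions are of order \<open>\<psi>\<close> for polynomial rates, and of order
  \<open>exp (- c' n\<^sup>a)\<close> with a smaller constant for stretched exponential ones. The initial decay is that of the summed
  tails \<open>\<Sum>\<^sub>i m{R > n + i}\<close>, whence the exponent \<open>a - 1\<close> in the polynomial case.
\<close>

section \<open>Decay rates and the renewal inequality\<close>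

text \<open>
  A family of subprobability kernels of mass at most \<open>\<rho>\<close>; the index \<open>g\<close> is the state (below, the gap
  between two renewal processes) and \<open>k\<close> is both the delay and the next state.
\<close>

definition delay_kernel :: "real \<Rightarrow> (nat \<Rightarrow> real) \<Rightarrow> (nat \<Rightarrow> nat \<Rightarrow> real) \<Rightarrow> bool" where
  "delay_kernel \<rho> \<tau> y \<longleftrightarrow>
     (\<forall>g k. 0 \<le> y g k) \<and> (\<forall>g m. (\<Sum>k=1..m. y g k) \<le> \<rho>) \<and>
     (\<forall>g j m. (\<Sum>k=j+1..m. y g k) \<le> \<tau> j)"

definition renewal_dominated ::
    "real \<Rightarrow> real \<Rightarrow> (nat \<Rightarrow> real) \<Rightarrow> real \<Rightarrow> real \<Rightarrow> (nat \<Rightarrow> real) \<Rightarrow> bool" where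
  "renewal_dominated \<rho> C \<psi> A K \<psi>' \<longleftrightarrow>
     (\<forall>y Z. delay_kernel \<rho> (\<lambda>j. C * \<psi> j) y \<longrightarrow>
        (\<forall>g m. 0 \<le> Z g m \<and> Z g m \<le> 1) \<longrightarrow>
        (\<forall>g m. Z g m \<le> A * \<psi> m + (\<Sum>k=1..m. y g k * Z k (m - k))) \<longrightarrow>
        (\<forall>g m. Z g m \<le> K * \<psi>' m))"

lemma renewal_dominatedD:
  assumes "renewal_dominated \<rho> C \<psi> A K \<psi>'" "delay_kernel \<rho> (\<lambda>j. C * \<psi> j) y"
    and "\<And>g m. 0 \<le> Z g m" "\<And>g m. Z g m \<le> 1"
    and "\<And>g m. Z g m \<le> A * \<psi> m + (\<Sum>k=1..m. y g k * Z k (m - k))"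
  shows "Z g m \<le> K * \<psi>' m"
  using assms unfolding renewal_dominated_def by blast

text \<open>
  The two kinds of decay are treated at once. A family is used, and not one rate, because the
  constant in a stretched exponential deteriorates in each step of the argument. In
  \<open>renewal_inequality\<close> the new rate \<open>\<psi>'\<close> is chosen before \<open>A\<close>: initial data affect only the constant
  \<open>K\<close>, which is what makes the final rate uniform in the initial measure.
\<close>

locale rate_family =
  fixes \<Psi> :: "(nat \<Rightarrow> real) set"
  assumes pos: "\<psi> \<in> \<Psi> \<Longrightarrow> 0 < \<psi> n"
    and antimono: "\<psi> \<in> \<Psi> \<Longrightarrow> n \<le> k \<Longrightarrow> \<psi> k \<le> \<psi> n"
    and directed: "\<psi>1 \<in> \<Psi> \<Longrightarrow> \<psi>2 \<in> \<Psi> \<Longrightarrow> \<exists>\<psi>\<in>\<Psi>. \<forall>n. \<psi>1 n \<le> \<psi> n \<and> \<psi>2 n \<le> \<psi> n"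
    and slow_down: "\<psi> \<in> \<Psi> \<Longrightarrow> 1 \<le> k \<Longrightarrow> \<exists>\<psi>'\<in>\<Psi>. \<exists>C>0. \<forall>n. \<psi> (n div k) \<le> C * \<psi>' n"
    and renewal_inequality:
      "\<psi> \<in> \<Psi> \<Longrightarrow> 0 \<le> \<rho> \<Longrightarrow> \<rho> < 1 \<Longrightarrow> 0 \<le> C \<Longrightarrow>
       \<exists>\<psi>'\<in>\<Psi>. \<forall>A\<ge>0. \<exists>K\<ge>0. renewal_dominated \<rho> C \<psi> A K \<psi>'"

text \<open>
  Induction on \<open>m\<close>. Delays up to \<open>\<gamma> (m + 1)\<close> change the rate only by the factor \<open>(1 - \<gamma>)\<^sup>-\<^sup>b\<close>, which
  the loss of mass \<open>\<rho> < 1\<close> absorbs when \<open>\<gamma>\<close> is small; for the longer delays \<open>Z \<le> 1\<close> and the tail of the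
  kernel already has the right order.
\<close>

lemma polynomial_renewal_inequality:
  fixes b \<rho> C A :: real
  assumes b: "0 < b" and \<rho>: "0 \<le> \<rho>" "\<rho> < 1" and C: "0 \<le> C" and A: "0 \<le> A"
  shows "\<exists>K\<ge>0. renewal_dominated \<rho> C (\<lambda>n. real (n + 1) powr (- b)) A K (\<lambda>n. real (n + 1) powr (- b))"
proof -
  define r where "r = (1 + \<rho>) / 2"
  have r: "\<rho> < r" "r < 1" "0 < r" using \<rho> by (auto simp: r_def)
  have "((\<lambda>x. \<rho> * (1 - x) powr (- b)) \<longlongrightarrow> \<rho> * (1 - 0) powr (- b)) (at_right 0)"
    by (intro tendsto_intros) auto
  then have "eventually (\<lambda>x. \<rho> * (1 - x) powr (- b) < r) (at_right (0::real))"
    using r by (intro order_tendstoD(2)) auto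
  moreover have "eventually (\<lambda>x::real. x \<in> {0<..<1}) (at_right 0)"
    by (rule eventually_at_right_real) simp
  ultimately have "eventually (\<lambda>x::real. \<rho> * (1 - x) powr (- b) < r \<and> x \<in> {0<..<1}) (at_right 0)"
    by eventually_elim auto
  then obtain \<gamma> where \<gamma>: "\<rho> * (1 - \<gamma>) powr (- b) < r" "0 < \<gamma>" "\<gamma> < 1"
    by (metis (mono_tags, lifting) eventually_happens' greaterThanLessThan_iff trivial_limit_at_right_real)
  \<comment> \<open>The fixed point of \<open>K = A + C \<gamma>\<^sup>-\<^sup>b + r K\<close>, which closes the induction.\<close>
  define K where "K = (A + C * \<gamma> powr (- b)) / (1 - r)"
  have K0: "0 \<le> K" unfolding K_def using A C r by (intro divide_nonneg_nonneg add_nonneg_nonneg mult_nonneg_nonneg) auto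
  have K: "A + C * \<gamma> powr (- b) + r * K = K"
    using r by (simp add: K_def field_simps)
  show ?thesis
    unfolding renewal_dominated_def
  proof (intro exI[of _ K] conjI K0 allI impI)
    fix y Z :: "nat \<Rightarrow> nat \<Rightarrow> real" and g m
    assume y: "delay_kernel \<rho> (\<lambda>j. C * real (j + 1) powr (- b)) y"
      and Z: "\<forall>g m. 0 \<le> Z g m \<and> Z g m \<le> 1"
      and rec: "\<forall>g m. Z g m \<le> A * real (m + 1) powr (- b) + (\<Sum>k=1..m. y g k * Z k (m - k))"
    have y0: "0 \<le> y g k" and y1: "(\<Sum>k=1..m. y g k) \<le> \<rho>" and
      y2: "(\<Sum>k=j+1..m. y g k) \<le> C * real (j + 1) powr (- b)" for g k j m
      using y by (auto simp: delay_kernel_def)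
    show "Z g m \<le> K * real (m + 1) powr (- b)"
    proof (induction m arbitrary: g rule: less_induct)
      case (less m)
      \<comment> \<open>The last short delay; \<open>j + 1 \<ge> \<gamma> (m + 1)\<close> also when the minimum is \<open>m\<close>.\<close>
      define j where "j = min m (nat \<lfloor>\<gamma> * real (m + 1)\<rfloor>)"
      have jm: "j \<le> m" by (simp add: j_def)
      have j1: "real j \<le> \<gamma> * real (m + 1)"
      proof -
        have "real (nat \<lfloor>\<gamma> * real (m + 1)\<rfloor>) \<le> \<gamma> * real (m + 1)"
          using \<gamma> by (intro of_nat_floor) auto
        then show ?thesis by (simp add: j_def)
      qed
      have j2: "\<gamma> * real (m + 1) \<le> real (j + 1)"
      proof (cases "j = m")
        case True then show ?thesis using \<gamma> by (simp add: mult_left_le_one_le)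
      next
        case False
        then have "j = nat \<lfloor>\<gamma> * real (m + 1)\<rfloor>" by (auto simp: j_def min_def split: if_splits)
        then show ?thesis using \<gamma> by linarith
      qed
      have split: "{1..m} = {1..j} \<union> {j+1..m}" "{1..j} \<inter> {j+1..m} = {}" using jm by auto
      have "(\<Sum>k=1..m. y g k * Z k (m - k)) = (\<Sum>k=1..j. y g k * Z k (m - k)) + (\<Sum>k=j+1..m. y g k * Z k (m - k))"
        unfolding split(1) by (intro sum.union_disjoint) auto
      also have "(\<Sum>k=1..j. y g k * Z k (m - k)) \<le> (\<Sum>k=1..j. y g k * (K * (1 - \<gamma>) powr (- b) * real (m + 1) powr (- b)))"
      proof (intro sum_mono mult_left_mono y0)
        fix k assume k: "k \<in> {1..j}"
        then have km: "k \<le> m" "m - k < m" using jm by auto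
        have "Z k (m - k) \<le> K * real (m - k + 1) powr (- b)" by (rule less.IH[OF km(2)])
        also have "real (m - k + 1) powr (- b) \<le> ((1 - \<gamma>) * real (m + 1)) powr (- b)"
        proof (rule powr_mono2')
          show "(1 - \<gamma>) * real (m + 1) \<le> real (m - k + 1)"
          proof -
            have "real k \<le> real j" using k by simp
            then have "real k \<le> \<gamma> * real (m + 1)" using j1 by linarith
            then show ?thesis using km by (simp add: of_nat_diff algebra_simps)
          qed
        qed (use b \<gamma> in auto)
        also have "((1 - \<gamma>) * real (m + 1)) powr (- b) = (1 - \<gamma>) powr (- b) * real (m + 1) powr (- b)"
          using \<gamma> by (simp add: powr_mult)
        finally show "Z k (m - k) \<le> K * (1 - \<gamma>) powr (- b) * real (m + 1) powr (- b)"
          using K0 by (simp add: mult_left_mono mult.assoc)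
      qed
      also have "\<dots> = (\<Sum>k=1..j. y g k) * (1 - \<gamma>) powr (- b) * (K * real (m + 1) powr (- b))"
        by (subst sum_distrib_right[symmetric]) (simp add: mult_ac)
      also have "\<dots> \<le> \<rho> * (1 - \<gamma>) powr (- b) * (K * real (m + 1) powr (- b))"
        using y1 K0 by (intro mult_right_mono) auto
      also have "\<dots> \<le> r * (K * real (m + 1) powr (- b))"
        using \<gamma>(1) K0 by (intro mult_right_mono) auto
      also have "(\<Sum>k=j+1..m. y g k * Z k (m - k)) \<le> (\<Sum>k=j+1..m. y g k)"
        using y0 Z by (intro sum_mono) (simp add: mult_left_le)
      also have "\<dots> \<le> C * real (j + 1) powr (- b)" by (rule y2)
      also have "\<dots> \<le> C * (\<gamma> * real (m + 1)) powr (- b)"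
        using j2 \<gamma> b C by (intro mult_left_mono powr_mono2') auto
      also have "\<dots> = C * \<gamma> powr (- b) * real (m + 1) powr (- b)"
        using \<gamma> by (simp add: powr_mult)
      finally have "(\<Sum>k=1..m. y g k * Z k (m - k)) \<le>
          r * (K * real (m + 1) powr (- b)) + C * \<gamma> powr (- b) * real (m + 1) powr (- b)" by simp
      then have "Z g m \<le> (A + C * \<gamma> powr (- b) + r * K) * real (m + 1) powr (- b)"
        using rec[rule_format, of g m] by (simp add: algebra_simps)
      then show ?case unfolding K .
    qed
  qed
qed

lemma polynomial_rate_family:
  assumes b: "0 < (b::real)"
  shows "rate_family {\<lambda>n. real (n + 1) powr (- b)}"
proof
  fix \<psi> :: "nat \<Rightarrow> real" and k :: nat
  assume \<psi>: "\<psi> \<in> {\<lambda>n. real (n + 1) powr (- b)}" and k: "1 \<le> k"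
  have "real (n div k + 1) powr (- b) \<le> real k powr b * real (n + 1) powr (- b)" for n
  proof -
    have "n < k * (n div k + 1)" using k
      by (metis One_nat_def Suc_eq_plus1 dividend_less_times_div less_le_trans zero_less_one mult_Suc_right)
    then have "n + 1 \<le> k * (n div k + 1)" by linarith
    then have "real (n + 1) \<le> real k * real (n div k + 1)"
      by (metis of_nat_le_iff of_nat_mult)
    then have "real (n + 1) / real k \<le> real (n div k + 1)"
      using k by (simp add: divide_le_eq mult.commute)
    then have "real (n div k + 1) powr (- b) \<le> (real (n + 1) / real k) powr (- b)"
      using k b by (intro powr_mono2') auto
    also have "\<dots> = real k powr b * real (n + 1) powr (- b)"
      using k by (simp add: powr_divide powr_minus field_simps)
    finally show ?thesis .
  qed
  then show "\<exists>\<psi>'\<in>{\<lambda>n. real (n + 1) powr (- b)}. \<exists>C>0. \<forall>n. \<psi> (n div k) \<le> C * \<psi>' n"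
    using \<psi> k by (auto intro!: exI[of _ "real k powr b"])
next
  fix \<psi> :: "nat \<Rightarrow> real" and \<rho> C :: real
  assume "\<psi> \<in> {\<lambda>n. real (n + 1) powr (- b)}" "0 \<le> \<rho>" "\<rho> < 1" "0 \<le> C"
  then show "\<exists>\<psi>'\<in>{\<lambda>n. real (n + 1) powr (- b)}. \<forall>A\<ge>0. \<exists>K\<ge>0. renewal_dominated \<rho> C \<psi> A K \<psi>'"
    using polynomial_renewal_inequality[OF b] by simp
qed (use b in \<open>auto intro!: powr_mono2'\<close>)

text \<open>
  Concavity of \<open>x\<^sup>a\<close>; it turns the sum of the delays into a product of the weights \<open>exp (c k\<^sup>a)\<close>.
\<close>

lemma nat_powr_subadditive:
  fixes a :: real
  assumes a: "0 < a" "a \<le> 1"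
  shows "real (i + j) powr a \<le> real i powr a + real j powr a"
proof (cases "i + j = 0")
  case False
  define s where "s = real (i + j)"
  have s: "0 < s" using False unfolding s_def of_nat_0_less_iff by simp
  have le: "x \<le> x powr a" if "0 \<le> x" "x \<le> 1" for x :: real
    using powr_mono'[of a 1 x] a that by (cases "x = 0") auto
  have "1 = real i / s + real j / s" using s by (simp add: s_def add_divide_distrib[symmetric])
  also have "\<dots> \<le> (real i / s) powr a + (real j / s) powr a"
    using s by (intro add_mono le) (auto simp: s_def)
  also have "\<dots> = (real i powr a + real j powr a) / s powr a"
    using s by (simp add: powr_divide add_divide_distrib)
  finally show ?thesis using s by (simp add: s_def field_simps)
qed auto

lemma stretched_exponential_summable:
  assumes "0 < (c::real)" "0 < a"
  shows "summable (\<lambda>k. exp (- c * real k powr a))"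
proof (rule summable_comparison_test_ev)
  have "((\<lambda>k::nat. real k powr 2 * exp (- c * real k powr a)) \<longlongrightarrow> 0) sequentially"
    using assms by real_asymp
  then have "eventually (\<lambda>k::nat. real k powr 2 * exp (- c * real k powr a) < 1) sequentially"
    by (rule order_tendstoD(2)) simp
  then show "eventually (\<lambda>k. norm (exp (- c * real k powr a)) \<le> inverse (real k ^ 2)) sequentially"
    using eventually_gt_at_top[of 0]
    by eventually_elim (simp add: field_simps)
  show "summable (\<lambda>k. inverse (real k ^ 2))"
    by (rule inverse_power_summable) simp
qed

lemma sum_le_tail:
  fixes f :: "nat \<Rightarrow> real"
  assumes f: "summable f" "\<And>i. 0 \<le> f i"
  shows "(\<Sum>i\<in>{m..<n}. f i) \<le> (\<Sum>i. f (i + m))"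
proof (cases "m \<le> n")
  case True
  have "(\<Sum>i\<in>{m..<n}. f i) = (\<Sum>i<n-m. f (i + m))"
    using sum.shift_bounds_nat_ivl[of f 0 m "n - m"] True by (simp add: atLeast0LessThan)
  also have "\<dots> \<le> (\<Sum>i. f (i + m))"
    by (intro sum_le_suminf summable_ignore_initial_segment f) (auto intro: f)
  finally show ?thesis .
qed (auto intro!: suminf_nonneg summable_ignore_initial_segment f)

text \<open>
  By subadditivity of \<open>k\<^sup>a\<close>, the function \<open>exp (- c' m\<^sup>a)\<close> is a supersolution as soon as the
  exponentially weighted kernel \<open>\<Sum>\<^sub>k y\<^sub>k exp (c' k\<^sup>a)\<close> has mass below \<open>1\<close>. The part of this sum beyond
  some \<open>G\<close> is small for every \<open>c' \<le> c / 2\<close>, and the part before \<open>G\<close> exceeds \<open>\<rho>\<close> arbitrarily little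
  when \<open>c'\<close> is small.
\<close>

lemma stretched_exponential_renewal_inequality:
  fixes a c \<rho> C :: real
  assumes a: "0 < a" "a \<le> 1" and c: "0 < c" and \<rho>: "0 \<le> \<rho>" "\<rho> < 1" and C: "0 \<le> C"
  shows "\<exists>c'>0. \<forall>A\<ge>0. \<exists>K\<ge>0. renewal_dominated \<rho> C (\<lambda>n. exp (- c * real n powr a)) A K (\<lambda>n. exp (- c' * real n powr a))"
proof -
  define r where "r = (1 + \<rho>) / 2"
  have r: "\<rho> < r" "r < 1" "0 < r" using \<rho> by (auto simp: r_def)
  \<comment> \<open>Bounds \<open>y\<^sub>k exp (c k\<^sup>a / 2)\<close>: the mass at \<open>k\<close> is at most the tail beyond \<open>k - 1\<close>, and \<open>exp c\<close> pays for the shift by one.\<close>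
  define e where "e = (\<lambda>k. C * exp c * exp (- (c / 2) * real k powr a))"
  have sum_e: "summable e"
    unfolding e_def using c a by (intro summable_mult stretched_exponential_summable) auto
  have e0: "0 \<le> e k" for k using C by (simp add: e_def)
  have "(\<lambda>G. \<Sum>k. e (k + G)) \<longlonglongrightarrow> 0"
    by (rule suminf_exist_split2[OF sum_e])
  then have "eventually (\<lambda>G. (\<Sum>k. e (k + G)) < (r - \<rho>) / 2) sequentially"
    using r by (intro order_tendstoD(2)) auto
  then obtain G where G: "(\<Sum>k. e (k + G)) < (r - \<rho>) / 2"
    by (auto simp: eventually_sequentially)
  have "((\<lambda>x. \<rho> * exp (x * real G powr a)) \<longlongrightarrow> \<rho> * exp (0 * real G powr a)) (at_right 0)"
    by (intro tendsto_intros)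
  then have "eventually (\<lambda>x. \<rho> * exp (x * real G powr a) < (r + \<rho>) / 2) (at_right (0::real))"
    using r by (intro order_tendstoD(2)) auto
  moreover have "eventually (\<lambda>x::real. x \<in> {0<..<c/2}) (at_right 0)"
    using c by (intro eventually_at_right_real) simp
  ultimately have "eventually (\<lambda>x::real. \<rho> * exp (x * real G powr a) < (r + \<rho>) / 2 \<and> x \<in> {0<..<c/2}) (at_right 0)"
    by eventually_elim auto
  then obtain c' where c': "\<rho> * exp (c' * real G powr a) < (r + \<rho>) / 2" "0 < c'" "c' < c / 2"
    by (metis (mono_tags, lifting) eventually_happens' greaterThanLessThan_iff trivial_limit_at_right_real)
  show ?thesis
  proof (rule exI[of _ c'], rule conjI[OF c'(2)], intro allI impI)
    fix A :: real assume A: "0 \<le> A"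
    define K where "K = A / (1 - r)"
    have K0: "0 \<le> K" using A r by (simp add: K_def)
    have K: "A + r * K = K" using r by (simp add: K_def field_simps)
    show "\<exists>K\<ge>0. renewal_dominated \<rho> C (\<lambda>n. exp (- c * real n powr a)) A K (\<lambda>n. exp (- c' * real n powr a))"
      unfolding renewal_dominated_def
    proof (intro exI[of _ K] conjI K0 allI impI)
      fix y Z :: "nat \<Rightarrow> nat \<Rightarrow> real" and g m
      assume y: "delay_kernel \<rho> (\<lambda>j. C * exp (- c * real j powr a)) y"
        and Z: "\<forall>g m. 0 \<le> Z g m \<and> Z g m \<le> 1"
        and rec: "\<forall>g m. Z g m \<le> A * exp (- c * real m powr a) + (\<Sum>k=1..m. y g k * Z k (m - k))"
      have y0: "0 \<le> y g k" and y1: "(\<Sum>k=1..m. y g k) \<le> \<rho>" and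
        y2: "(\<Sum>k=j+1..m. y g k) \<le> C * exp (- c * real j powr a)" for g k j m
        using y by (auto simp: delay_kernel_def)
      have yk: "y g k * exp (c' * real k powr a) \<le> e k" if "1 \<le> k" for g k
      proof -
        have "y g k \<le> C * exp (- c * real (k - 1) powr a)"
          using y2[of g "k - 1" k] that by simp
        moreover have "real k powr a \<le> real (k - 1) powr a + 1"
          using nat_powr_subadditive[OF a, of "k - 1" 1] that by simp
        then have "c * real k powr a \<le> c * (real (k - 1) powr a + 1)" using c by (intro mult_left_mono) auto
        then have "exp (- c * real (k - 1) powr a) \<le> exp (c - c * real k powr a)"
          by (simp add: algebra_simps)
        ultimately have "y g k \<le> C * exp (c - c * real k powr a)"
          using C by (meson mult_left_mono order_trans)
        moreover have "exp (c' * real k powr a) \<le> exp (c / 2 * real k powr a)"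
          using mult_right_mono[of c' "c / 2" "real k powr a"] c' by simp
        ultimately have "y g k * exp (c' * real k powr a) \<le> C * exp (c - c * real k powr a) * exp (c / 2 * real k powr a)"
          using C by (intro mult_mono) auto
        also have "\<dots> = e k" unfolding e_def mult.assoc mult_exp_exp by (simp add: field_simps)
        finally show ?thesis .
      qed
      have wsum: "(\<Sum>k=1..m. y g k * exp (c' * real k powr a)) \<le> r" for g m
      proof -
        have "(\<Sum>k=1..m. y g k * exp (c' * real k powr a)) \<le>
            (\<Sum>k=1..m. y g k * exp (c' * real G powr a) + (if G \<le> k then e k else 0))"
        proof (intro sum_mono)
          fix k assume k: "k \<in> {1..m}"
          show "y g k * exp (c' * real k powr a) \<le> y g k * exp (c' * real G powr a) + (if G \<le> k then e k else 0)"
          proof (cases "G \<le> k")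
            case True then show ?thesis using yk[of k g] k y0[of g k] by (simp add: add_increasing)
          next
            case False
            then have "exp (c' * real k powr a) \<le> exp (c' * real G powr a)"
              using c' a by (simp add: powr_mono2)
            then show ?thesis using False y0[of g k] by (simp add: mult_left_mono)
          qed
        qed
        also have "\<dots> = (\<Sum>k=1..m. y g k) * exp (c' * real G powr a) + (\<Sum>k=1..m. if G \<le> k then e k else 0)"
          by (simp add: sum.distrib sum_distrib_right)
        also have "(\<Sum>k=1..m. y g k) * exp (c' * real G powr a) \<le> \<rho> * exp (c' * real G powr a)"
          by (intro mult_right_mono y1) auto
        also have "(\<Sum>k=1..m. if G \<le> k then e k else 0) \<le> (\<Sum>k\<in>{G..<m+1+G}. e k)"
          by (subst sum.inter_filter[symmetric], simp, intro sum_mono2 e0) auto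
        also have "\<dots> \<le> (\<Sum>k. e (k + G))" by (rule sum_le_tail[OF sum_e e0])
        finally show ?thesis using G c'(1) by simp
      qed
      show "Z g m \<le> K * exp (- c' * real m powr a)"
      proof (induction m arbitrary: g rule: less_induct)
        case (less m)
        have "(\<Sum>k=1..m. y g k * Z k (m - k)) \<le>
            (\<Sum>k=1..m. y g k * exp (c' * real k powr a) * (K * exp (- c' * real m powr a)))"
        proof (intro sum_mono)
          fix k assume k: "k \<in> {1..m}"
          have "Z k (m - k) \<le> K * exp (- c' * real (m - k) powr a)" using k by (intro less.IH) auto
          also have "\<dots> \<le> K * (exp (c' * real k powr a) * exp (- c' * real m powr a))"
          proof (intro mult_left_mono K0)
            have "real m powr a \<le> real k powr a + real (m - k) powr a"
              using nat_powr_subadditive[OF a, of k "m - k"] k by simp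
            then have "c' * real m powr a \<le> c' * (real k powr a + real (m - k) powr a)"
              using c' by (intro mult_left_mono) auto
            then show "exp (- c' * real (m - k) powr a) \<le> exp (c' * real k powr a) * exp (- c' * real m powr a)"
              by (simp add: exp_add[symmetric] algebra_simps)
          qed
          finally show "y g k * Z k (m - k) \<le> y g k * exp (c' * real k powr a) * (K * exp (- c' * real m powr a))"
            using y0[of g k] mult_left_mono by (fastforce simp: mult_ac)
        qed
        also have "\<dots> \<le> r * (K * exp (- c' * real m powr a))"
          unfolding sum_distrib_right[symmetric] using wsum K0 by (intro mult_right_mono) auto
        finally have "Z g m \<le> A * exp (- c * real m powr a) + r * (K * exp (- c' * real m powr a))"
          using rec[rule_format, of g m] by linarith
        also have "A * exp (- c * real m powr a) \<le> A * exp (- c' * real m powr a)"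
          using A c c' by (intro mult_left_mono) (auto intro!: mult_right_mono)
        finally have "Z g m \<le> (A + r * K) * exp (- c' * real m powr a)" by (simp add: algebra_simps)
        then show ?case unfolding K .
      qed
    qed
  qed
qed

lemma stretched_exponential_rate_family:
  assumes a: "0 < (a::real)" "a \<le> 1"
  shows "rate_family {\<lambda>n. exp (- c * real n powr a) | c. 0 < c}"
proof
  fix \<psi> :: "nat \<Rightarrow> real" and k n :: nat
  assume \<psi>: "\<psi> \<in> {\<lambda>n. exp (- c * real n powr a) | c. 0 < c}"
  then obtain c where c: "0 < c" and \<psi>_eq: "\<psi> = (\<lambda>n. exp (- c * real n powr a))" by auto
  show "0 < \<psi> n" by (simp add: \<psi>_eq)
  show "\<psi> k \<le> \<psi> n" if "n \<le> k"
    using c a that by (simp add: \<psi>_eq powr_mono2)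
  {
    assume k: "1 \<le> k"
    define c' where "c' = c / real k powr a"
    have "\<psi> (n div k) \<le> exp c * exp (- c' * real n powr a)" for n
    proof -
      have "real n powr a \<le> (real k * real (n div k + 1)) powr a"
      proof (rule powr_mono2)
        have "n < k * (n div k + 1)" using k
          by (metis One_nat_def Suc_eq_plus1 dividend_less_times_div less_le_trans zero_less_one mult_Suc_right)
        then show "real n \<le> real k * real (n div k + 1)"
          by (metis less_imp_le of_nat_le_iff of_nat_mult)
      qed (use a in auto)
      also have "\<dots> = real k powr a * real (n div k + 1) powr a" by (simp add: powr_mult)
      also have "real (n div k + 1) powr a \<le> real (n div k) powr a + 1"
        using nat_powr_subadditive[OF a, of "n div k" 1] by simp
      finally have "real n powr a \<le> real k powr a * (real (n div k) powr a + 1)"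
        by (simp add: mult_left_mono)
      then have "c' * real n powr a \<le> c' * (real k powr a * (real (n div k) powr a + 1))"
        using c by (intro mult_left_mono) (auto simp: c'_def)
      also have "\<dots> = c * (real (n div k) powr a + 1)" using k by (simp add: c'_def)
      finally show ?thesis by (simp add: \<psi>_eq exp_add[symmetric] algebra_simps)
    qed
    moreover have "0 < c'" using c k by (simp add: c'_def)
    ultimately show "\<exists>\<psi>'\<in>{\<lambda>n. exp (- c * real n powr a) | c. 0 < c}. \<exists>C>0. \<forall>n. \<psi> (n div k) \<le> C * \<psi>' n"
      by (intro bexI[of _ "\<lambda>n. exp (- c' * real n powr a)"] exI[of _ "exp c"]) auto
  }
next
  fix \<psi>1 \<psi>2 :: "nat \<Rightarrow> real"
  assume "\<psi>1 \<in> {\<lambda>n. exp (- c * real n powr a) | c. 0 < c}" "\<psi>2 \<in> {\<lambda>n. exp (- c * real n powr a) | c. 0 < c}"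
  then obtain c1 c2 where c: "0 < c1" "0 < c2" and eq: "\<psi>1 = (\<lambda>n. exp (- c1 * real n powr a))"
    "\<psi>2 = (\<lambda>n. exp (- c2 * real n powr a))" by auto
  show "\<exists>\<psi>\<in>{\<lambda>n. exp (- c * real n powr a) | c. 0 < c}. \<forall>n. \<psi>1 n \<le> \<psi> n \<and> \<psi>2 n \<le> \<psi> n"
    using c by (intro bexI[of _ "\<lambda>n. exp (- min c1 c2 * real n powr a)"])
      (auto simp: eq intro!: mult_right_mono exI[of _ "min c1 c2"])
next
  fix \<psi> :: "nat \<Rightarrow> real" and \<rho> C :: real
  assume "\<psi> \<in> {\<lambda>n. exp (- c * real n powr a) | c. 0 < c}" and *: "0 \<le> \<rho>" "\<rho> < 1" "0 \<le> C"
  then obtain c where c: "0 < c" and \<psi>_eq: "\<psi> = (\<lambda>n. exp (- c * real n powr a))" by auto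
  from stretched_exponential_renewal_inequality[OF a c *] obtain c' where "0 < c'" and
    c': "\<forall>A\<ge>0. \<exists>K\<ge>0. renewal_dominated \<rho> C (\<lambda>n. exp (- c * real n powr a)) A K (\<lambda>n. exp (- c' * real n powr a))"
    by blast
  show "\<exists>\<psi>'\<in>{\<lambda>n. exp (- c * real n powr a) | c. 0 < c}. \<forall>A\<ge>0. \<exists>K\<ge>0. renewal_dominated \<rho> C \<psi> A K \<psi>'"
    unfolding \<psi>_eq
    by (rule bexI[of _ "\<lambda>n. exp (- c' * real n powr a)"]) (use c' \<open>0 < c'\<close> in auto)
qed

text \<open>
  Comparison with the telescoping sum of \<open>(n + 1)\<^sup>-\<^sup>(\<^sup>a\<^sup>-\<^sup>1\<^sup>)\<close>, via the mean value theorem.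
\<close>

lemma polynomial_tail_sum:
  fixes t :: "nat \<Rightarrow> real"
  assumes a: "1 < a" and C: "0 \<le> C" and t: "\<And>n. 1 \<le> n \<Longrightarrow> t n \<le> C * real n powr (- a)" and t0: "\<And>n. 0 \<le> t n"
  shows "\<exists>D\<ge>0. \<forall>n. (\<Sum>i. t (i + n)) \<le> D * real (n + 1) powr (- (a - 1))"
proof -
  define b where "b = a - 1"
  have b: "0 < b" "- a = - b - 1" using a by (auto simp: b_def)
  define D where "D = max (t 0) (C * 2 powr a) / b"
  have D: "0 \<le> D" using b t0[of 0] by (simp add: D_def le_max_iff_disj)
  define v where "v = (\<lambda>n::nat. D * real (n + 1) powr (- b))"
  have tv: "t n \<le> D * b * real (n + 1) powr (- a)" for n
  proof (cases "n = 0")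
    case True then show ?thesis using b(1) by (simp add: D_def)
  next
    case False
    have "real n powr (- a) \<le> (real (n + 1) / 2) powr (- a)"
      using False a by (intro powr_mono2') auto
    also have "\<dots> = 2 powr a * real (n + 1) powr (- a)" by (simp add: powr_divide powr_minus field_simps)
    finally have "t n \<le> C * (2 powr a * real (n + 1) powr (- a))"
      using False by (intro order_trans[OF t mult_left_mono[OF _ C]]) auto
    also have "\<dots> = C * 2 powr a * real (n + 1) powr (- a)" by simp
    also have "\<dots> \<le> D * b * real (n + 1) powr (- a)"
      using b by (intro mult_right_mono) (auto simp: D_def)
    finally show ?thesis .
  qed
  have step: "b * real (n + 2) powr (- a) \<le> real (n + 1) powr (- b) - real (n + 2) powr (- b)" for n
  proof -
    have "\<exists>z. real (n + 1) < z \<and> z < real (n + 2) \<and>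
       real (n + 2) powr (- b) - real (n + 1) powr (- b) = (real (n + 2) - real (n + 1)) * (- b * z powr (- b - 1))"
      by (rule MVT2) (auto intro!: derivative_eq_intros)
    then obtain z where z: "real (n + 1) < z" "z < real (n + 2)"
      "real (n + 2) powr (- b) - real (n + 1) powr (- b) = (real (n + 2) - real (n + 1)) * (- b * z powr (- b - 1))" by blast
    have "real (n + 2) powr (- a) \<le> z powr (- a)" using z a by (intro powr_mono2') auto
    then have "b * real (n + 2) powr (- a) \<le> b * z powr (- a)" using b by (intro mult_left_mono) auto
    then show ?thesis using z(3) b(2) by simp
  qed
  have tv': "t n \<le> 2 powr a * (v n - v (Suc n))" for n
  proof -
    have "real (n + 1) powr (- a) \<le> (real (n + 2) / 2) powr (- a)"
      using a by (intro powr_mono2') auto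
    also have "\<dots> = 2 powr a * real (n + 2) powr (- a)" by (simp add: powr_divide powr_minus field_simps)
    finally have "D * b * real (n + 1) powr (- a) \<le> D * b * (2 powr a * real (n + 2) powr (- a))"
      using D b by (intro mult_left_mono) auto
    also have "\<dots> = 2 powr a * (D * (b * real (n + 2) powr (- a)))" by simp
    also have "\<dots> \<le> 2 powr a * (D * (real (n + 1) powr (- b) - real (n + 2) powr (- b)))"
      by (intro mult_left_mono step D) auto
    also have "\<dots> = 2 powr a * (v n - v (Suc n))" by (simp add: v_def algebra_simps)
    finally show ?thesis using tv[of n] by simp
  qed
  have v0: "0 \<le> v n" for n using D by (simp add: v_def)
  have partial: "(\<Sum>i<k. t (i + n)) \<le> 2 powr a * v n" for k n
  proof -
    have "(\<Sum>i<k. t (i + n)) \<le> (\<Sum>i<k. 2 powr a * (v (i + n) - v (Suc i + n)))"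
      using tv' by (intro sum_mono) auto
    also have "\<dots> = 2 powr a * (v n - v (k + n))"
      unfolding sum_distrib_left[symmetric] by (subst sum_lessThan_telescope') simp
    also have "\<dots> \<le> 2 powr a * v n" using v0[of "k + n"] by (intro mult_left_mono) auto
    finally show ?thesis .
  qed
  have "(\<Sum>i. t (i + n)) \<le> 2 powr a * v n" for n
    by (intro suminf_le_const summableI_nonneg_bounded[where x = "2 powr a * v n"] partial t0)
  then show ?thesis using D
    by (intro exI[of _ "2 powr a * D"]) (auto simp: v_def b_def mult.assoc)
qed

lemma stretched_exponential_tail_sum:
  fixes t :: "nat \<Rightarrow> real"
  assumes a: "0 < a" and c: "0 < c" and C: "0 \<le> C"
    and t: "\<And>n. 1 \<le> n \<Longrightarrow> t n \<le> C * exp (- c * real n powr a)" and t0: "\<And>n. 0 \<le> t n"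
  shows "\<exists>D\<ge>0. \<forall>n. (\<Sum>i. t (i + n)) \<le> D * exp (- (c / 2) * real n powr a)"
proof -
  define E where "E = max (t 0) C"
  have E: "0 \<le> E" using C by (simp add: E_def)
  define e where "e = (\<lambda>k. E * exp (- (c / 2) * real k powr a))"
  have sum_e: "summable e"
    unfolding e_def using c a by (intro summable_mult stretched_exponential_summable) auto
  have te: "t (i + n) \<le> e i * exp (- (c / 2) * real n powr a)" for i n
  proof -
    have "t (i + n) \<le> E * exp (- c * real (i + n) powr a)"
    proof (cases "i + n = 0")
      case True then show ?thesis by (simp add: E_def)
    next
      case False
      then have "t (i + n) \<le> C * exp (- c * real (i + n) powr a)" by (intro t) auto
      also have "\<dots> \<le> E * exp (- c * real (i + n) powr a)" by (intro mult_right_mono) (auto simp: E_def)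
      finally show ?thesis .
    qed
    also have "\<dots> \<le> E * (exp (- (c / 2) * real i powr a) * exp (- (c / 2) * real n powr a))"
    proof (intro mult_left_mono E)
      have "real i powr a \<le> real (i + n) powr a" "real n powr a \<le> real (i + n) powr a"
        using a by (auto intro!: powr_mono2)
      then have "c / 2 * (real i powr a + real n powr a) \<le> c / 2 * (2 * real (i + n) powr a)"
        using c by (intro mult_left_mono) auto
      then show "exp (- c * real (i + n) powr a) \<le> exp (- (c / 2) * real i powr a) * exp (- (c / 2) * real n powr a)"
        by (simp add: exp_add[symmetric] algebra_simps)
    qed
    finally show ?thesis by (simp add: e_def mult_ac)
  qed
  have e0: "0 \<le> e i" for i using E by (simp add: e_def)
  have "(\<Sum>i. t (i + n)) \<le> (\<Sum>i. e i * exp (- (c / 2) * real n powr a))" for n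
  proof (rule suminf_le)
    show s: "summable (\<lambda>i. e i * exp (- (c / 2) * real n powr a))" by (intro summable_mult2 sum_e)
    show "summable (\<lambda>i. t (i + n))"
      by (rule summable_comparison_test'[OF s]) (use te t0 in auto)
  qed (rule te)
  then show ?thesis
    by (intro exI[of _ "suminf e"]) (auto simp: suminf_mult2[OF sum_e, symmetric] intro!: suminf_nonneg sum_e e0)
qed

section \<open>Renewal sequences\<close>

definition renewal_fps :: "(nat \<Rightarrow> real) \<Rightarrow> real fps" where
  "renewal_fps q = inverse (1 - Abs_fps q)"

text \<open>
  \<open>q\<close> is the distribution of the waiting times; that it has total mass \<open>1\<close> follows from the
  summability of its tails.
\<close>

locale renewal_process =
  fixes q :: "nat \<Rightarrow> real" and tail :: "nat \<Rightarrow> real"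
  assumes q_nonneg: "0 \<le> q k" and q_0: "q 0 = 0" and q_1: "0 < q 1"
    and tail_def: "tail n = 1 - (\<Sum>k=0..n. q k)"
    and tail_nonneg: "0 \<le> tail n" and tail_summable: "summable tail"
begin

abbreviation "Q \<equiv> Abs_fps q"
abbreviation "U \<equiv> renewal_fps q"
abbreviation "u \<equiv> fps_nth U"

lemma U_eq: "(1 - Q) * U = 1"
  unfolding renewal_fps_def by (rule inverse_mult_eq_1') (simp add: q_0)

text \<open>
  Generating functions turn a convolution equation into the geometric series \<open>X = E / (1 - Q)\<close>.
\<close>

lemma renewal_equation_solution:
  assumes "X = E + Q * X"
  shows "X = U * E"
proof -
  have "(1 - Q) * X = E" using assms by (simp add: algebra_simps)
  then have "U * ((1 - Q) * X) = U * E" by (rule arg_cong)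
  moreover have "U * ((1 - Q) * X) = ((1 - Q) * U) * X" by (simp only: mult_ac)
  ultimately show ?thesis by (simp only: U_eq mult_1_left)
qed

lemma u_0: "u 0 = 1"
  using arg_cong[OF U_eq, of "\<lambda>f. fps_nth f 0"] by (simp add: fps_mult_nth q_0)

lemma u_rec: "0 < n \<Longrightarrow> u n = (\<Sum>k=0..n. q k * u (n - k))"
  using arg_cong[OF U_eq, of "\<lambda>f. fps_nth f n"] by (simp add: ring_distribs fps_mult_nth)

lemma u_nonneg: "0 \<le> u n"
proof (induction n rule: less_induct)
  case (less n)
  show ?case
  proof (cases "n = 0")
    case False
    then show ?thesis
      unfolding u_rec[OF False[THEN neq0_conv[THEN iffD1]]]
      by (intro sum_nonneg) (metis (no_types, lifting) less diff_less mult_nonneg_nonneg mult_zero_left neq0_conv order_refl q_0 q_nonneg)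
  qed (simp add: u_0)
qed

lemma tail_fps: "Abs_fps tail = (1 - Q) * Abs_fps (\<lambda>_. 1)"
  by (rule fps_ext) (simp add: ring_distribs fps_mult_nth tail_def)

text \<open>
  At time \<open>n\<close> some renewal is the last one so far.
\<close>

lemma renewal_identity: "(\<Sum>i=0..n. tail i * u (n - i)) = 1"
proof -
  have "Abs_fps tail * U = Abs_fps (\<lambda>_. 1)"
    using U_eq by (simp add: tail_fps mult.assoc mult.commute mult.left_commute)
  then show ?thesis by (metis (no_types, lifting) fps_mult_nth fps_nth_Abs_fps sum.cong)
qed

lemma u_le_1: "u n \<le> 1"
proof -
  have "tail 0 * u (n - 0) \<le> (\<Sum>i=0..n. tail i * u (n - i))"
    by (rule member_le_sum) (auto intro: mult_nonneg_nonneg tail_nonneg u_nonneg)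
  moreover have "tail 0 = 1" by (simp add: tail_def q_0)
  ultimately show ?thesis by (simp add: renewal_identity)
qed

text \<open>
  The coefficient at \<open>k\<close> is \<open>\<Sum>j<g. u j * q (g + k - j)\<close>, the probability that the first renewal at or
  after time \<open>g\<close> happens at \<open>g + k\<close>.
\<close>

definition overshoot :: "nat \<Rightarrow> real fps" where
  "overshoot g = fps_shift g (Q * fps_cutoff g U)"

lemma overshoot_nonneg: "0 \<le> fps_nth (overshoot g) k"
  by (auto simp: overshoot_def fps_mult_nth intro!: sum_nonneg mult_nonneg_nonneg q_nonneg u_nonneg)

text \<open>
  Splitting \<open>U\<close> at time \<open>g\<close> in \<open>(1 - Q) U = 1\<close>.
\<close>

lemma overshoot_eq:
  assumes "0 < g"
  shows "overshoot g = (1 - Q) * fps_shift g U"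
proof (rule fps_ext)
  fix n
  have "(1 - Q) * (fps_shift g U * fps_X ^ g + fps_cutoff g U) = 1"
    by (simp add: fps_shift_cutoff U_eq)
  then have "((1 - Q) * fps_shift g U) * fps_X ^ g = 1 - fps_cutoff g U + Q * fps_cutoff g U"
    by (simp add: algebra_simps)
  then have "fps_nth (((1 - Q) * fps_shift g U) * fps_X ^ g) (n + g) = fps_nth (1 - fps_cutoff g U + Q * fps_cutoff g U) (n + g)"
    by simp
  then show "fps_nth (overshoot g) n = fps_nth ((1 - Q) * fps_shift g U) n"
    using assms by (simp add: fps_X_power_mult_right_nth overshoot_def)
qed

text \<open>
  The Markov property at the first renewal at or after time \<open>g\<close>.
\<close>

lemma shift_eq:
  assumes "0 < g"
  shows "u (m + g) = (\<Sum>k=0..m. fps_nth (overshoot g) k * u (m - k))"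
proof -
  have "fps_shift g U = overshoot g * U"
    unfolding overshoot_eq[OF assms] using U_eq by (simp add: mult.assoc mult.commute mult.left_commute)
  then have "fps_nth (fps_shift g U) m = fps_nth (overshoot g * U) m" by simp
  then show ?thesis by (simp add: fps_mult_nth)
qed

definition tail_sum :: "nat \<Rightarrow> real" where
  "tail_sum m = (\<Sum>i. tail (i + m))"

lemma tail_sum_bound: "(\<Sum>i\<in>{m..<n}. tail i) \<le> tail_sum m"
  unfolding tail_sum_def by (rule sum_le_tail[OF tail_summable tail_nonneg])

text \<open>
  Multiplying \<open>overshoot_eq\<close> by the series \<open>1 / (1 - z)\<close> expresses the partial sums through the tails of
  \<open>q\<close>; the complement is then the missing part of the renewal identity at time \<open>m + g\<close>.
\<close>

lemma overshoot_sum: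
  assumes g: "0 < g"
  shows "(\<Sum>k=0..m. fps_nth (overshoot g) k) \<le> 1"
    and "1 - (\<Sum>k=0..m. fps_nth (overshoot g) k) \<le> tail_sum m"
proof -
  have "overshoot g * Abs_fps (\<lambda>_. 1) = Abs_fps tail * fps_shift g U"
    unfolding overshoot_eq[OF g] tail_fps by (simp add: mult_ac)
  then have "fps_nth (overshoot g * Abs_fps (\<lambda>_. 1)) m = fps_nth (Abs_fps tail * fps_shift g U) m" by simp
  then have *: "(\<Sum>k=0..m. fps_nth (overshoot g) k) = (\<Sum>i=0..m. tail i * u (m - i + g))"
    by (simp add: fps_mult_nth)
  have "1 = (\<Sum>i=0..m+g. tail i * u (m + g - i))" by (simp add: renewal_identity)
  also have "{0..m+g} = {0..m} \<union> {m+1..m+g}" by auto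
  also have "(\<Sum>i\<in>\<dots>. tail i * u (m + g - i)) =
      (\<Sum>i=0..m. tail i * u (m + g - i)) + (\<Sum>i=m+1..m+g. tail i * u (m + g - i))"
    by (rule sum.union_disjoint) auto
  also have "(\<Sum>i=0..m. tail i * u (m + g - i)) = (\<Sum>i=0..m. tail i * u (m - i + g))"
    by (intro sum.cong) auto
  finally have eq: "1 - (\<Sum>k=0..m. fps_nth (overshoot g) k) = (\<Sum>i=m+1..m+g. tail i * u (m + g - i))"
    using * by simp
  have "0 \<le> (\<Sum>i=m+1..m+g. tail i * u (m + g - i))"
    by (intro sum_nonneg mult_nonneg_nonneg tail_nonneg u_nonneg)
  then show "(\<Sum>k=0..m. fps_nth (overshoot g) k) \<le> 1" using eq by simp
  have "(\<Sum>i=m+1..m+g. tail i * u (m + g - i)) \<le> (\<Sum>i=m+1..m+g. tail i)"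
    by (intro sum_mono mult_left_le u_le_1 tail_nonneg)
  also have "\<dots> \<le> (\<Sum>i\<in>{m..<m+g+1}. tail i)"
    by (intro sum_mono2) (auto intro: tail_nonneg)
  also have "\<dots> \<le> tail_sum m" by (rule tail_sum_bound)
  finally show "1 - (\<Sum>k=0..m. fps_nth (overshoot g) k) \<le> tail_sum m" using eq by simp
qed

lemma u_Suc: "q 1 * u n \<le> u (Suc n)"
proof -
  have "q 1 * u (Suc n - 1) \<le> (\<Sum>k=0..Suc n. q k * u (Suc n - k))"
    by (rule member_le_sum) (auto intro: mult_nonneg_nonneg q_nonneg u_nonneg)
  then show ?thesis by (simp add: u_rec[of "Suc n"])
qed

lemma q_1_le: "q 1 \<le> 1"
  using tail_nonneg[of 1] q_0 by (simp add: tail_def)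

text \<open>
  By the renewal identity, the last renewal up to time \<open>n\<close> lies within a distance \<open>k\<close> of \<open>n\<close> with
  probability at least \<open>1 / 2\<close>, where \<open>k\<close> does not depend on \<open>n\<close>. Since \<open>q 1 > 0\<close>, from there \<open>n\<close> can
  be reached by unit steps.
\<close>

lemma u_lower: "\<exists>\<epsilon>>0. \<epsilon> \<le> 1 \<and> (\<forall>n. \<epsilon> \<le> u n)"
proof -
  have "tail_sum \<longlonglongrightarrow> 0" unfolding tail_sum_def by (rule suminf_exist_split2[OF tail_summable])
  then have "eventually (\<lambda>k. tail_sum k < 1 / 2) sequentially" by (rule order_tendstoD(2)) simp
  then obtain k where k: "tail_sum k < 1 / 2" by (auto simp: eventually_sequentially)
  have k0: "0 < k"
  proof (rule ccontr)
    assume "\<not> 0 < k"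
    moreover have "(\<Sum>i\<in>{0..<1}. tail i) \<le> tail_sum 0" by (rule tail_sum_bound)
    ultimately show False using k by (simp add: tail_def q_0)
  qed
  define \<epsilon> where "\<epsilon> = q 1 ^ k / (2 * real k)"
  have pow: "q 1 ^ i * u n \<le> u (n + i)" for n i
  proof (induction i)
    case (Suc i)
    have "q 1 ^ Suc i * u n = q 1 * (q 1 ^ i * u n)" by simp
    also have "\<dots> \<le> q 1 * u (n + i)" using q_1 by (intro mult_left_mono Suc.IH) auto
    also have "\<dots> \<le> u (n + Suc i)" using u_Suc[of "n + i"] by simp
    finally show ?case .
  qed simp
  have "\<epsilon> \<le> u n" for n
  proof -
    have "1 = (\<Sum>i=0..n. tail i * u (n - i))" by (simp add: renewal_identity)
    also have "\<dots> \<le> (\<Sum>i=0..n. (if i < k then u n / q 1 ^ k else 0) + (if k \<le> i then tail i else 0))"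
    proof (intro sum_mono)
      fix i assume i: "i \<in> {0..n}"
      show "tail i * u (n - i) \<le> (if i < k then u n / q 1 ^ k else 0) + (if k \<le> i then tail i else 0)"
      proof (cases "i < k")
        case True
        have "tail i * u (n - i) \<le> 1 * u (n - i)"
          by (intro mult_right_mono u_nonneg) (simp add: tail_def sum_nonneg q_nonneg)
        also have "q 1 ^ k * u (n - i) \<le> q 1 ^ i * u (n - i)"
          using True q_1 q_1_le by (intro mult_right_mono u_nonneg power_decreasing) auto
        then have "q 1 ^ k * u (n - i) \<le> u n"
          using pow[of i "n - i"] i by simp
        then have "1 * u (n - i) \<le> u n / q 1 ^ k"
          using q_1 by (simp add: field_simps)
        finally show ?thesis using True by simp
      next
        case False
        then show ?thesis by (simp add: mult_left_le u_le_1 tail_nonneg)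
      qed
    qed
    also have "\<dots> = (\<Sum>i=0..n. (if i < k then u n / q 1 ^ k else 0)) + (\<Sum>i=0..n. if k \<le> i then tail i else 0)"
      by (rule sum.distrib)
    also have "(\<Sum>i=0..n. (if i < k then u n / q 1 ^ k else 0)) \<le> (\<Sum>i\<in>{..<k}. u n / q 1 ^ k)"
      by (subst sum.inter_filter[symmetric], simp, intro sum_mono2) (use u_nonneg q_1 in auto)
    also have "\<dots> = real k * (u n / q 1 ^ k)" by simp
    also have "(\<Sum>i=0..n. if k \<le> i then tail i else 0) \<le> (\<Sum>i\<in>{k..<n+1}. tail i)"
      by (subst sum.inter_filter[symmetric], simp, intro sum_mono2) (auto intro: tail_nonneg)
    also have "\<dots> \<le> tail_sum k" by (rule tail_sum_bound)
    also note k
    finally show ?thesis using k0 q_1 by (simp add: \<epsilon>_def field_simps)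
  qed
  moreover have "0 < \<epsilon>" using k0 q_1 by (simp add: \<epsilon>_def)
  moreover have "\<epsilon> \<le> 1" using \<open>\<And>n. \<epsilon> \<le> u n\<close>[of 0] u_0 by simp
  ultimately show ?thesis by blast
qed

end

lemma sum_reflect_low:
  fixes f :: "nat \<Rightarrow> real"
  assumes "m \<le> n"
  shows "(\<Sum>i=0..m. f (n - i)) = (\<Sum>i\<in>{n - m..<n+1}. f i)"
  by (rule sum.reindex_bij_witness[of _ "\<lambda>i. n - i" "\<lambda>i. n - i"]) (use assms in auto)

lemma sum_reflect_high:
  fixes f :: "nat \<Rightarrow> real"
  shows "(\<Sum>i=m+1..n. f (n - i)) = (\<Sum>i\<in>{0..<n - m}. f i)"
  by (rule sum.reindex_bij_witness[of _ "\<lambda>i. n - i" "\<lambda>i. n - i"]) auto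

context rate_family begin

lemma common_rate:
  assumes "\<psi>1 \<in> \<Psi>" "\<psi>2 \<in> \<Psi>" "1 \<le> k"
  shows "\<exists>\<psi>\<in>\<Psi>. \<exists>C>0. \<forall>n. \<psi>1 (n div k) \<le> C * \<psi> n \<and> \<psi>2 (n div k) \<le> C * \<psi> n \<and> \<psi>1 n \<le> C * \<psi> n \<and> \<psi>2 n \<le> C * \<psi> n"
proof -
  obtain \<psi>3 where 3: "\<psi>3 \<in> \<Psi>" "\<And>n. \<psi>1 n \<le> \<psi>3 n" "\<And>n. \<psi>2 n \<le> \<psi>3 n"
    using directed[OF assms(1,2)] by auto
  obtain \<psi> C where \<psi>: "\<psi> \<in> \<Psi>" "0 < C" "\<And>n. \<psi>3 (n div k) \<le> C * \<psi> n"
    using slow_down[OF 3(1) assms(3)] by auto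
  have "\<psi>3 n \<le> C * \<psi> n" for n
    using antimono[OF 3(1), of "n div k" n] \<psi>(3)[of n] by simp
  then show ?thesis using \<psi> 3 by (meson order_trans)
qed

text \<open>
  Two renewal processes, one of them \<open>g\<close> ahead: the one behind runs until it reaches or passes the other.
  With probability \<open>u g \<ge> \<epsilon>\<close> they meet and cancel; otherwise they have exchanged their roles, and
  the new gap is the overshoot. Hence the differences \<open>\<bar>u (m + g) - u m\<bar>\<close> satisfy the renewal inequality
  with the overshoot, without its atom at \<open>0\<close>, as kernel.
\<close>

lemma renewal_difference:
  assumes "renewal_process q tail" and \<psi>: "\<psi> \<in> \<Psi>" and C: "0 \<le> C"
    and t: "\<And>m. renewal_process.tail_sum tail m \<le> C * \<psi> m"
  shows "\<exists>\<psi>'\<in>\<Psi>. \<exists>K\<ge>0. \<forall>g m. \<bar>fps_nth (renewal_fps q) (m + g) - fps_nth (renewal_fps q) m\<bar> \<le> K * \<psi>' m"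
proof -
  interpret renewal_process q tail by fact
  obtain \<epsilon> where \<epsilon>: "0 < \<epsilon>" "\<epsilon> \<le> 1" "\<And>n. \<epsilon> \<le> u n" using u_lower by auto
  define y where "y = (\<lambda>g k. if g = 0 then 0 else fps_nth (overshoot g) k)"
  define Z where "Z = (\<lambda>g m. \<bar>u (m + g) - u m\<bar>)"
  have split0: "(\<Sum>k=0..m. f k) = f 0 + (\<Sum>k=1..m. f k)" for f :: "nat \<Rightarrow> real" and m
    by (simp add: sum.atLeast_Suc_atMost)
  have h0: "fps_nth (overshoot g) 0 = u g" if "0 < g" for g
    using shift_eq[OF that, of 0] u_0 by simp
  have "delay_kernel (1 - \<epsilon>) (\<lambda>j. C * \<psi> j) y"
    unfolding delay_kernel_def
  proof (intro conjI allI)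
    fix g k show "0 \<le> y g k" by (simp add: y_def overshoot_nonneg)
  next
    fix g m show "(\<Sum>k=1..m. y g k) \<le> 1 - \<epsilon>"
    proof (cases "g = 0")
      case False
      then have "(\<Sum>k=0..m. fps_nth (overshoot g) k) \<le> 1" by (intro overshoot_sum) auto
      then show ?thesis using False \<epsilon>(3)[of g] by (simp add: y_def split0 h0)
    qed (use \<epsilon> in \<open>simp add: y_def\<close>)
  next
    fix g j m show "(\<Sum>k=j+1..m. y g k) \<le> C * \<psi> j"
    proof (cases "g = 0 \<or> m < j + 1")
      case False
      then have g: "0 < g" by simp
      have "{0..m} = {0..j} \<union> {j+1..m}" using False by auto
      then have "(\<Sum>k=0..m. fps_nth (overshoot g) k) = (\<Sum>k=0..j. fps_nth (overshoot g) k) + (\<Sum>k=j+1..m. fps_nth (overshoot g) k)"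
        by (simp only:) (rule sum.union_disjoint, auto)
      then have "(\<Sum>k=j+1..m. fps_nth (overshoot g) k) \<le> tail_sum j"
        using overshoot_sum(1)[OF g, of m] overshoot_sum(2)[OF g, of j] by linarith
      then show ?thesis using g t[of j] by (simp add: y_def)
    qed (use C pos[OF \<psi>, of j] in \<open>auto simp: y_def\<close>)
  qed
  moreover have "0 \<le> Z g m \<and> Z g m \<le> 1" for g m
    using u_nonneg[of m] u_nonneg[of "m + g"] u_le_1[of m] u_le_1[of "m+g"] by (auto simp: Z_def)
  moreover have "Z g m \<le> C * \<psi> m + (\<Sum>k=1..m. y g k * Z k (m - k))" for g m
  proof (cases "g = 0")
    case True
    then show ?thesis using C pos[OF \<psi>, of m] by (simp add: Z_def y_def)
  next
    case False
    then have g: "0 < g" by simp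
    let ?h = "fps_nth (overshoot g)"
    \<comment> \<open>The last term is the probability of an overshoot beyond the present time.\<close>
    have "u (m + g) - u m = (\<Sum>k=0..m. ?h k * (u (m - k) - u m)) - (1 - (\<Sum>k=0..m. ?h k)) * u m"
      unfolding shift_eq[OF g] by (simp add: algebra_simps sum_subtractf sum_distrib_left)
    also have "(\<Sum>k=0..m. ?h k * (u (m - k) - u m)) = (\<Sum>k=1..m. ?h k * (u (m - k) - u m))"
      unfolding split0 by simp
    finally have "Z g m \<le> \<bar>\<Sum>k=1..m. ?h k * (u (m - k) - u m)\<bar> + \<bar>(1 - (\<Sum>k=0..m. ?h k)) * u m\<bar>"
      unfolding Z_def by (simp only: abs_triangle_ineq4)
    also have "\<bar>(1 - (\<Sum>k=0..m. ?h k)) * u m\<bar> \<le> tail_sum m * 1"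
      unfolding abs_mult using overshoot_sum[OF g, of m] u_nonneg[of m] u_le_1[of m]
      by (intro mult_mono) auto
    also have "\<bar>\<Sum>k=1..m. ?h k * (u (m - k) - u m)\<bar> \<le> (\<Sum>k=1..m. \<bar>?h k * (u (m - k) - u m)\<bar>)"
      by (rule sum_abs)
    also have "\<dots> = (\<Sum>k=1..m. y g k * Z k (m - k))"
      using g by (intro sum.cong) (auto simp: y_def Z_def abs_mult overshoot_nonneg abs_minus_commute)
    finally show ?thesis using t[of m] by simp
  qed
  moreover have e: "0 \<le> 1 - \<epsilon>" "1 - \<epsilon> < 1" using \<epsilon> by auto
  obtain \<psi>' where \<psi>': "\<psi>' \<in> \<Psi>" "\<forall>A\<ge>0. \<exists>K\<ge>0. renewal_dominated (1 - \<epsilon>) C \<psi> A K \<psi>'"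
    using renewal_inequality[OF \<psi> e C] by blast
  moreover obtain K where "0 \<le> K" "renewal_dominated (1 - \<epsilon>) C \<psi> C K \<psi>'"
    using \<psi>'(2) C by blast
  ultimately have "\<forall>g m. Z g m \<le> K * \<psi>' m" unfolding renewal_dominated_def by blast
  then show ?thesis using \<psi>'(1) \<open>0 \<le> K\<close> by (auto simp: Z_def)
qed

text \<open>
  The coefficients of \<open>(P\<^sub>1 - P\<^sub>2) U\<close> compare two delayed renewal processes. Since the two delays have
  the same mass, each coefficient is a sum of differences of \<open>u\<close> weighted with the delays, up to the tails
  of the delays. Convolution with the tails of \<open>q\<close>, which are summable at the right rate, preserves this rate:
  one of the two factors always gets at least half of the time.
\<close>

lemma renewal_coupling:
  assumes rp: "renewal_process q tail" and \<psi>: "\<psi> \<in> \<Psi>" and C: "0 \<le> C"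
    and t: "\<And>m. renewal_process.tail_sum tail m \<le> C * \<psi> m"
    and \<psi>d: "\<psi>d \<in> \<Psi>"
  shows "\<exists>\<psi>'\<in>\<Psi>. \<forall>p1 p2 X D. 0 \<le> D \<longrightarrow> (\<forall>k. 0 \<le> p1 k \<and> 0 \<le> p2 k) \<longrightarrow>
     (\<forall>n. 0 \<le> X - (\<Sum>k=0..n. p1 k) \<and> X - (\<Sum>k=0..n. p1 k) \<le> D * \<psi>d n) \<longrightarrow>
     (\<forall>n. 0 \<le> X - (\<Sum>k=0..n. p2 k) \<and> X - (\<Sum>k=0..n. p2 k) \<le> D * \<psi>d n) \<longrightarrow>
     (\<exists>K\<ge>0. \<forall>n. (\<Sum>i=0..n. \<bar>fps_nth ((Abs_fps p1 - Abs_fps p2) * renewal_fps q) i\<bar> * tail (n - i)) \<le> K * \<psi>' n)"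
proof -
  interpret renewal_process q tail by fact
  obtain \<psi>1 K1 where 1: "\<psi>1 \<in> \<Psi>" "0 \<le> K1" "\<And>g m. \<bar>u (m + g) - u m\<bar> \<le> K1 * \<psi>1 m"
    using renewal_difference[OF rp \<psi> C t] by auto
  obtain \<psi>2 C2 where 2: "\<psi>2 \<in> \<Psi>" "0 < C2" "\<And>n. \<psi>1 (n div 2) \<le> C2 * \<psi>2 n" "\<And>n. \<psi>d (n div 2) \<le> C2 * \<psi>2 n"
      "\<And>n. \<psi>d n \<le> C2 * \<psi>2 n"
    using common_rate[OF 1(1) \<psi>d, of 2] by fastforce
  obtain \<psi>3 C3 where 3: "\<psi>3 \<in> \<Psi>" "0 < C3" "\<And>n. \<psi>2 (n div 2) \<le> C3 * \<psi>3 n" "\<And>n. \<psi> (n div 2) \<le> C3 * \<psi>3 n"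
    using common_rate[OF 2(1) \<psi>, of 2] by fastforce
  show ?thesis
  proof (intro bexI[OF _ 3(1)] allI impI)
    fix p1 p2 :: "nat \<Rightarrow> real" and X D :: real
    assume D: "0 \<le> D" and p: "\<forall>k. 0 \<le> p1 k \<and> 0 \<le> p2 k"
      and t1: "\<forall>n. 0 \<le> X - (\<Sum>k=0..n. p1 k) \<and> X - (\<Sum>k=0..n. p1 k) \<le> D * \<psi>d n"
      and t2: "\<forall>n. 0 \<le> X - (\<Sum>k=0..n. p2 k) \<and> X - (\<Sum>k=0..n. p2 k) \<le> D * \<psi>d n"
    have X: "0 \<le> X" using t1[rule_format, of 0] p[rule_format, of 0] by simp
    define w where "w = fps_nth ((Abs_fps p1 - Abs_fps p2) * U)"
    have half: "{0..n} = {0..n div 2} \<union> {n div 2 + 1..n}" for n :: nat by auto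
    have conv: "(\<Sum>k=0..n. p k * \<bar>u (n - k) - u n\<bar>) \<le> (X * K1 + D) * C2 * \<psi>2 n"
      if p: "\<forall>k. 0 \<le> p k" and tt: "\<forall>n. 0 \<le> X - (\<Sum>k=0..n. p k) \<and> X - (\<Sum>k=0..n. p k) \<le> D * \<psi>d n"
      for p n
    proof -
      have "(\<Sum>k=0..n. p k * \<bar>u (n - k) - u n\<bar>) =
        (\<Sum>k=0..n div 2. p k * \<bar>u (n - k) - u n\<bar>) + (\<Sum>k=n div 2 + 1..n. p k * \<bar>u (n - k) - u n\<bar>)"
        by (subst half) (intro sum.union_disjoint, auto)
      also have "(\<Sum>k=0..n div 2. p k * \<bar>u (n - k) - u n\<bar>) \<le> (\<Sum>k=0..n div 2. p k * (K1 * \<psi>1 (n div 2)))"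
      proof (intro sum_mono mult_left_mono)
        fix k assume k: "k \<in> {0..n div 2}"
        have "\<bar>u (n - k) - u n\<bar> \<le> K1 * \<psi>1 (n - k)"
          using 1(3)[of "n - k" k] k by (simp add: abs_minus_commute)
        also have "\<dots> \<le> K1 * \<psi>1 (n div 2)"
          using k 1(2) by (intro mult_left_mono antimono[OF 1(1)]) auto
        finally show "\<bar>u (n - k) - u n\<bar> \<le> K1 * \<psi>1 (n div 2)" .
      qed (use p in auto)
      also have "\<dots> = (\<Sum>k=0..n div 2. p k) * (K1 * \<psi>1 (n div 2))" by (simp add: sum_distrib_right)
      also have "\<dots> \<le> X * (K1 * \<psi>1 (n div 2))"
        using tt[rule_format, of "n div 2"] 1(2) pos[OF 1(1), of "n div 2"] by (intro mult_right_mono) auto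
      also have "\<dots> \<le> X * (K1 * (C2 * \<psi>2 n))" by (intro mult_left_mono X 1 2)
      also have "(\<Sum>k=n div 2 + 1..n. p k * \<bar>u (n - k) - u n\<bar>) \<le> (\<Sum>k=n div 2 + 1..n. p k)"
      proof (intro sum_mono mult_left_le)
        fix k show "\<bar>u (n - k) - u n\<bar> \<le> 1"
          using u_nonneg[of n] u_nonneg[of "n - k"] u_le_1[of n] u_le_1[of "n-k"] by auto
      qed (use p in auto)
      also have "\<dots> \<le> D * \<psi>d (n div 2)"
      proof -
        have "(\<Sum>k=0..n. p k) = (\<Sum>k=0..n div 2. p k) + (\<Sum>k=n div 2 + 1..n. p k)"
          by (subst half) (intro sum.union_disjoint, auto)
        then show ?thesis using tt[rule_format, of n] tt[rule_format, of "n div 2"] by linarith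
      qed
      also have "\<dots> \<le> D * (C2 * \<psi>2 n)" by (intro mult_left_mono D 2)
      finally show ?thesis by (simp add: algebra_simps)
    qed
    have w: "\<bar>w n\<bar> \<le> (2 * X * K1 + 3 * D) * C2 * \<psi>2 n" for n
    proof -
      let ?d = "\<lambda>k. p1 k - p2 k"
      have "w n = (\<Sum>k=0..n. ?d k * (u (n - k) - u n)) + u n * (\<Sum>k=0..n. ?d k)"
        by (simp add: w_def fps_mult_nth algebra_simps sum_subtractf sum.distrib sum_distrib_left)
      then have "\<bar>w n\<bar> \<le> \<bar>\<Sum>k=0..n. ?d k * (u (n - k) - u n)\<bar> + \<bar>u n * (\<Sum>k=0..n. ?d k)\<bar>"
        by (simp add: abs_triangle_ineq)
      also have "\<bar>u n * (\<Sum>k=0..n. ?d k)\<bar> \<le> 1 * (D * \<psi>d n)"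
        unfolding abs_mult using u_nonneg[of n] u_le_1[of n] t1[rule_format, of n] t2[rule_format, of n]
        by (intro mult_mono) (auto simp: sum_subtractf)
      also have "\<dots> \<le> D * (C2 * \<psi>2 n)" by (simp add: mult_left_mono D 2)
      also have "\<bar>\<Sum>k=0..n. ?d k * (u (n - k) - u n)\<bar> \<le> (\<Sum>k=0..n. \<bar>?d k * (u (n - k) - u n)\<bar>)"
        by (rule sum_abs)
      also have "\<dots> \<le> (\<Sum>k=0..n. p1 k * \<bar>u (n - k) - u n\<bar> + p2 k * \<bar>u (n - k) - u n\<bar>)"
      proof (intro sum_mono)
        fix k
        have "\<bar>?d k\<bar> \<le> p1 k + p2 k" using p[rule_format, of k] by auto
        then show "\<bar>?d k * (u (n - k) - u n)\<bar> \<le> p1 k * \<bar>u (n - k) - u n\<bar> + p2 k * \<bar>u (n - k) - u n\<bar>"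
          unfolding abs_mult distrib_right[symmetric] by (intro mult_right_mono) auto
      qed
      also have "\<dots> \<le> (X * K1 + D) * C2 * \<psi>2 n + (X * K1 + D) * C2 * \<psi>2 n"
        unfolding sum.distrib using p t1 t2 by (intro add_mono conv) auto
      finally show ?thesis by (simp add: algebra_simps)
    qed
    define V where "V = (2 * X * K1 + 3 * D) * C2"
    have V0: "0 \<le> V" using X 1 D 2 by (simp add: V_def)
    define K where "K = V * C3 * tail_sum 0 + V * \<psi>2 0 * C * C3"
    have ts0: "0 \<le> tail_sum 0" using tail_sum_bound[of 0 0] by simp
    have "(\<Sum>i=0..n. \<bar>w i\<bar> * tail (n - i)) \<le> K * \<psi>3 n" for n
    proof -
      have "(\<Sum>i=0..n. \<bar>w i\<bar> * tail (n - i)) =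
         (\<Sum>i=0..n div 2. \<bar>w i\<bar> * tail (n - i)) + (\<Sum>i=n div 2 + 1..n. \<bar>w i\<bar> * tail (n - i))"
        by (subst half) (intro sum.union_disjoint, auto)
      also have "(\<Sum>i=0..n div 2. \<bar>w i\<bar> * tail (n - i)) \<le> (\<Sum>i=0..n div 2. V * \<psi>2 0 * tail (n - i))"
      proof (intro sum_mono mult_right_mono tail_nonneg)
        fix i show "\<bar>w i\<bar> \<le> V * \<psi>2 0"
          using w[of i] mult_left_mono[OF antimono[OF 2(1), of 0 i] V0] by (simp add: V_def)
      qed
      also have "\<dots> = V * \<psi>2 0 * (\<Sum>i=0..n div 2. tail (n - i))" by (simp add: sum_distrib_left)
      also have "(\<Sum>i=0..n div 2. tail (n - i)) = (\<Sum>i\<in>{n - n div 2..<n+1}. tail i)"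
        by (rule sum_reflect_low) simp
      also have "V * \<psi>2 0 * \<dots> \<le> V * \<psi>2 0 * (C * (C3 * \<psi>3 n))"
      proof (intro mult_left_mono)
        have "(\<Sum>i\<in>{n - n div 2..<n+1}. tail i) \<le> (\<Sum>i\<in>{n div 2..<n+1}. tail i)"
          by (intro sum_mono2) (auto intro: tail_nonneg)
        also have "\<dots> \<le> tail_sum (n div 2)" by (rule tail_sum_bound)
        also have "\<dots> \<le> C * \<psi> (n div 2)" by (rule t)
        also have "\<dots> \<le> C * (C3 * \<psi>3 n)" by (intro mult_left_mono C 3)
        finally show "(\<Sum>i\<in>{n - n div 2..<n+1}. tail i) \<le> C * (C3 * \<psi>3 n)" .
      qed (use V0 pos[OF 2(1), of 0] in auto)
      also have "(\<Sum>i=n div 2 + 1..n. \<bar>w i\<bar> * tail (n - i)) \<le> (\<Sum>i=n div 2 + 1..n. V * (C3 * \<psi>3 n) * tail (n - i))"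
      proof (intro sum_mono mult_right_mono tail_nonneg)
        fix i assume i: "i \<in> {n div 2 + 1..n}"
        have "\<bar>w i\<bar> \<le> V * \<psi>2 i" using w by (simp add: V_def)
        also have "\<dots> \<le> V * \<psi>2 (n div 2)" using i by (intro mult_left_mono antimono[OF 2(1)] V0) auto
        also have "\<dots> \<le> V * (C3 * \<psi>3 n)" by (intro mult_left_mono V0 3)
        finally show "\<bar>w i\<bar> \<le> V * (C3 * \<psi>3 n)" .
      qed
      also have "\<dots> = V * (C3 * \<psi>3 n) * (\<Sum>i=n div 2 + 1..n. tail (n - i))" by (simp add: sum_distrib_left)
      also have "\<dots> \<le> V * (C3 * \<psi>3 n) * tail_sum 0"
      proof (intro mult_left_mono)
        have "(\<Sum>i=n div 2 + 1..n. tail (n - i)) = (\<Sum>i\<in>{0..<n - n div 2}. tail i)"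
          by (rule sum_reflect_high)
        then show "(\<Sum>i=n div 2 + 1..n. tail (n - i)) \<le> tail_sum 0" by (simp only: tail_sum_bound)
      qed (use V0 3(2) pos[OF 3(1), of n] in auto)
      finally show ?thesis by (simp add: K_def algebra_simps)
    qed
    moreover have "0 \<le> K" using V0 3 C ts0 pos[OF 2(1), of 0] by (simp add: K_def)
    ultimately show "\<exists>K\<ge>0. \<forall>n. (\<Sum>i=0..n. \<bar>fps_nth ((Abs_fps p1 - Abs_fps p2) * U) i\<bar> * tail (n - i)) \<le> K * \<psi>3 n"
      unfolding w_def by blast
  qed
qed

end

section \<open>Systems that drain\<close>

text \<open>
  \<open>M n\<close> is the mass left in the system at time \<open>n\<close> and \<open>B k\<close> the mass that arrives at the base at time \<open>k\<close>.
  A mass that arrives at time \<open>k\<close> is still on its excursion at time \<open>n\<close> in a proportion at most \<open>C * t (n - k)\<close>,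
  and \<open>I n\<close> bounds what has never visited the base. A fraction \<open>c\<close> of each arrival leaves the
  system within the next \<open>W\<close> steps.
\<close>

definition draining :: "(nat \<Rightarrow> real) \<Rightarrow> real \<Rightarrow> real \<Rightarrow> nat \<Rightarrow> (nat \<Rightarrow> real) \<Rightarrow> (nat \<Rightarrow> real) \<Rightarrow> (nat \<Rightarrow> real) \<Rightarrow> bool" where
  "draining t C c W M B I \<longleftrightarrow>
     antimono M \<and> (\<forall>n. 0 \<le> M n) \<and> (\<forall>n. 0 \<le> B n) \<and> (\<forall>n. 0 \<le> I n) \<and>
     (\<forall>n. M n \<le> I n + C * (\<Sum>k=1..n. t (n - k) * B k)) \<and>
     (\<forall>k\<ge>1. c * B k \<le> M k - M (k + W))"

text \<open>
  A sum of losses over windows of length \<open>W\<close> counts each loss at most \<open>W\<close> times.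
\<close>

lemma sum_window_telescope:
  fixes M :: "nat \<Rightarrow> real"
  assumes M: "antimono M" and xy: "x \<le> y"
  shows "(\<Sum>k=x+1..y. M k - M (k + W)) \<le> real W * (M x - M (y + W))"
proof -
  have "(\<Sum>k=x+1..y. M k - M (k + W)) = (\<Sum>k=x+1..y. \<Sum>i<W. M (k + i) - M (k + Suc i))"
    by (intro sum.cong refl) (simp only: sum_lessThan_telescope'[where f = "\<lambda>i. M (_ + i)"] add_0_right)
  also have "\<dots> = (\<Sum>i<W. \<Sum>k=x+1..y. M (k + i) - M (Suc k + i))"
    by (subst sum.swap) simp
  also have "\<dots> = (\<Sum>i<W. M (x + 1 + i) - M (y + 1 + i))"
  proof (intro sum.cong refl)
    fix i
    have "(\<Sum>k=x+1..y. M (k + i) - M (Suc k + i)) = (\<Sum>k=x+1..<y+1. - (M (Suc k + i) - M (k + i)))"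
      by (intro sum.cong) auto
    also have "\<dots> = - (\<Sum>k=x+1..<y+1. M (Suc k + i) - M (k + i))"
      by (rule sum_negf)
    also have "\<dots> = M (x + 1 + i) - M (y + 1 + i)"
      using xy by (subst sum_Suc_diff'[where f = "\<lambda>k. M (k + i)"]) auto
    finally show "(\<Sum>k=x+1..y. M (k + i) - M (Suc k + i)) = M (x + 1 + i) - M (y + 1 + i)" .
  qed
  also have "\<dots> \<le> (\<Sum>i<W. M x - M (y + W))"
    by (intro sum_mono diff_mono antimonoD[OF M]) auto
  finally show ?thesis by simp
qed

lemma sum_swap_delay:
  fixes f :: "nat \<Rightarrow> nat \<Rightarrow> real"
  shows "(\<Sum>m=j..N. \<Sum>k=1..m. f k (m - k)) = (\<Sum>k=1..N. \<Sum>i=j-k..N-k. f k i)"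
proof -
  have "(\<Sum>m=j..N. \<Sum>k=1..m. f k (m - k)) = (\<Sum>(m,k)\<in>(SIGMA m:{j..N}. {1..m}). f k (m - k))"
    by (subst sum.Sigma) auto
  also have "\<dots> = (\<Sum>(k,i)\<in>(SIGMA k:{1..N}. {j-k..N-k}). f k i)"
    by (rule sum.reindex_bij_witness[of _ "\<lambda>(k,i). (k + i, k)" "\<lambda>(m,k). (k, m - k)"]) auto
  also have "\<dots> = (\<Sum>k=1..N. \<Sum>i=j-k..N-k. f k i)"
    by (subst sum.Sigma) auto
  finally show ?thesis .
qed

text \<open>
  The threshold \<open>G\<close> separates short from long excursions.
\<close>

locale drain_kernel =
  fixes t :: "nat \<Rightarrow> real" and C c :: real and W G :: nat
  assumes t_nonneg: "0 \<le> t n" and t_antimono: "antimono t" and t_summable: "summable t"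
    and C: "0 \<le> C" and c: "0 < c" and W: "1 \<le> W"
    and G: "C / c * (\<Sum>i. t (i + G)) \<le> 1 / 2"
begin

definition "a = C / c"
definition "b = a * t 0 * real W"
definition "\<rho> = (1 / 2 + b) / (1 + b)"
text \<open>
  The kernel of the inequality \<open>draining_recursion\<close>: an excursion of length \<open>i \<ge> G\<close> yields the delay
  \<open>W + i\<close>, and all shorter excursions together contribute the atom at \<open>W + G\<close>.
\<close>

definition y :: "nat \<Rightarrow> real" where
  "y k = (if W + G \<le> k then a * t (k - W) else 0) / (1 + b) + (if k = W + G then b / (1 + b) else 0)"

lemma a: "0 \<le> a" using C c by (simp add: a_def)
lemma b: "0 \<le> b" using a t_nonneg[of 0] by (simp add: b_def)
lemma \<rho>: "0 \<le> \<rho>" "\<rho> < 1" using b by (auto simp: \<rho>_def divide_less_eq)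
lemma y_nonneg: "0 \<le> y k" using a b t_nonneg by (simp add: y_def)

lemma t_sum_bound: "(\<Sum>i\<in>{m..<n}. t i) \<le> (\<Sum>i. t (i + m))"
  by (rule sum_le_tail[OF t_summable t_nonneg])

lemma y_sum_late:
  assumes "W + G \<le> j"
  shows "(\<Sum>k=j+1..m. y k) \<le> a * (\<Sum>i. t (i + (j - W)))"
proof -
  have "(\<Sum>k=j+1..m. y k) \<le> (\<Sum>k=j+1..m. a * t (k - W))"
    using assms a b t_nonneg by (intro sum_mono) (auto simp: y_def divide_le_eq mult_left_le ring_distribs)
  also have "\<dots> = a * (\<Sum>k=j+1..m. t (k - W))" by (simp add: sum_distrib_left)
  also have "(\<Sum>k=j+1..m. t (k - W)) = (\<Sum>i\<in>{j+1-W..<m+1-W}. t i)"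
    by (rule sum.reindex_bij_witness[of _ "\<lambda>i. i + W" "\<lambda>i. i - W"]) (use assms in auto)
  also have "\<dots> \<le> (\<Sum>i\<in>{j-W..<m+1-W}. t i)"
    by (intro sum_mono2) (auto intro: t_nonneg)
  also have "\<dots> \<le> (\<Sum>i. t (i + (j - W)))" by (rule t_sum_bound)
  finally show ?thesis using a by (simp add: mult_left_mono)
qed

lemma y_sum: "(\<Sum>k\<in>{j..m}. y k) \<le> \<rho>"
proof -
  have "(\<Sum>k\<in>{j..m}. y k) = (\<Sum>k\<in>{j..m}. if W + G \<le> k then a * t (k - W) else 0) / (1 + b) + (\<Sum>k\<in>{j..m}. if k = W + G then b / (1 + b) else 0)"
    by (simp add: y_def sum.distrib sum_divide_distrib)
  also have "(\<Sum>k\<in>{j..m}. if W + G \<le> k then a * t (k - W) else 0) \<le> 1 / 2"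
  proof -
    have "(\<Sum>k\<in>{j..m}. if W + G \<le> k then a * t (k - W) else 0) \<le> (\<Sum>k\<in>{W+G..<m+1+W}. a * t (k - W))"
      by (subst sum.inter_filter[symmetric], simp, intro sum_mono2) (use a t_nonneg in auto)
    also have "\<dots> = (\<Sum>i\<in>{G..<m+1}. a * t i)"
      by (rule sum.reindex_bij_witness[of _ "\<lambda>i. i + W" "\<lambda>i. i - W"]) auto
    also have "\<dots> = a * (\<Sum>i\<in>{G..<m+1}. t i)" by (rule sum_distrib_left[symmetric])
    also have "\<dots> \<le> a * (\<Sum>i. t (i + G))" by (intro mult_left_mono t_sum_bound a)
    finally show ?thesis using G unfolding a_def by linarith
  qed
  also have "(\<Sum>k\<in>{j..m}. if k = W + G then b / (1 + b) else 0) \<le> b / (1 + b)"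
    using b by (simp add: sum.delta)
  finally show ?thesis using b by (simp add: \<rho>_def add_divide_distrib divide_right_mono)
qed

text \<open>
  The arrivals in the last \<open>G\<close> steps before \<open>n = m - W\<close> are bounded by the mass that they lose
  afterwards, thus by \<open>b (M (n - G) - M m)\<close>. Moving the negative term to the left gives the factor \<open>1 + b\<close>
  and hence a coefficient \<open>b / (1 + b) < 1\<close>, however large the constants are.
\<close>

lemma draining_recursion:
  assumes d: "draining t C c W M B I" and m: "W + G \<le> m"
  shows "M m \<le> I (m - W) + (\<Sum>k=1..m. y k * M (m - k))"
proof -
  have M: "antimono M" "\<And>n. 0 \<le> M n" and B: "\<And>n. 0 \<le> B n" and I: "\<And>n. 0 \<le> I n"
    and rec: "\<And>n. M n \<le> I n + C * (\<Sum>k=1..n. t (n - k) * B k)"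
    and cB: "\<And>k. 1 \<le> k \<Longrightarrow> c * B k \<le> M k - M (k + W)"
    using d by (auto simp: draining_def)
  define n where "n = m - W"
  have n: "m = n + W" "G \<le> n" using m by (auto simp: n_def)
  have CB: "C * B k \<le> a * (M k - M (k + W))" if "1 \<le> k" for k
    using mult_left_mono[OF cB[OF that] a] c by (simp add: a_def)
  have CB': "C * B k \<le> a * M k" if "1 \<le> k" for k
    using CB[OF that] mult_left_mono[OF _ a, of "M k - M (k + W)" "M k"] M(2)[of "k + W"] by simp
  have "{1..n} = {1..n-G} \<union> {n-G+1..n}" using n by auto
  then have "C * (\<Sum>k=1..n. t (n - k) * B k) = C * (\<Sum>k\<in>{1..n-G} \<union> {n-G+1..n}. t (n - k) * B k)" by simp
  also have "\<dots> = (\<Sum>k=1..n-G. t (n - k) * (C * B k)) + (\<Sum>k=n-G+1..n. t (n - k) * (C * B k))"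
    by (subst sum.union_disjoint) (auto simp: ring_distribs sum_distrib_left mult_ac)
  also have "(\<Sum>k=1..n-G. t (n - k) * (C * B k)) \<le> (\<Sum>k=1..n-G. t (n - k) * (a * M k))"
    by (intro sum_mono mult_left_mono CB' t_nonneg) auto
  also have "(\<Sum>k=n-G+1..n. t (n - k) * (C * B k)) \<le> (\<Sum>k=n-G+1..n. t 0 * (a * (M k - M (k + W))))"
    using C B t_nonneg by (intro sum_mono mult_mono CB antimonoD[OF t_antimono]) auto
  also have "\<dots> = a * t 0 * (\<Sum>k=n-G+1..n. M k - M (k + W))"
    by (simp add: sum_distrib_left mult_ac)
  also have "\<dots> \<le> a * t 0 * (real W * (M (n - G) - M (n + W)))"
    using a t_nonneg M by (intro mult_left_mono sum_window_telescope) auto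
  also have "\<dots> = b * (M (n - G) - M (n + W))" by (simp add: b_def)
  finally have "M n \<le> I n + (\<Sum>k=1..n-G. t (n - k) * (a * M k)) + b * (M (n - G) - M (n + W))"
    using rec[of n] by simp
  then have "(1 + b) * M (n + W) \<le> I n + (\<Sum>k=1..n-G. t (n - k) * (a * M k)) + b * M (n - G)"
    using antimonoD[OF M(1), of n "n + W"] by (simp add: algebra_simps)
  then have "M (n + W) \<le> (I n + (\<Sum>k=1..n-G. t (n - k) * (a * M k)) + b * M (n - G)) / (1 + b)"
    using b by (simp add: le_divide_eq mult.commute)
  also have "\<dots> = I n / (1 + b) + ((\<Sum>k=1..n-G. t (n - k) * (a * M k)) / (1 + b) + b * M (n - G) / (1 + b))"
    by (simp add: add_divide_distrib)
  also have "I n / (1 + b) \<le> I n"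
    using I[of n] b by (simp add: divide_le_eq mult_left_le ring_distribs)
  also have "(\<Sum>k=1..n-G. t (n - k) * (a * M k)) / (1 + b) + b * M (n - G) / (1 + b) \<le> (\<Sum>k=1..m. y k * M (m - k))"
  proof -
    have "(\<Sum>k=1..m. y k * M (m - k)) =
        (\<Sum>k=1..m. (if W + G \<le> k then a * t (k - W) * M (m - k) / (1 + b) else 0)) +
        (\<Sum>k=1..m. (if k = W + G then b / (1 + b) * M (m - k) else 0))"
      unfolding sum.distrib[symmetric] by (intro sum.cong refl) (auto simp: y_def ring_distribs)
    also have "(\<Sum>k=1..m. (if k = W + G then b / (1 + b) * M (m - k) else 0)) = b * M (n - G) / (1 + b)"
      using W m by (simp add: sum.delta n_def)
    also have "(\<Sum>k=1..m. (if W + G \<le> k then a * t (k - W) * M (m - k) / (1 + b) else 0)) =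
        (\<Sum>k\<in>{W+G..m}. a * t (k - W) * M (m - k) / (1 + b))"
      using W by (subst sum.inter_filter[symmetric], simp, intro sum.cong) auto
    also have "\<dots> = (\<Sum>k\<in>{0..n-G}. t (n - k) * (a * M k) / (1 + b))"
      by (rule sum.reindex_bij_witness[of _ "\<lambda>i. m - i" "\<lambda>i. m - i"]) (use n in auto)
    finally have eq: "(\<Sum>k=1..m. y k * M (m - k)) =
      (\<Sum>k\<in>{0..n-G}. t (n - k) * (a * M k) / (1 + b)) + b * M (n - G) / (1 + b)" .
    have "(\<Sum>k=1..n-G. t (n - k) * (a * M k) / (1 + b)) \<le> (\<Sum>k\<in>{0..n-G}. t (n - k) * (a * M k) / (1 + b))"
      using a b M t_nonneg by (intro sum_mono2) auto
    then show ?thesis unfolding eq by (simp add: sum_divide_distrib)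
  qed
  finally show ?thesis by (simp add: n)
qed

end

context rate_family begin

text \<open>
  The renewal inequality for the mass itself and, in the second part, for its tail sums: these satisfy
  the same inequality once they are known to be finite. The tail sums matter because the
  residuals of \<open>\<kappa>\<close> are summed in the coupling argument. All constants but \<open>K\<close> are chosen from \<open>t\<close>, \<open>C\<close>, \<open>c\<close>
  and \<open>W\<close> alone.
\<close>

lemma drain_rate:
  assumes t: "\<And>n. 0 \<le> t n" "antimono t" "summable t" and C: "0 \<le> C" and c: "0 < c" and W: "1 \<le> W"
    and \<psi>: "\<psi> \<in> \<Psi>" and E: "0 \<le> E" and tail: "\<And>n. (\<Sum>i. t (i + n)) \<le> E * \<psi> n"
  shows "\<exists>\<psi>'\<in>\<Psi>. \<forall>M B I D. draining t C c W M B I \<longrightarrow> 0 \<le> D \<longrightarrow>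
     ((\<forall>n. I n \<le> D * \<psi> n) \<longrightarrow> (\<exists>K\<ge>0. \<forall>n. M n \<le> K * \<psi>' n)) \<and>
     (summable I \<longrightarrow> (\<forall>n. (\<Sum>i. I (i + n)) \<le> D * \<psi> n) \<longrightarrow>
        summable M \<and> (\<exists>K\<ge>0. \<forall>n. (\<Sum>i. M (i + n)) \<le> K * \<psi>' n))"
proof -
  have "(\<lambda>k. C / c * (\<Sum>i. t (i + k))) \<longlonglongrightarrow> C / c * 0"
    by (intro tendsto_intros suminf_exist_split2 t)
  then have "eventually (\<lambda>k. C / c * (\<Sum>i. t (i + k)) < 1 / 2) sequentially"
    by (rule order_tendstoD(2)) simp
  then obtain G where G: "C / c * (\<Sum>i. t (i + G)) < 1 / 2" by (auto simp: eventually_sequentially)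
  interpret drain_kernel t C c W G
    using t C c W G by unfold_locales auto
  obtain \<psi>2 C2 where 2: "\<psi>2 \<in> \<Psi>" "0 < C2" "\<And>n. \<psi> (n div 2) \<le> C2 * \<psi>2 n"
    using slow_down[OF \<psi>, of 2] by auto
  \<comment> \<open>Before time \<open>H\<close> the recursion says nothing, and constants are bounded by multiples of the rate;
     after it the shift by \<open>W\<close> is harmless.\<close>
  define H where "H = 2 * W + G"
  define F where "F = 1 / \<psi>2 H"
  have F: "0 < F" using pos[OF 2(1)] by (simp add: F_def)
  have early: "1 \<le> F * \<psi>2 n" if "n \<le> H" for n
    using antimono[OF 2(1) that] pos[OF 2(1), of H] by (simp add: F_def divide_simps)
  have late: "\<psi> (n - W) \<le> C2 * \<psi>2 n" if "H \<le> n" for n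
  proof -
    have "n div 2 \<le> n - W" using that unfolding H_def by linarith
    then show ?thesis using antimono[OF \<psi>, of "n div 2" "n - W"] 2(3)[of n] by linarith
  qed
  define E' where "E' = a * E * C2 + F"
  have E': "0 \<le> E'" using a E 2 F by (simp add: E'_def)
  have y_tail: "(\<Sum>k=j+1..m. y k) \<le> E' * \<psi>2 j" for j m
  proof (cases "H \<le> j")
    case True
    have "(\<Sum>k=j+1..m. y k) \<le> a * (\<Sum>i. t (i + (j - W)))"
      by (rule y_sum_late) (use True in \<open>simp add: H_def\<close>)
    also have "\<dots> \<le> a * (E * \<psi> (j - W))" by (intro mult_left_mono a tail)
    also have "\<dots> \<le> a * (E * (C2 * \<psi>2 j))" by (intro mult_left_mono a E late True)
    also have "\<dots> \<le> E' * \<psi>2 j" using F pos[OF 2(1), of j] by (simp add: E'_def algebra_simps)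
    finally show ?thesis .
  next
    case False
    have "(\<Sum>k=j+1..m. y k) \<le> 1" using y_sum[of "j+1" m] \<rho> by linarith
    also have "\<dots> \<le> F * \<psi>2 j" using False by (intro early) auto
    also have "\<dots> \<le> E' * \<psi>2 j"
      using pos[OF 2(1), of j] a E 2 by (intro mult_right_mono) (auto simp: E'_def)
    finally show ?thesis .
  qed
  have ker: "delay_kernel \<rho> (\<lambda>j. E' * \<psi>2 j) (\<lambda>g. y)"
    unfolding delay_kernel_def using y_nonneg y_sum y_tail by blast
  obtain \<psi>3 where 3: "\<psi>3 \<in> \<Psi>" and R: "\<forall>A\<ge>0. \<exists>K\<ge>0. renewal_dominated \<rho> E' \<psi>2 A K \<psi>3"
    using renewal_inequality[OF 2(1) \<rho> E'] by blast
  have conclude: "\<exists>K\<ge>0. \<forall>n. M n \<le> K * \<psi>3 n"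
    if M: "\<And>n. 0 \<le> M n" "\<And>n. M n \<le> X" and A: "0 \<le> A"
      and rec: "\<And>m. M m \<le> A * \<psi>2 m + (\<Sum>k=1..m. y k * M (m - k))" for M X A
  proof -
    define X' where "X' = max 1 X"
    have X': "0 < X'" "\<And>n. M n \<le> X'" using M by (auto simp: X'_def intro: order_trans[OF _ max.cobounded2])
    have AX: "0 \<le> A / X'" using A X' by simp
    obtain K where K: "0 \<le> K" and KR: "renewal_dominated \<rho> E' \<psi>2 (A / X') K \<psi>3"
      using R[THEN spec, THEN mp, OF AX] by blast
    have "M m / X' \<le> K * \<psi>3 m" for m
    proof (rule renewal_dominatedD[OF KR ker, of "\<lambda>g m. M m / X'"])
      fix m
      show "0 \<le> M m / X'" "M m / X' \<le> 1" using M X' by simp_all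
      have "M m / X' \<le> (A * \<psi>2 m + (\<Sum>k=1..m. y k * M (m - k))) / X'"
        using rec[of m] X' by (intro divide_right_mono) auto
      then show "M m / X' \<le> A / X' * \<psi>2 m + (\<Sum>k=1..m. y k * (M (m - k) / X'))"
        by (simp add: add_divide_distrib sum_divide_distrib)
    qed
    then have "M n \<le> X' * K * \<psi>3 n" for n using X' by (simp add: divide_le_eq mult_ac)
    then show ?thesis using K X' by (intro exI[of _ "X' * K"]) auto
  qed
  show ?thesis
  proof (intro bexI[OF _ 3] allI impI conjI)
    fix M B I :: "nat \<Rightarrow> real" and D :: real
    assume d: "draining t C c W M B I" and D: "0 \<le> D"
    have M: "antimono M" "\<And>n. 0 \<le> M n" and I0: "\<And>n. 0 \<le> I n"
      using d by (auto simp: draining_def)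
    have M0: "M n \<le> M 0" for n using antimonoD[OF M(1)] by simp
    have yM: "0 \<le> (\<Sum>k=1..m. y k * M (m - k))" for m
      by (intro sum_nonneg mult_nonneg_nonneg y_nonneg M)
    define I' where "I' = (\<lambda>m. if m < H then M 0 else I (m - W))"
    have rec: "M m \<le> I' m + (\<Sum>k=1..m. y k * M (m - k))" for m
      using draining_recursion[OF d, of m] yM[of m] M0[of m] by (auto simp: I'_def H_def)
    {
      assume I: "\<forall>n. I n \<le> D * \<psi> n"
      have I': "I' m \<le> (D * C2 + M 0 * F) * \<psi>2 m" for m
      proof (cases "m < H")
        case True
        then have "M 0 * 1 \<le> M 0 * (F * \<psi>2 m)" by (intro mult_left_mono M early) auto
        also have "\<dots> \<le> (D * C2 + M 0 * F) * \<psi>2 m"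
          using D 2 pos[OF 2(1), of m] by (simp add: algebra_simps)
        finally show ?thesis using True by (simp add: I'_def)
      next
        case False
        then have "I (m - W) \<le> D * \<psi> (m - W)" using I by simp
        also have "\<dots> \<le> D * (C2 * \<psi>2 m)" using False by (intro mult_left_mono D late) auto
        also have "\<dots> \<le> (D * C2 + M 0 * F) * \<psi>2 m"
          using M(2)[of 0] F pos[OF 2(1), of m] by (simp add: algebra_simps)
        finally show ?thesis using False by (simp add: I'_def)
      qed
      show "\<exists>K\<ge>0. \<forall>n. M n \<le> K * \<psi>3 n"
      proof (rule conclude)
        show "M m \<le> (D * C2 + M 0 * F) * \<psi>2 m + (\<Sum>k=1..m. y k * M (m - k))" for m
          using rec[of m] I'[of m] by simp
      qed (use M M0 D 2 F in auto)
    }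
    assume I: "summable I" and I_tail: "\<forall>n. (\<Sum>i. I (i + n)) \<le> D * \<psi> n"
    have I'0: "0 \<le> I' m" for m using M I0 by (simp add: I'_def)
    have sI': "summable I'"
    proof -
      have "summable (\<lambda>n. I' (n + H))"
      proof (rule summable_cong[THEN iffD2])
        show "eventually (\<lambda>n. I' (n + H) = I (n + (H - W))) sequentially"
          by (simp add: I'_def H_def add_ac)
      qed (intro summable_ignore_initial_segment I)
      then show ?thesis by (simp add: summable_iff_shift)
    qed
    have I'_sum: "(\<Sum>m\<in>{j..N}. I' m) \<le> (\<Sum>i. I' (i + j))" for j N
      using sum_le_tail[OF sI' I'0, of j "Suc N"] by (simp add: atLeastLessThanSuc_atLeastAtMost)
    have sum_rec: "(\<Sum>m\<in>{j..N}. M m) \<le> (\<Sum>i. I' (i + j)) + (\<Sum>k=1..N. y k * (\<Sum>i=j-k..N-k. M i))" for j N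
    proof -
      have "(\<Sum>m\<in>{j..N}. M m) \<le> (\<Sum>m\<in>{j..N}. I' m + (\<Sum>k=1..m. y k * M (m - k)))"
        by (intro sum_mono rec)
      also have "\<dots> = (\<Sum>m\<in>{j..N}. I' m) + (\<Sum>k=1..N. \<Sum>i=j-k..N-k. y k * M i)"
        by (simp only: sum.distrib sum_swap_delay[of "\<lambda>k i. y k * M i"])
      finally show ?thesis using I'_sum[of j N] by (simp add: sum_distrib_left)
    qed
    \<comment> \<open>Summing the recursion: the kernel returns at most the fraction \<open>\<rho>\<close> of the total.\<close>
    have partial: "(\<Sum>m<N. M m) \<le> (\<Sum>i. I' i) / (1 - \<rho>)" for N
    proof -
      have "(\<Sum>k=1..N. y k * (\<Sum>i=0-k..N-k. M i)) \<le> (\<Sum>k=1..N. y k * (\<Sum>i=0..N. M i))"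
        by (intro sum_mono mult_left_mono y_nonneg sum_mono2) (use M in auto)
      also have "\<dots> = (\<Sum>k=1..N. y k) * (\<Sum>i=0..N. M i)" by (simp add: sum_distrib_right)
      also have "\<dots> \<le> \<rho> * (\<Sum>i=0..N. M i)" by (intro mult_right_mono y_sum sum_nonneg M)
      finally have "(\<Sum>i=0..N. M i) \<le> (\<Sum>i. I' i) + \<rho> * (\<Sum>i=0..N. M i)"
        using sum_rec[of 0 N] by simp
      then have "(\<Sum>i=0..N. M i) \<le> (\<Sum>i. I' i) / (1 - \<rho>)" using \<rho> by (simp add: field_simps)
      moreover have "(\<Sum>m<N. M m) \<le> (\<Sum>i=0..N. M i)" by (intro sum_mono2) (use M in auto)
      ultimately show ?thesis by linarith
    qed
    show sM: "summable M"
      by (rule summableI_nonneg_bounded[OF M(2) partial])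
    define S where "S = (\<lambda>n. \<Sum>i. M (i + n))"
    have S_bound: "(\<Sum>i\<in>{j..N}. M i) \<le> S j" for j N
      using sum_le_tail[OF sM M(2), of j "Suc N"] by (simp add: S_def atLeastLessThanSuc_atLeastAtMost)
    have S_nonneg: "0 \<le> S n" for n
      unfolding S_def by (intro suminf_nonneg summable_ignore_initial_segment sM M)
    have S_split: "S 0 = S n + (\<Sum>i<n. M i)" for n
      unfolding S_def using suminf_split_initial_segment[OF sM, of n] by simp
    have S_le: "S n \<le> S 0" for n
      using S_split[of n] sum_nonneg[of "{..<n}" M] M by simp
    have S_rec: "S j \<le> (\<Sum>i. I' (i + j)) + ((\<Sum>k=1..j. y k * S (j - k)) + E' * \<psi>2 j * S 0)" for j
      unfolding S_def[of] 
    proof (rule suminf_le_const)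
      show "summable (\<lambda>i. M (i + j))" by (intro summable_ignore_initial_segment sM)
      fix n
      define N where "N = n + j"
      have "(\<Sum>i<n. M (i + j)) = (\<Sum>m\<in>{j..<N}. M m)"
        by (rule sum.reindex_bij_witness[of _ "\<lambda>i. i - j" "\<lambda>i. i + j"]) (auto simp: N_def)
      also have "\<dots> \<le> (\<Sum>m\<in>{j..N}. M m)" by (intro sum_mono2) (use M in auto)
      also have "\<dots> \<le> (\<Sum>i. I' (i + j)) + (\<Sum>k=1..N. y k * (\<Sum>i=j-k..N-k. M i))" by (rule sum_rec)
      also have "(\<Sum>k=1..N. y k * (\<Sum>i=j-k..N-k. M i)) \<le> (\<Sum>k=1..N. y k * S (j - k))"
        by (intro sum_mono mult_left_mono y_nonneg S_bound)
      also have "\<dots> = (\<Sum>k=1..j. y k * S (j - k)) + (\<Sum>k=j+1..N. y k * S (j - k))"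
      proof -
        have "{1..N} = {1..j} \<union> {j+1..N}" by (auto simp: N_def)
        then show ?thesis by (simp only:) (rule sum.union_disjoint, auto)
      qed
      also have "(\<Sum>k=j+1..N. y k * S (j - k)) \<le> (\<Sum>k=j+1..N. y k * S 0)"
        by (intro sum_mono mult_left_mono y_nonneg S_le)
      also have "\<dots> = (\<Sum>k=j+1..N. y k) * S 0" by (simp add: sum_distrib_right)
      also have "\<dots> \<le> E' * \<psi>2 j * S 0" by (intro mult_right_mono y_tail S_nonneg)
      finally show "(\<Sum>i<n. M (i + j)) \<le> (\<Sum>i. I' (i + j)) + ((\<Sum>k=1..j. y k * (\<Sum>i. M (i + (j - k)))) + E' * \<psi>2 j * (\<Sum>i. M (i + 0)))"
        by (simp add: S_def)
    qed
    define I0' where "I0' = (\<Sum>i. I' i)"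
    have I0'_nonneg: "0 \<le> I0'" unfolding I0'_def by (intro suminf_nonneg sI' I'0)
    have I'_tail: "(\<Sum>i. I' (i + j)) \<le> (D * C2 + I0' * F) * \<psi>2 j" for j
    proof (cases "j < H")
      case True
      have "(\<Sum>i. I' (i + j)) \<le> I0'"
        unfolding I0'_def using suminf_split_initial_segment[OF sI', of j] sum_nonneg[of "{..<j}" I'] I'0 by simp
      also have "I0' * 1 \<le> I0' * (F * \<psi>2 j)" using True by (intro mult_left_mono I0'_nonneg early) auto
      also have "\<dots> \<le> (D * C2 + I0' * F) * \<psi>2 j"
        using D 2 pos[OF 2(1), of j] by (simp add: algebra_simps)
      finally show ?thesis by simp
    next
      case False
      then have "(\<Sum>i. I' (i + j)) = (\<Sum>i. I (i + (j - W)))"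
        by (intro suminf_cong) (auto simp: I'_def H_def)
      also have "\<dots> \<le> D * \<psi> (j - W)" using I_tail by simp
      also have "\<dots> \<le> D * (C2 * \<psi>2 j)" using False by (intro mult_left_mono D late) auto
      also have "\<dots> \<le> (D * C2 + I0' * F) * \<psi>2 j"
        using I0'_nonneg F pos[OF 2(1), of j] by (simp add: algebra_simps)
      finally show ?thesis .
    qed
    have "\<exists>K\<ge>0. \<forall>n. S n \<le> K * \<psi>3 n"
    proof (rule conclude)
      show "S m \<le> (D * C2 + I0' * F + E' * S 0) * \<psi>2 m + (\<Sum>k=1..m. y k * S (m - k))" for m
        using S_rec[of m] I'_tail[of m] by (simp add: algebra_simps)
    qed (use S_nonneg S_le D 2 F I0'_nonneg E' in auto)
    then show "\<exists>K\<ge>0. \<forall>n. (\<Sum>i. M (i + n)) \<le> K * \<psi>3 n" by (simp add: S_def)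
  qed
qed

end

section \<open>The transfer operator of an exact Markov tower\<close>

text \<open>
  The setting after a null set has been removed: images of cells are unions of cells, up to points that
  belong to no cell. Of separation time only the
  quasi-distance \<open>d\<close>, which is \<open>\<beta>\<close> to the power of separation time, and its contraction along branches are retained.
  The assumption \<open>hit\<close> says that orbits starting in any cell of the base meet the base cell \<open>star\<close> at all large
  times with positive measure.
\<close>

locale markov_tower = finite_measure m for m :: "'a measure" +
  fixes F :: "'a \<Rightarrow> 'a" and P :: "'a set set" and R :: "'a \<Rightarrow> nat" and J :: "'a \<Rightarrow> real"
    and d :: "'a \<Rightarrow> 'a \<Rightarrow> real" and \<beta> C\<^sub>J \<delta>\<^sub>0 :: real and star :: "'a set"
  assumes F_measurable [measurable]: "F \<in> m \<rightarrow>\<^sub>M m"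
    and R_measurable [measurable]: "R \<in> m \<rightarrow>\<^sub>M count_space UNIV"
    and R_pos: "x \<in> space m \<Longrightarrow> 1 \<le> R x"
    and P_countable: "countable P" and P_sets: "\<omega> \<in> P \<Longrightarrow> \<omega> \<in> sets m"
    and P_disjoint: "disjoint P" and P_cover: "space m - \<Union>P \<in> null_sets m"
    and R_const: "\<omega> \<in> P \<Longrightarrow> x \<in> \<omega> \<Longrightarrow> y \<in> \<omega> \<Longrightarrow> R x = R y"
    and F_inj: "\<omega> \<in> P \<Longrightarrow> inj_on F \<omega>"
    and image_sets: "\<omega> \<in> P \<Longrightarrow> A \<in> sets m \<Longrightarrow> A \<subseteq> \<omega> \<Longrightarrow> F ` A \<in> sets m"
    and markov: "\<omega> \<in> P \<Longrightarrow> \<omega>' \<in> P \<Longrightarrow> \<omega>' \<subseteq> F ` \<omega> \<or> \<omega>' \<inter> F ` \<omega> = {}"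
    and J_measurable [measurable]: "J \<in> borel_measurable m"
    and J_pos: "x \<in> space m \<Longrightarrow> 0 < J x"
    and jacobian: "\<omega> \<in> P \<Longrightarrow> A \<in> sets m \<Longrightarrow> A \<subseteq> \<omega> \<Longrightarrow>
      emeasure m (F ` A) = (\<integral>\<^sup>+x\<in>A. ennreal (J x) \<partial>m)"
    and d_nonneg: "0 \<le> d x y" and d_le_1: "d x y \<le> 1" and d_sym: "d x y = d y x"
    and d_contract: "\<omega> \<in> P \<Longrightarrow> x \<in> \<omega> \<Longrightarrow> y \<in> \<omega> \<Longrightarrow> d x y \<le> \<beta> * d (F x) (F y)"
    and \<beta>: "0 < \<beta>" "\<beta> < 1" and C\<^sub>J: "0 < C\<^sub>J" and \<delta>\<^sub>0: "0 < \<delta>\<^sub>0"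
    and distortion: "\<omega> \<in> P \<Longrightarrow> x \<in> \<omega> \<Longrightarrow> y \<in> \<omega> \<Longrightarrow> J x \<le> exp (C\<^sub>J * d (F x) (F y)) * J y"
    and long: "\<omega> \<in> P \<Longrightarrow> \<delta>\<^sub>0 \<le> measure m (F ` \<omega>)"
    and star: "star \<in> P"
    and hit: "\<sigma> \<in> P \<Longrightarrow> \<exists>n\<^sub>0. \<forall>t\<ge>n\<^sub>0. 0 < measure m {x \<in> \<sigma>. (tower_map F R ^^ t) (x, 0) \<in> star \<times> {0}}"
    and R_integrable: "integrable m (\<lambda>x. real (R x))"
begin

definition inv_branch :: "'a set \<Rightarrow> 'a \<Rightarrow> 'a" where
  "inv_branch \<omega> = the_inv_into \<omega> F"

lemma inv_branch_F [simp]: "\<omega> \<in> P \<Longrightarrow> x \<in> \<omega> \<Longrightarrow> inv_branch \<omega> (F x) = x"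
  unfolding inv_branch_def using the_inv_into_f_f[OF F_inj] by auto

lemma inv_branch_in: "\<omega> \<in> P \<Longrightarrow> y \<in> F ` \<omega> \<Longrightarrow> inv_branch \<omega> y \<in> \<omega>"
  by auto

lemma F_inv_branch: "\<omega> \<in> P \<Longrightarrow> y \<in> F ` \<omega> \<Longrightarrow> F (inv_branch \<omega> y) = y"
  by auto

lemma P_space: "\<omega> \<in> P \<Longrightarrow> x \<in> \<omega> \<Longrightarrow> x \<in> space m"
  using P_sets sets.sets_into_space by blast

lemma F_image_sets [measurable]: "\<omega> \<in> P \<Longrightarrow> F ` \<omega> \<in> sets m"
  using image_sets[of \<omega> \<omega>] P_sets by auto

lemma measurable_on_branch:
  assumes \<omega>: "\<omega> \<in> P" and h [measurable]: "h \<in> borel_measurable m"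
  shows "(\<lambda>y. if y \<in> F ` \<omega> then h (inv_branch \<omega> y) else (0::ennreal)) \<in> borel_measurable m"
proof -
  note [measurable] = F_image_sets[OF \<omega>]
  have "inv_branch \<omega> \<in> restrict_space m (F ` \<omega>) \<rightarrow>\<^sub>M m"
  proof (rule measurableI)
    fix y assume "y \<in> space (restrict_space m (F ` \<omega>))"
    then show "inv_branch \<omega> y \<in> space m"
      using inv_branch_in[OF \<omega>] P_space[OF \<omega>] by (auto simp: space_restrict_space)
  next
    fix A assume A: "A \<in> sets m"
    have "inv_branch \<omega> -` A \<inter> space (restrict_space m (F ` \<omega>)) = F ` (A \<inter> \<omega>)"
      using \<omega> sets.sets_into_space[OF F_image_sets[OF \<omega>]] by (auto simp: space_restrict_space)
    moreover have "F ` (A \<inter> \<omega>) \<in> sets m" using A P_sets[OF \<omega>] by (intro image_sets[OF \<omega>]) auto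
    moreover have "F ` (A \<inter> \<omega>) = F ` \<omega> \<inter> F ` (A \<inter> \<omega>)" by auto
    ultimately show "inv_branch \<omega> -` A \<inter> space (restrict_space m (F ` \<omega>)) \<in> sets (restrict_space m (F ` \<omega>))"
      by (auto simp: sets_restrict_space)
  qed
  then have "(\<lambda>y. h (inv_branch \<omega> y)) \<in> restrict_space m (F ` \<omega>) \<rightarrow>\<^sub>M borel"
    by measurable
  then show ?thesis
    by (subst (asm) measurable_restrict_space_iff[where c = 0]) auto
qed

text \<open>
  The Jacobian condition says that \<open>F\<close> maps the measure \<open>J m\<close> on \<open>\<omega>\<close> to \<open>m\<close> on \<open>F ` \<omega>\<close>.
\<close>

lemma change_of_variables:
  assumes \<omega>: "\<omega> \<in> P" and h [measurable]: "h \<in> borel_measurable m"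
  shows "(\<integral>\<^sup>+y. (if y \<in> F ` \<omega> then h (inv_branch \<omega> y) else 0) \<partial>m) = (\<integral>\<^sup>+x\<in>\<omega>. h x * ennreal (J x) \<partial>m)"
proof -
  note [measurable] = F_image_sets[OF \<omega>] P_sets[OF \<omega>]
  let ?h = "\<lambda>y. if y \<in> F ` \<omega> then h (inv_branch \<omega> y) else 0"
  have [measurable]: "?h \<in> borel_measurable m" by (rule measurable_on_branch[OF \<omega> h])
  let ?N = "density m (\<lambda>x. ennreal (J x) * indicator \<omega> x)"
  have eq: "distr ?N m F = density m (indicator (F ` \<omega>))"
  proof (rule measure_eqI)
    fix B assume "B \<in> sets (distr ?N m F)"
    then have B [measurable]: "B \<in> sets m" by simp
    have A: "F -` B \<inter> space m \<inter> \<omega> \<in> sets m" by measurable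
    have "emeasure (distr ?N m F) B = (\<integral>\<^sup>+x. ennreal (J x) * indicator \<omega> x * indicator (F -` B \<inter> space m) x \<partial>m)"
      by (subst emeasure_distr) (auto simp: emeasure_density)
    also have "\<dots> = (\<integral>\<^sup>+x\<in>F -` B \<inter> space m \<inter> \<omega>. ennreal (J x) \<partial>m)"
      by (intro nn_integral_cong) (auto split: split_indicator)
    also have "\<dots> = emeasure m (F ` (F -` B \<inter> space m \<inter> \<omega>))"
      by (rule jacobian[OF \<omega> A, symmetric]) auto
    also have "F ` (F -` B \<inter> space m \<inter> \<omega>) = F ` \<omega> \<inter> B"
      using P_space[OF \<omega>] by auto
    also have "emeasure m \<dots> = emeasure (density m (indicator (F ` \<omega>))) B"
      by (subst emeasure_density) (auto simp: indicator_inter_arith[symmetric])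
    finally show "emeasure (distr ?N m F) B = emeasure (density m (indicator (F ` \<omega>))) B" .
  qed simp
  have "(\<integral>\<^sup>+y. ?h y \<partial>m) = (\<integral>\<^sup>+y. indicator (F ` \<omega>) y * ?h y \<partial>m)"
    by (intro nn_integral_cong) (auto split: split_indicator)
  also have "\<dots> = (\<integral>\<^sup>+y. ?h y \<partial>density m (indicator (F ` \<omega>)))"
    by (subst nn_integral_density) auto
  also have "\<dots> = (\<integral>\<^sup>+x. ?h (F x) \<partial>?N)"
    unfolding eq[symmetric] by (subst nn_integral_distr) auto
  also have "\<dots> = (\<integral>\<^sup>+x. ennreal (J x) * indicator \<omega> x * ?h (F x) \<partial>m)"
    by (subst nn_integral_density) auto
  also have "\<dots> = (\<integral>\<^sup>+x\<in>\<omega>. h x * ennreal (J x) \<partial>m)"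
    using \<omega> by (intro nn_integral_cong) (auto split: split_indicator simp: mult.commute)
  finally show ?thesis .
qed

text \<open>
  The contribution of one inverse branch to the transfer operator of \<open>F\<close>.
\<close>

definition branch :: "('a \<Rightarrow> ennreal) \<Rightarrow> 'a set \<Rightarrow> 'a \<Rightarrow> ennreal" where
  "branch g \<omega> y = (if y \<in> F ` \<omega> then g (inv_branch \<omega> y) / ennreal (J (inv_branch \<omega> y)) else 0)"

definition transfer :: "('a \<Rightarrow> ennreal) \<Rightarrow> 'a \<Rightarrow> ennreal" where
  "transfer g y = (\<integral>\<^sup>+\<omega>. branch g \<omega> y \<partial>count_space P)"

lemma branch_measurable [measurable]:
  assumes \<omega>: "\<omega> \<in> P" and [measurable]: "g \<in> borel_measurable m"
  shows "branch g \<omega> \<in> borel_measurable m"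
  unfolding branch_def by (rule measurable_on_branch[OF \<omega>]) measurable

lemma sigma_finite_P: "sigma_finite_measure (count_space P)"
  by (rule sigma_finite_measure_count_space_countable[OF P_countable])

lemma transfer_measurable [measurable]:
  assumes [measurable]: "g \<in> borel_measurable m"
  shows "transfer g \<in> borel_measurable m"
proof -
  interpret sigma_finite_measure "count_space P" by (rule sigma_finite_P)
  have "(\<lambda>(\<omega>, y). branch g \<omega> y) \<in> borel_measurable (count_space P \<Otimes>\<^sub>M m)"
    using P_countable by (intro measurable_pair_measure_countable1) auto
  then have "(\<lambda>(y, \<omega>). branch g \<omega> y) \<in> borel_measurable (m \<Otimes>\<^sub>M count_space P)"
    by (subst measurable_pair_swap_iff) (simp add: case_prod_beta')
  then show ?thesis unfolding transfer_def by (rule borel_measurable_nn_integral)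
qed

lemma swap_cells:
  assumes "\<And>\<omega>. \<omega> \<in> P \<Longrightarrow> h \<omega> \<in> borel_measurable m"
  shows "(\<integral>\<^sup>+y. (\<integral>\<^sup>+\<omega>. h \<omega> y \<partial>count_space P) \<partial>m) = (\<integral>\<^sup>+\<omega>. (\<integral>\<^sup>+y. h \<omega> y \<partial>m) \<partial>count_space P)"
proof -
  interpret N: sigma_finite_measure "count_space P" by (rule sigma_finite_P)
  interpret pair_sigma_finite "count_space P" m ..
  show ?thesis
    by (rule Fubini') (use P_countable assms in \<open>auto intro!: measurable_pair_measure_countable1\<close>)
qed

lemma AE_in_cell: "AE x in m. x \<in> \<Union>P"
  using P_cover by (rule AE_I') auto

lemma sum_indicator_cells:
  "x \<in> \<Union>P \<Longrightarrow> (\<integral>\<^sup>+\<omega>. indicator \<omega> x \<partial>count_space P) = (1::ennreal)"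
proof -
  assume "x \<in> \<Union>P"
  then obtain \<sigma> where \<sigma>: "\<sigma> \<in> P" "x \<in> \<sigma>" by auto
  have "(\<integral>\<^sup>+\<omega>. indicator \<omega> x \<partial>count_space P) = (\<integral>\<^sup>+\<omega>. indicator {\<sigma>} \<omega> \<partial>count_space P)"
  proof (rule nn_integral_cong)
    fix \<omega> assume "\<omega> \<in> space (count_space P)"
    then show "indicator \<omega> x = (indicator {\<sigma>} \<omega> :: ennreal)"
      using \<sigma> P_disjoint by (auto simp: disjoint_def split: split_indicator)
  qed
  also have "\<dots> = 1" using \<sigma> by simp
  finally show ?thesis .
qed

lemma branch_dual:
  assumes \<omega>: "\<omega> \<in> P" and [measurable]: "u \<in> borel_measurable m" "g \<in> borel_measurable m"
  shows "(\<integral>\<^sup>+y. u y * branch g \<omega> y \<partial>m) = (\<integral>\<^sup>+x\<in>\<omega>. u (F x) * g x \<partial>m)"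
proof -
  have "(\<integral>\<^sup>+y. u y * branch g \<omega> y \<partial>m) =
      (\<integral>\<^sup>+y. (if y \<in> F ` \<omega> then (\<lambda>x. u (F x) * (g x / ennreal (J x))) (inv_branch \<omega> y) else 0) \<partial>m)"
    using F_inv_branch[OF \<omega>] by (intro nn_integral_cong) (simp add: branch_def)
  also have "\<dots> = (\<integral>\<^sup>+x\<in>\<omega>. u (F x) * (g x / ennreal (J x)) * ennreal (J x) \<partial>m)"
    by (rule change_of_variables[OF \<omega>]) measurable
  also have "\<dots> = (\<integral>\<^sup>+x\<in>\<omega>. u (F x) * g x \<partial>m)"
  proof (rule nn_integral_cong)
    fix x assume "x \<in> space m"
    then have "g x / ennreal (J x) * ennreal (J x) = g x"
      using J_pos[of x] by (simp add: ennreal_divide_times divide_ennreal)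
    then show "u (F x) * (g x / ennreal (J x)) * ennreal (J x) * indicator \<omega> x = u (F x) * g x * indicator \<omega> x"
      by (simp add: mult.assoc)
  qed
  finally show ?thesis .
qed

lemma transfer_dual:
  assumes [measurable]: "u \<in> borel_measurable m" "g \<in> borel_measurable m"
  shows "(\<integral>\<^sup>+y. u y * transfer g y \<partial>m) = (\<integral>\<^sup>+x. u (F x) * g x \<partial>m)"
proof -
  have "(\<integral>\<^sup>+y. u y * transfer g y \<partial>m) = (\<integral>\<^sup>+y. (\<integral>\<^sup>+\<omega>. u y * branch g \<omega> y \<partial>count_space P) \<partial>m)"
    by (simp add: transfer_def nn_integral_cmult)
  also have "\<dots> = (\<integral>\<^sup>+\<omega>. (\<integral>\<^sup>+y. u y * branch g \<omega> y \<partial>m) \<partial>count_space P)"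
    by (rule swap_cells) measurable
  also have "\<dots> = (\<integral>\<^sup>+\<omega>. (\<integral>\<^sup>+x\<in>\<omega>. u (F x) * g x \<partial>m) \<partial>count_space P)"
    by (intro nn_integral_cong branch_dual) auto
  also have "\<dots> = (\<integral>\<^sup>+x. (\<integral>\<^sup>+\<omega>. u (F x) * g x * indicator \<omega> x \<partial>count_space P) \<partial>m)"
    by (rule swap_cells[symmetric]) (use P_sets in measurable)
  also have "\<dots> = (\<integral>\<^sup>+x. u (F x) * g x \<partial>m)"
    using AE_in_cell by (intro nn_integral_cong_AE) (auto simp: nn_integral_cmult sum_indicator_cells)
  finally show ?thesis .
qed

text \<open>
  Functions on the tower are curried, level first. This is the integral over the tower (see
  \<open>nn_integral_tower\<close>); values above the roof \<open>R\<close> do not enter.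
\<close>

definition integ :: "(nat \<Rightarrow> 'a \<Rightarrow> ennreal) \<Rightarrow> ennreal" where
  "integ f = (\<integral>\<^sup>+x. (\<Sum>l<R x. f l x) \<partial>m)"

text \<open>
  Composition with the tower map, see \<open>koopman_pow\<close>.
\<close>

definition koopman :: "(nat \<Rightarrow> 'a \<Rightarrow> ennreal) \<Rightarrow> nat \<Rightarrow> 'a \<Rightarrow> ennreal" where
  "koopman u l x = (if l + 1 < R x then u (l + 1) x else u 0 (F x))"

text \<open>
  The transfer operator of the tower map: every level moves up, and the base receives what
  falls down from the top of the columns.
\<close>

definition push :: "(nat \<Rightarrow> 'a \<Rightarrow> ennreal) \<Rightarrow> nat \<Rightarrow> 'a \<Rightarrow> ennreal" where
  "push f l = (if l = 0 then transfer (\<lambda>x. f (R x - 1) x) else f (l - 1))"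

definition tmeas :: "(nat \<Rightarrow> 'a \<Rightarrow> ennreal) \<Rightarrow> bool" where
  "tmeas f \<longleftrightarrow> (\<forall>l. f l \<in> borel_measurable m)"

lemma tmeasD: "tmeas f \<Longrightarrow> f l \<in> borel_measurable m"
  by (simp add: tmeas_def)

lemma tmeas_top: "tmeas f \<Longrightarrow> (\<lambda>x. f (R x - 1) x) \<in> borel_measurable m"
  by (rule measurable_compose_countable[where f = "\<lambda>l x. f l x" and g = "\<lambda>x. R x - 1"]) (auto intro: tmeasD)

lemma tmeas_sum:
  assumes "tmeas f"
  shows "(\<lambda>x. \<Sum>l<R x. f l x) \<in> borel_measurable m"
proof -
  note [measurable] = tmeasD[OF assms]
  show ?thesis
    by (rule measurable_compose_countable[where f = "\<lambda>n x. \<Sum>l<n. f l x" and g = R]) measurable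
qed

lemma tmeas_push:
  assumes "tmeas f"
  shows "tmeas (push f)"
  unfolding tmeas_def push_def using transfer_measurable[OF tmeas_top[OF assms]] tmeasD[OF assms] by simp

lemma tmeas_koopman:
  assumes "tmeas u"
  shows "tmeas (koopman u)"
proof -
  note [measurable] = tmeasD[OF assms] measurable_compose[OF F_measurable tmeasD[OF assms]]
  show ?thesis unfolding tmeas_def koopman_def by measurable
qed

lemma tmeas_koopman_pow: "tmeas u \<Longrightarrow> tmeas ((koopman ^^ n) u)"
  by (induction n) (auto intro: tmeas_koopman)

lemma tmeas_mult:
  assumes "tmeas f" "tmeas g"
  shows "tmeas (\<lambda>l x. f l x * g l x)"
proof -
  note [measurable] = assms[THEN tmeasD]
  show ?thesis unfolding tmeas_def by measurable
qed

lemma integ_mono: "(\<And>l x. x \<in> space m \<Longrightarrow> l < R x \<Longrightarrow> f l x \<le> g l x) \<Longrightarrow> integ f \<le> integ g"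
  unfolding integ_def by (intro nn_integral_mono sum_mono) auto

lemma integ_cong: "(\<And>l x. x \<in> space m \<Longrightarrow> l < R x \<Longrightarrow> f l x = g l x) \<Longrightarrow> integ f = integ g"
  unfolding integ_def by (intro nn_integral_cong sum.cong) auto

lemma integ_add: "tmeas f \<Longrightarrow> tmeas g \<Longrightarrow> integ (\<lambda>l x. f l x + g l x) = integ f + integ g"
  unfolding integ_def by (simp add: sum.distrib nn_integral_add tmeas_sum)

lemma integ_cmult: "tmeas f \<Longrightarrow> integ (\<lambda>l x. c * f l x) = c * integ f"
  unfolding integ_def by (simp add: sum_distrib_left[symmetric] nn_integral_cmult tmeas_sum)

lemma integ_sum: "finite A \<Longrightarrow> (\<And>a. a \<in> A \<Longrightarrow> tmeas (f a)) \<Longrightarrow> integ (\<lambda>l x. \<Sum>a\<in>A. f a l x) = (\<Sum>a\<in>A. integ (f a))"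
proof (induction A rule: finite_induct)
  case empty then show ?case by (simp add: integ_def)
next
  case (insert a A)
  have "tmeas (\<lambda>l x. \<Sum>a\<in>A. f a l x)"
    unfolding tmeas_def
  proof
    fix l show "(\<lambda>x. \<Sum>a\<in>A. f a l x) \<in> borel_measurable m"
      by (rule borel_measurable_sum) (use insert.prems in \<open>auto intro: tmeasD\<close>)
  qed
  then show ?case using insert by (simp add: integ_add)
qed

lemma integ_base: "integ (\<lambda>l x. if l = 0 then h x else 0) = (\<integral>\<^sup>+x. h x \<partial>m)"
proof -
  have "(\<Sum>l<R x. if l = 0 then h x else 0) = h x" if "x \<in> space m" for x
    using R_pos[OF that] by (simp add: sum.delta)
  then show ?thesis unfolding integ_def by (intro nn_integral_cong) auto
qed

text \<open>
  On the levels above the base this is a shift of the summation index; on the base it is the duality for \<open>F\<close>.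
\<close>

lemma integ_dual:
  assumes u: "tmeas u" and f: "tmeas f"
  shows "integ (\<lambda>l x. u l x * push f l x) = integ (\<lambda>l x. koopman u l x * f l x)"
proof -
  note [measurable] = tmeasD[OF u] tmeasD[OF f] tmeas_top[OF f]
  have [measurable]: "(\<lambda>x. \<Sum>l<R x - 1. u (Suc l) x * f l x) \<in> borel_measurable m"
    by (rule measurable_compose_countable[where f = "\<lambda>n x. \<Sum>l<n. u (Suc l) x * f l x" and g = "\<lambda>x. R x - 1"]) auto
  have 1: "(\<Sum>l<R x. u l x * push f l x) = u 0 x * transfer (\<lambda>x. f (R x - 1) x) x + (\<Sum>l<R x - 1. u (Suc l) x * f l x)"
    if "x \<in> space m" for x
  proof -
    have "R x = Suc (R x - 1)" using R_pos[OF that] by simp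
    then have "(\<Sum>l<R x. u l x * push f l x) = (\<Sum>l<Suc (R x - 1). u l x * push f l x)" by simp
    then show ?thesis by (simp only: sum.lessThan_Suc_shift) (simp add: push_def)
  qed
  have 2: "(\<Sum>l<R x. koopman u l x * f l x) = u 0 (F x) * f (R x - 1) x + (\<Sum>l<R x - 1. u (Suc l) x * f l x)"
    if "x \<in> space m" for x
  proof -
    have r: "R x = Suc (R x - 1)" using R_pos[OF that] by simp
    then have "(\<Sum>l<R x. koopman u l x * f l x) = (\<Sum>l<Suc (R x - 1). koopman u l x * f l x)" by simp
    also have "\<dots> = (\<Sum>l<R x - 1. koopman u l x * f l x) + koopman u (R x - 1) x * f (R x - 1) x" by simp
    also have "koopman u (R x - 1) x = u 0 (F x)" using r by (simp add: koopman_def)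
    also have "(\<Sum>l<R x - 1. koopman u l x * f l x) = (\<Sum>l<R x - 1. u (Suc l) x * f l x)"
      by (intro sum.cong) (auto simp: koopman_def)
    finally show ?thesis by (simp add: add.commute)
  qed
  have "integ (\<lambda>l x. u l x * push f l x) =
      (\<integral>\<^sup>+x. u 0 x * transfer (\<lambda>x. f (R x - 1) x) x + (\<Sum>l<R x - 1. u (Suc l) x * f l x) \<partial>m)"
    unfolding integ_def by (intro nn_integral_cong 1)
  also have "\<dots> = (\<integral>\<^sup>+x. u 0 (F x) * f (R x - 1) x \<partial>m) + (\<integral>\<^sup>+x. (\<Sum>l<R x - 1. u (Suc l) x * f l x) \<partial>m)"
    by (subst nn_integral_add) (auto simp: transfer_dual)
  also have "\<dots> = (\<integral>\<^sup>+x. u 0 (F x) * f (R x - 1) x + (\<Sum>l<R x - 1. u (Suc l) x * f l x) \<partial>m)"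
    by (subst nn_integral_add) auto
  also have "\<dots> = integ (\<lambda>l x. koopman u l x * f l x)"
    unfolding integ_def by (intro nn_integral_cong 2[symmetric])
  finally show ?thesis .
qed

lemma koopman_pow: "(koopman ^^ n) u l x = (case (tower_map F R ^^ n) (x, l) of (y, k) \<Rightarrow> u k y)"
proof (induction n arbitrary: u)
  case (Suc n)
  have "(koopman ^^ Suc n) u l x = (koopman ^^ n) (koopman u) l x" by (simp add: funpow_Suc_right del: funpow.simps)
  also have "\<dots> = (case (tower_map F R ^^ n) (x, l) of (y, k) \<Rightarrow> koopman u k y)" by (rule Suc.IH)
  also have "\<dots> = (case (tower_map F R ^^ Suc n) (x, l) of (y, k) \<Rightarrow> u k y)"
    by (auto simp: koopman_def tower_map_def split: prod.splits)
  finally show ?case .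
qed simp

end

section \<open>Distortion and hitting the reference cell\<close>

context markov_tower begin

definition \<delta> :: real where "\<delta> = (1 - \<beta>) / (1 + \<beta>)"
text \<open>
  The constants solve \<open>L' \<beta> + C\<^sub>J = L\<close> with \<open>L' = L / (1 - \<delta>)\<close>: subtracting a fraction \<open>\<delta>\<close> of a density raises its
  logarithmic Hoelder constant from \<open>L\<close> to \<open>L'\<close>, and the next return to the base restores \<open>L\<close>.
\<close>

definition L :: real where "L = 2 * C\<^sub>J / (1 - \<beta>)"
definition L' :: real where "L' = L / (1 - \<delta>)"

lemma \<delta>: "0 < \<delta>" "\<delta> < 1" and L: "0 < L" "L \<le> L'"
  and L'_contract: "L' * \<beta> + C\<^sub>J = L"
proof -
  show d: "0 < \<delta>" "\<delta> < 1" using \<beta> by (auto simp: \<delta>_def field_simps)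
  show "0 < L" using \<beta> C\<^sub>J by (simp add: L_def)
  then show "L \<le> L'" using d by (simp add: L'_def field_simps)
  have "1 - \<delta> = 2 * \<beta> / (1 + \<beta>)" using \<beta> by (simp add: \<delta>_def field_simps)
  then have "L' * \<beta> = L * (1 + \<beta>) / 2" using \<beta> by (simp add: L'_def)
  moreover have "C\<^sub>J = L * (1 - \<beta>) / 2" using \<beta> by (simp add: L_def)
  ultimately show "L' * \<beta> + C\<^sub>J = L" by (simp add: field_simps)
qed

text \<open>
  Logarithmic Hoelder continuity on cells, in a form that is stable under countable sums.
\<close>

definition regular :: "real \<Rightarrow> nat \<Rightarrow> ('a \<Rightarrow> ennreal) \<Rightarrow> bool" where
  "regular c l g \<longleftrightarrow> (\<forall>\<omega>\<in>P. \<forall>x\<in>\<omega>. \<forall>y\<in>\<omega>. l < R x \<longrightarrow> g x \<le> ennreal (exp (c * d x y)) * g y)"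

text \<open>
  The points \<open>y\<close> and \<open>y'\<close> may lie in different cells: a single branch has bounded distortion on its whole
  image, which is what lets a returning mass spread out.
\<close>

lemma branch_distortion:
  assumes f: "\<And>l. regular L' l (f l)" and \<omega>: "\<omega> \<in> P" and y: "y \<in> F ` \<omega>" "y' \<in> F ` \<omega>"
  shows "branch (\<lambda>x. f (R x - 1) x) \<omega> y \<le> ennreal (exp (L * d y y')) * branch (\<lambda>x. f (R x - 1) x) \<omega> y'"
proof -
  define x x' where "x = inv_branch \<omega> y" and "x' = inv_branch \<omega> y'"
  have x: "x \<in> \<omega>" "x' \<in> \<omega>" "F x = y" "F x' = y'"
    using y \<omega> by (auto simp: x_def x'_def)
  have R: "R x = R x'" using R_const[OF \<omega>] x by blast
  have J: "0 < J x" "0 < J x'" using J_pos P_space[OF \<omega>] x by auto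
  have sp: "x \<in> space m" using P_space[OF \<omega>] x by auto
  have "f (R x - 1) x \<le> ennreal (exp (L' * d x x')) * f (R x - 1) x'"
    using f[of "R x - 1"] \<omega> x R_pos[OF sp] unfolding regular_def by auto
  also have "\<dots> \<le> ennreal (exp (L' * (\<beta> * d y y'))) * f (R x - 1) x'"
    using d_contract[OF \<omega> x(1,2)] x L by (intro mult_right_mono ennreal_leI) (auto intro!: mult_left_mono)
  finally have 1: "f (R x - 1) x \<le> ennreal (exp (L' * (\<beta> * d y y'))) * f (R x - 1) x'" .
  have "J x' \<le> exp (C\<^sub>J * d y y') * J x"
    using distortion[OF \<omega> x(2,1)] x by (simp add: d_sym)
  then have "1 / J x \<le> exp (C\<^sub>J * d y y') / J x'" using J by (simp add: field_simps)
  then have 2: "inverse (ennreal (J x)) \<le> ennreal (exp (C\<^sub>J * d y y')) * inverse (ennreal (J x'))"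
    using J by (simp add: inverse_ennreal ennreal_mult[symmetric] inverse_eq_divide del: ennreal_mult')
  have "f (R x - 1) x / ennreal (J x) \<le> (ennreal (exp (L' * (\<beta> * d y y'))) * f (R x - 1) x') * (ennreal (exp (C\<^sub>J * d y y')) * inverse (ennreal (J x')))"
    unfolding divide_ennreal_def by (intro mult_mono 1 2) auto
  also have "\<dots> = ennreal (exp (L' * (\<beta> * d y y')) * exp (C\<^sub>J * d y y')) * (f (R x' - 1) x' / ennreal (J x'))"
    by (simp add: divide_ennreal_def ennreal_mult R mult_ac)
  also have "exp (L' * (\<beta> * d y y')) * exp (C\<^sub>J * d y y') = exp (L * d y y')"
    unfolding mult_exp_exp L'_contract[symmetric] by (simp add: algebra_simps)
  finally show ?thesis using y by (simp add: branch_def x_def x'_def)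
qed

lemma transfer_regular:
  assumes f: "\<And>l. regular L' l (f l)"
  shows "regular L l (transfer (\<lambda>x. f (R x - 1) x))"
  unfolding regular_def
proof (intro ballI impI)
  fix \<omega>' y y' assume \<omega>': "\<omega>' \<in> P" and y: "y \<in> \<omega>'" "y' \<in> \<omega>'"
  let ?g = "\<lambda>x. f (R x - 1) x"
  have "transfer ?g y \<le> (\<integral>\<^sup>+\<omega>. ennreal (exp (L * d y y')) * branch ?g \<omega> y' \<partial>count_space P)"
    unfolding transfer_def
  proof (rule nn_integral_mono)
    fix \<omega> assume "\<omega> \<in> space (count_space P)"
    then have \<omega>: "\<omega> \<in> P" by simp
    show "branch ?g \<omega> y \<le> ennreal (exp (L * d y y')) * branch ?g \<omega> y'"
    proof (cases "y \<in> F ` \<omega>")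
      case True
      then have "y' \<in> F ` \<omega>" using markov[OF \<omega> \<omega>'] y by blast
      then show ?thesis by (rule branch_distortion[OF f \<omega> True])
    qed (simp add: branch_def)
  qed
  also have "\<dots> = ennreal (exp (L * d y y')) * transfer ?g y'"
    unfolding transfer_def by (rule nn_integral_cmult) simp
  finally show "transfer ?g y \<le> ennreal (exp (L * d y y')) * transfer ?g y'" .
qed

lemma regular_mono: "regular c l g \<Longrightarrow> c \<le> c' \<Longrightarrow> regular c' l g"
  unfolding regular_def
  by (meson d_nonneg ennreal_leI exp_le_cancel_iff mult_right_mono order_trans zero_le)

lemma regular_level: "regular c l g \<Longrightarrow> regular c (Suc l) g"
  unfolding regular_def by auto

lemma push_regular:
  assumes f: "\<And>l. regular L' l (f l)"
  shows "regular L 0 (push f 0)" "regular L' l (push f l)"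
proof -
  show 1: "regular L 0 (push f 0)" unfolding push_def using transfer_regular[OF f] by simp
  show "regular L' l (push f l)"
  proof (cases l)
    case 0 then show ?thesis using regular_mono[OF 1 L(2)] by simp
  next
    case (Suc k) then show ?thesis using regular_level[OF f[of k]] by (simp add: push_def)
  qed
qed

text \<open>
  Bounded distortion compares the values of a branch with its mean over an image of measure between \<open>\<delta>\<^sub>0\<close> and
  the total mass.
\<close>

lemma branch_le_integral:
  assumes f: "tmeas f" "\<And>l. regular L' l (f l)" and \<omega>: "\<omega> \<in> P" and y: "y \<in> F ` \<omega>"
  defines "g \<equiv> \<lambda>x. f (R x - 1) x"
  shows "ennreal \<delta>\<^sub>0 * branch g \<omega> y \<le> ennreal (exp L) * (\<integral>\<^sup>+y. branch g \<omega> y \<partial>m)"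
    and "(\<integral>\<^sup>+y. branch g \<omega> y \<partial>m) \<le> ennreal (exp L) * emeasure m (space m) * branch g \<omega> y"
proof -
  have [measurable]: "g \<in> borel_measurable m" unfolding g_def by (rule tmeas_top[OF f(1)])
  note [measurable] = branch_measurable[OF \<omega>, of g] F_image_sets[OF \<omega>]
  have dist: "branch g \<omega> z \<le> ennreal (exp L) * branch g \<omega> z'" if "z \<in> F ` \<omega>" "z' \<in> F ` \<omega>" for z z'
  proof -
    have "branch g \<omega> z \<le> ennreal (exp (L * d z z')) * branch g \<omega> z'"
      unfolding g_def by (rule branch_distortion[OF f(2) \<omega> that])
    also have "\<dots> \<le> ennreal (exp L) * branch g \<omega> z'"
      using L(1) d_le_1[of z z'] by (intro mult_right_mono ennreal_leI) (auto intro!: mult_left_le)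
    finally show ?thesis .
  qed
  have "ennreal \<delta>\<^sub>0 * branch g \<omega> y \<le> emeasure m (F ` \<omega>) * branch g \<omega> y"
    using long[OF \<omega>] by (intro mult_right_mono) (auto simp: emeasure_eq_measure intro!: ennreal_leI)
  also have "\<dots> = (\<integral>\<^sup>+z. branch g \<omega> y * indicator (F ` \<omega>) z \<partial>m)"
    by (subst nn_integral_cmult_indicator) (auto simp: mult.commute)
  also have "\<dots> \<le> (\<integral>\<^sup>+z. ennreal (exp L) * branch g \<omega> z \<partial>m)"
    using dist[OF y] by (intro nn_integral_mono) (auto split: split_indicator)
  also have "\<dots> = ennreal (exp L) * (\<integral>\<^sup>+y. branch g \<omega> y \<partial>m)" by (rule nn_integral_cmult) simp
  finally show "ennreal \<delta>\<^sub>0 * branch g \<omega> y \<le> ennreal (exp L) * (\<integral>\<^sup>+y. branch g \<omega> y \<partial>m)" .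
  have "(\<integral>\<^sup>+z. branch g \<omega> z \<partial>m) \<le> (\<integral>\<^sup>+z. ennreal (exp L) * branch g \<omega> y \<partial>m)"
  proof (rule nn_integral_mono)
    fix z show "branch g \<omega> z \<le> ennreal (exp L) * branch g \<omega> y"
      using dist[OF _ y, of z] by (cases "z \<in> F ` \<omega>") (auto simp: branch_def)
  qed
  then show "(\<integral>\<^sup>+y. branch g \<omega> y \<partial>m) \<le> ennreal (exp L) * emeasure m (space m) * branch g \<omega> y"
    by (simp add: mult_ac)
qed

lemma integral_transfer_cells:
  assumes [measurable]: "g \<in> borel_measurable m" "u \<in> borel_measurable m"
  shows "(\<integral>\<^sup>+y. u y * transfer g y \<partial>m) = (\<integral>\<^sup>+\<omega>. (\<integral>\<^sup>+y. u y * branch g \<omega> y \<partial>m) \<partial>count_space P)"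
proof -
  have "(\<integral>\<^sup>+y. u y * transfer g y \<partial>m) = (\<integral>\<^sup>+y. (\<integral>\<^sup>+\<omega>. u y * branch g \<omega> y \<partial>count_space P) \<partial>m)"
    by (simp add: transfer_def nn_integral_cmult)
  then show ?thesis by (simp add: swap_cells)
qed

text \<open>
  Every branch is bounded by its own mass; summing over the branches keeps the constant.
\<close>

lemma transfer_bounded:
  assumes f: "tmeas f" "\<And>l. regular L' l (f l)"
  shows "ennreal \<delta>\<^sub>0 * push f 0 y \<le> ennreal (exp L) * (\<integral>\<^sup>+y. push f 0 y \<partial>m)"
proof -
  let ?g = "\<lambda>x. f (R x - 1) x"
  note [measurable] = tmeas_top[OF f(1)]
  have "ennreal \<delta>\<^sub>0 * transfer ?g y = (\<integral>\<^sup>+\<omega>. ennreal \<delta>\<^sub>0 * branch ?g \<omega> y \<partial>count_space P)"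
    unfolding transfer_def by (rule nn_integral_cmult[symmetric]) simp
  also have "\<dots> \<le> (\<integral>\<^sup>+\<omega>. ennreal (exp L) * (\<integral>\<^sup>+y. branch ?g \<omega> y \<partial>m) \<partial>count_space P)"
  proof (rule nn_integral_mono)
    fix \<omega> assume "\<omega> \<in> space (count_space P)"
    then show "ennreal \<delta>\<^sub>0 * branch ?g \<omega> y \<le> ennreal (exp L) * (\<integral>\<^sup>+y. branch ?g \<omega> y \<partial>m)"
      using branch_le_integral(1)[OF f, of \<omega> y] by (cases "y \<in> F ` \<omega>") (auto simp: branch_def)
  qed
  also have "\<dots> = ennreal (exp L) * (\<integral>\<^sup>+\<omega>. (\<integral>\<^sup>+y. branch ?g \<omega> y \<partial>m) \<partial>count_space P)"
    by (rule nn_integral_cmult) simp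
  also have "(\<integral>\<^sup>+\<omega>. (\<integral>\<^sup>+y. branch ?g \<omega> y \<partial>m) \<partial>count_space P) = (\<integral>\<^sup>+y. transfer ?g y \<partial>m)"
    using integral_transfer_cells[OF tmeas_top[OF f(1)], of "\<lambda>_. 1"] by simp
  finally show ?thesis by (simp add: push_def)
qed

lemma space_m_pos: "0 < measure m (space m)"
proof -
  have "0 < \<delta>\<^sub>0" by (rule \<delta>\<^sub>0)
  also have "\<delta>\<^sub>0 \<le> measure m (F ` star)" by (rule long[OF star])
  also have "\<dots> \<le> measure m (space m)"
    by (rule bounded_measure)
  finally show ?thesis .
qed

text \<open>
  Finitely many cells cover all but measure less than \<open>\<delta>\<^sub>0\<close>, so an image of a cell, having measure at least
  \<open>\<delta>\<^sub>0\<close>, meets one of them and then contains it.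
\<close>

lemma finite_cells: "\<exists>S\<subseteq>P. finite S \<and> (\<forall>\<omega>\<in>P. \<exists>\<sigma>\<in>S. \<sigma> \<subseteq> F ` \<omega>)"
proof -
  define A where "A = (\<lambda>n. \<Union>(from_nat_into P ` {..<n}))"
  have Pne: "P \<noteq> {}" using star by auto
  have nat_P: "from_nat_into P i \<in> P" for i using Pne by (rule from_nat_into)
  have A_sets: "range A \<subseteq> sets m" using P_sets nat_P by (auto simp: A_def)
  have A_mono: "incseq A" unfolding A_def incseq_def by (intro allI impI Union_mono image_mono) auto
  have "(\<lambda>n. measure m (A n)) \<longlonglongrightarrow> measure m (\<Union>n. A n)"
    by (rule finite_Lim_measure_incseq[OF A_sets A_mono])
  also have "(\<Union>n. A n) = \<Union>P"
  proof -
    have "(\<Union>n. A n) = \<Union>(range (from_nat_into P))" unfolding A_def by blast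
    then show ?thesis using range_from_nat_into[OF Pne P_countable] by simp
  qed
  also have "measure m (\<Union>P) = measure m (space m)"
  proof -
    have "\<Union>P \<in> sets m" using P_countable P_sets by (auto intro: sets.countable_Union)
    then have "measure m (space m - \<Union>P) = measure m (space m) - measure m (\<Union>P)"
      by (rule finite_measure_compl)
    moreover have "measure m (space m - \<Union>P) = 0" using P_cover by (simp add: measure_def null_sets_def)
    ultimately show ?thesis by simp
  qed
  finally have "eventually (\<lambda>n. measure m (space m) - \<delta>\<^sub>0 < measure m (A n)) sequentially"
    using \<delta>\<^sub>0 by (intro order_tendstoD(1)) auto
  then obtain n where n: "measure m (space m) - \<delta>\<^sub>0 < measure m (A n)" by (auto simp: eventually_sequentially)
  define S where "S = from_nat_into P ` {..<n}"
  have "\<exists>\<sigma>\<in>S. \<sigma> \<subseteq> F ` \<omega>" if \<omega>: "\<omega> \<in> P" for \<omega>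
  proof (rule ccontr)
    assume "\<not> (\<exists>\<sigma>\<in>S. \<sigma> \<subseteq> F ` \<omega>)"
    then have "\<sigma> \<inter> F ` \<omega> = {}" if "\<sigma> \<in> S" for \<sigma>
      using markov[OF \<omega>, of \<sigma>] nat_P that by (auto simp: S_def)
    then have disj: "A n \<inter> F ` \<omega> = {}" by (auto simp: A_def S_def)
    have "measure m (A n) + \<delta>\<^sub>0 \<le> measure m (A n) + measure m (F ` \<omega>)" using long[OF \<omega>] by simp
    also have "\<dots> = measure m (A n \<union> F ` \<omega>)"
      using A_sets F_image_sets[OF \<omega>] disj by (intro finite_measure_Union[symmetric]) auto
    also have "\<dots> \<le> measure m (space m)" by (rule bounded_measure)
    finally show False using n by simp
  qed
  then show ?thesis using nat_P by (intro exI[of _ S]) (auto simp: S_def)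
qed

definition hits :: "nat \<Rightarrow> 'a set" where
  "hits t = {x \<in> space m. (tower_map F R ^^ t) (x, 0) \<in> star \<times> {0}}"

definition star_indicator :: "nat \<Rightarrow> 'a \<Rightarrow> ennreal" where
  "star_indicator l x = (if l = 0 then indicator star x else 0)"

lemma tmeas_star_indicator: "tmeas star_indicator"
  unfolding tmeas_def star_indicator_def using P_sets[OF star] by simp

lemma koopman_star_indicator: "x \<in> space m \<Longrightarrow> (koopman ^^ t) star_indicator 0 x = indicator (hits t) x"
  by (auto simp: koopman_pow star_indicator_def hits_def split: prod.splits split_indicator)

lemma hits_measurable [measurable]: "hits t \<in> sets m"
proof -
  have "{x \<in> space m. (koopman ^^ t) star_indicator 0 x = 1} \<in> sets m"
    using tmeasD[OF tmeas_koopman_pow[OF tmeas_star_indicator], of t 0] by measurable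
  also have "{x \<in> space m. (koopman ^^ t) star_indicator 0 x = 1} = hits t"
  proof -
    have "(koopman ^^ t) star_indicator 0 x = 1 \<longleftrightarrow> x \<in> hits t" if "x \<in> space m" for x
      using that by (simp only: koopman_star_indicator indicator_eq_1_iff)
    moreover have "hits t \<subseteq> space m" by (auto simp: hits_def)
    ultimately show ?thesis by blast
  qed
  finally show ?thesis .
qed

text \<open>
  A branch contains one of finitely many cells in its image and has on it a density comparable to its
  mass; so only the finitely many measures of points of these cells that are in \<open>star\<close> at times \<open>t\<close> with
  \<open>N \<le> t < 2 N\<close> matter, and they are positive. The range of times contains every residue class modulo \<open>N\<close>.
\<close>

lemma hitting: "\<exists>N\<ge>1. \<exists>c>0. (\<forall>t\<in>{N..<2*N}. \<forall>f. tmeas f \<longrightarrow> (\<forall>l. regular L' l (f l)) \<longrightarrow>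
     ennreal c * (\<integral>\<^sup>+y. push f 0 y \<partial>m) \<le> (\<integral>\<^sup>+y\<in>hits t. push f 0 y \<partial>m)) \<and> 0 < measure m (star \<inter> hits N)"
proof -
  obtain S where S: "S \<subseteq> P" "finite S" "\<And>\<omega>. \<omega> \<in> P \<Longrightarrow> \<exists>\<sigma>\<in>S. \<sigma> \<subseteq> F ` \<omega>"
    using finite_cells by blast
  have hits_eq: "\<sigma> \<inter> hits t = {x \<in> \<sigma>. (tower_map F R ^^ t) (x, 0) \<in> star \<times> {0}}" if "\<sigma> \<in> P" for \<sigma> t
    using P_space[OF that] by (auto simp: hits_def)
  have "\<forall>\<sigma>\<in>insert star S. \<exists>n. \<forall>t\<ge>n. 0 < measure m (\<sigma> \<inter> hits t)"
    using hit star S(1) hits_eq by (simp add: subset_iff)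
  then obtain n where n: "\<And>\<sigma> t. \<sigma> \<in> insert star S \<Longrightarrow> n \<sigma> \<le> t \<Longrightarrow> 0 < measure m (\<sigma> \<inter> hits t)"
    by metis
  define N where "N = Max (insert 1 (n ` insert star S))"
  have N1: "1 \<le> N" unfolding N_def using S(2) by (intro Max_ge) auto
  have nN: "n \<sigma> \<le> N" if "\<sigma> \<in> insert star S" for \<sigma>
    unfolding N_def using S(2) that by (intro Max_ge) auto
  define V where "V = (\<lambda>(\<sigma>, t). measure m (\<sigma> \<inter> hits t)) ` (insert star S \<times> {N..<2*N})"
  have V: "finite V" "V \<noteq> {}" using S(2) N1 by (auto simp: V_def)
  \<comment> \<open>The distortion \<open>exp L\<close> and the size of the space convert the measure of a set into a proportion of the mass.\<close>
  define c where "c = Min V / (exp L * measure m (space m))"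
  have "0 < Min V"
  proof (subst Min_gr_iff[OF V], intro ballI)
    fix v assume "v \<in> V"
    then obtain p where p: "p \<in> insert star S \<times> {N..<2*N}" "v = measure m (fst p \<inter> hits (snd p))"
      unfolding V_def case_prod_beta' by blast
    then have *: "fst p \<in> insert star S" "N \<le> snd p" by (auto simp: mem_Times_iff)
    then show "0 < v" using n[OF *(1), of "snd p"] nN[OF *(1)] p(2) by simp
  qed
  then have c: "0 < c" using space_m_pos by (simp add: c_def)
  have "ennreal c * (\<integral>\<^sup>+y. push f 0 y \<partial>m) \<le> (\<integral>\<^sup>+y\<in>hits t. push f 0 y \<partial>m)"
    if t: "t \<in> {N..<2*N}" and f: "tmeas f" "\<And>l. regular L' l (f l)" for t f
  proof -
    let ?g = "\<lambda>x. f (R x - 1) x"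
    note [measurable] = tmeas_top[OF f(1)]
    have "ennreal c * (\<integral>\<^sup>+y. branch ?g \<omega> y \<partial>m) \<le> (\<integral>\<^sup>+y. indicator (hits t) y * branch ?g \<omega> y \<partial>m)"
      if \<omega>: "\<omega> \<in> P" for \<omega>
    proof -
      note [measurable] = branch_measurable[OF \<omega>, of ?g]
      obtain \<sigma> where \<sigma>: "\<sigma> \<in> S" "\<sigma> \<subseteq> F ` \<omega>" using S(3)[OF \<omega>] by auto
      have [measurable]: "\<sigma> \<in> sets m" using \<sigma> S P_sets by auto
      have K: "ennreal (exp L) * emeasure m (space m) = ennreal (exp L * measure m (space m))"
        by (simp add: emeasure_eq_measure ennreal_mult)
      have "c * (exp L * measure m (space m)) = Min V" using space_m_pos by (simp add: c_def)
      also have "\<dots> \<le> measure m (\<sigma> \<inter> hits t)"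
        using V t \<sigma> by (intro Min_le) (auto simp: V_def)
      finally have "ennreal c * ennreal (exp L * measure m (space m)) \<le> emeasure m (\<sigma> \<inter> hits t)"
        using c by (simp add: emeasure_eq_measure ennreal_mult[symmetric] ennreal_leI)
      then have c_le: "ennreal c * ennreal (exp L * measure m (space m)) * (\<integral>\<^sup>+y. branch ?g \<omega> y \<partial>m)
          \<le> emeasure m (\<sigma> \<inter> hits t) * (\<integral>\<^sup>+y. branch ?g \<omega> y \<partial>m)" by (rule mult_right_mono) simp
      also have "\<dots> = (\<integral>\<^sup>+z. (\<integral>\<^sup>+y. branch ?g \<omega> y \<partial>m) * indicator (\<sigma> \<inter> hits t) z \<partial>m)"
        by (subst nn_integral_cmult_indicator) (auto simp: mult.commute)
      also have "\<dots> \<le> (\<integral>\<^sup>+z. ennreal (exp L * measure m (space m)) * (indicator (hits t) z * branch ?g \<omega> z) \<partial>m)"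
        using branch_le_integral(2)[OF f \<omega>] \<sigma>(2)
        by (intro nn_integral_mono) (auto simp: K split: split_indicator)
      also have "\<dots> = ennreal (exp L * measure m (space m)) * (\<integral>\<^sup>+z. indicator (hits t) z * branch ?g \<omega> z \<partial>m)"
        by (rule nn_integral_cmult) measurable
      finally have "ennreal (exp L * measure m (space m)) * (ennreal c * (\<integral>\<^sup>+y. branch ?g \<omega> y \<partial>m))
        \<le> ennreal (exp L * measure m (space m)) * (\<integral>\<^sup>+z. indicator (hits t) z * branch ?g \<omega> z \<partial>m)"
        by (simp only: mult_ac)
      then show ?thesis
        using space_m_pos by (subst (asm) ennreal_mult_le_mult_iff) (auto simp: ennreal_eq_0_iff not_le)
    qed
    then have "(\<integral>\<^sup>+\<omega>. ennreal c * (\<integral>\<^sup>+y. branch ?g \<omega> y \<partial>m) \<partial>count_space P) \<le>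
       (\<integral>\<^sup>+\<omega>. (\<integral>\<^sup>+y. indicator (hits t) y * branch ?g \<omega> y \<partial>m) \<partial>count_space P)"
      by (intro nn_integral_mono) simp
    also have "\<dots> = (\<integral>\<^sup>+y. indicator (hits t) y * transfer ?g y \<partial>m)"
      by (rule integral_transfer_cells[symmetric]) measurable
    also have "(\<integral>\<^sup>+\<omega>. ennreal c * (\<integral>\<^sup>+y. branch ?g \<omega> y \<partial>m) \<partial>count_space P) =
        ennreal c * (\<integral>\<^sup>+y. transfer ?g y \<partial>m)"
      using integral_transfer_cells[OF tmeas_top[OF f(1)], of "\<lambda>_. 1"] by (simp add: nn_integral_cmult)
    finally show ?thesis by (simp add: push_def mult.commute)
  qed
  moreover have "0 < measure m (star \<inter> hits N)" using n[of star N] nN[of star] by simp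
  ultimately show ?thesis using N1 c by (intro exI[of _ N] conjI exI[of _ c]) auto
qed

end

section \<open>Releasing a fixed fraction of the mass\<close>

text \<open>
  Subtracting \<open>c\<close> multiplies relative differences by at most \<open>1 / (1 - q)\<close>. The exponential form is
  Bernoulli's inequality for the exponent \<open>p = 1 / (1 - q)\<close>.
\<close>

lemma exp_stretch:
  fixes a b c s q :: real
  assumes s: "0 \<le> s" and q: "0 \<le> q" "q < 1" and ab: "a \<le> exp s * b" and b: "0 \<le> b" and c: "0 \<le> c" "c \<le> q * b"
  shows "a - c \<le> exp (s / (1 - q)) * (b - c)"
proof -
  define p where "p = 1 / (1 - q)"
  have p: "1 \<le> p" using q by (simp add: p_def)
  have bc: "(1 - q) * b \<le> b - c" using c by (simp add: algebra_simps)
  then have pb: "b \<le> p * (b - c)" using q by (simp add: p_def field_simps)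
  have "1 - s \<le> exp (- s)" using exp_ge_add_one_self[of "- s"] by simp
  then have "exp s * (1 - s) \<le> exp s * exp (- s)" by (intro mult_left_mono) auto
  then have "exp s - 1 \<le> exp s * s" by (simp add: mult_exp_exp algebra_simps)
  then have "(p - 1) * (exp s - 1) \<le> (p - 1) * (exp s * s)" using p by (intro mult_left_mono) auto
  then have "1 + p * (exp s - 1) \<le> exp s * (1 + s * (p - 1))" by (simp add: algebra_simps)
  also have "\<dots> \<le> exp s * exp (s * (p - 1))"
    using exp_ge_add_one_self[of "s * (p - 1)"] by (intro mult_left_mono) auto
  also have "\<dots> = exp (s / (1 - q))" by (simp add: mult_exp_exp p_def algebra_simps)
  finally have E: "1 + p * (exp s - 1) \<le> exp (s / (1 - q))" .
  have "0 \<le> (1 - q) * b" using b q by simp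
  then have "0 \<le> b - c" using bc by linarith
  have "a - c \<le> (b - c) + (exp s - 1) * b" using ab by (simp add: algebra_simps)
  also have "(exp s - 1) * b \<le> (exp s - 1) * (p * (b - c))" using s by (intro mult_left_mono pb) auto
  also have "(b - c) + (exp s - 1) * (p * (b - c)) = (1 + p * (exp s - 1)) * (b - c)" by (simp add: algebra_simps)
  also have "\<dots> \<le> exp (s / (1 - q)) * (b - c)" by (intro mult_right_mono E \<open>0 \<le> b - c\<close>)
  finally show ?thesis by simp
qed

text \<open>
  \<open>N\<close> and \<open>c\<^sub>1\<close> are supplied by \<open>hitting\<close>.
\<close>

locale blocked_tower = markov_tower +
  fixes N :: nat and c\<^sub>1 :: real
  assumes N: "1 \<le> N" and c\<^sub>1: "0 < c\<^sub>1"
    and hit_block: "t \<in> {N..<2*N} \<Longrightarrow> tmeas f \<Longrightarrow> (\<And>l. regular L' l (f l)) \<Longrightarrow>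
      ennreal c\<^sub>1 * (\<integral>\<^sup>+y. push f 0 y \<partial>m) \<le> (\<integral>\<^sup>+y\<in>hits t. push f 0 y \<partial>m)"
    and return: "0 < measure m (star \<inter> hits N)"
begin

definition \<theta> :: real where "\<theta> = \<delta> * exp (- L)"

lemma \<theta>: "0 < \<theta>" using \<delta> by (simp add: \<theta>_def)

text \<open>
  The mass to be released. As densities vary by at most the factor \<open>exp L\<close> on \<open>star\<close>, the factor \<open>\<theta>\<close> guarantees that
  the corresponding constant density is at most the fraction \<open>\<delta>\<close> of \<open>f\<close> (see \<open>removal_le\<close>).
\<close>

definition removal :: "(nat \<Rightarrow> 'a \<Rightarrow> ennreal) \<Rightarrow> ennreal" where
  "removal f = ennreal \<theta> * (\<integral>\<^sup>+x\<in>star. f 0 x \<partial>m)"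

definition \<kappa> :: "nat \<Rightarrow> 'a \<Rightarrow> ennreal" where
  "\<kappa> l x = (if l = 0 \<and> x \<in> star then 1 / emeasure m star else 0)"

definition strip :: "(nat \<Rightarrow> 'a \<Rightarrow> ennreal) \<Rightarrow> nat \<Rightarrow> 'a \<Rightarrow> ennreal" where
  "strip f l x = f l x - removal f * \<kappa> l x"

text \<open>
  The evolution of a density from which quanta of \<open>\<kappa>\<close> are released at the positive multiples of \<open>N\<close>.
\<close>

primrec residual :: "(nat \<Rightarrow> 'a \<Rightarrow> ennreal) \<Rightarrow> nat \<Rightarrow> nat \<Rightarrow> 'a \<Rightarrow> ennreal" where
  "residual f 0 = f"
| "residual f (Suc n) = (if N dvd Suc n then strip (push (residual f n)) else push (residual f n))"

definition removed :: "(nat \<Rightarrow> 'a \<Rightarrow> ennreal) \<Rightarrow> nat \<Rightarrow> ennreal" where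
  "removed f n = (if n \<noteq> 0 \<and> N dvd n then removal (push (residual f (n - 1))) else 0)"

lemma star_pos: "0 < measure m star"
proof -
  have "0 < measure m (star \<inter> hits N)" by (rule return)
  also have "\<dots> \<le> measure m star" using P_sets[OF star] by (intro finite_measure_mono) auto
  finally show ?thesis .
qed

lemma star_emeasure: "emeasure m star \<noteq> 0" "emeasure m star \<noteq> top" "emeasure m star = ennreal (measure m star)"
  using star_pos by (auto simp: emeasure_eq_measure)

lemma tmeas_\<kappa>: "tmeas \<kappa>"
proof -
  note [measurable] = P_sets[OF star]
  show ?thesis unfolding tmeas_def \<kappa>_def by measurable
qed

lemma removal_le:
  assumes f: "tmeas f" "regular L 0 (f 0)"
  shows "removal f * \<kappa> l x \<le> ennreal \<delta> * f l x"
proof (cases "l = 0 \<and> x \<in> star")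
  case True
  note [measurable] = P_sets[OF star] tmeasD[OF f(1)]
  have x: "x \<in> star" "0 < R x" using True R_pos[OF P_space[OF star, of x]] by auto
  have "(\<integral>\<^sup>+y\<in>star. f 0 y \<partial>m) \<le> (\<integral>\<^sup>+y. (ennreal (exp L) * f 0 x) * indicator star y \<partial>m)"
  proof (rule nn_integral_mono)
    fix y show "f 0 y * indicator star y \<le> (ennreal (exp L) * f 0 x) * indicator star y"
    proof (cases "y \<in> star")
      case True
      have "f 0 y \<le> ennreal (exp (L * d y x)) * f 0 x"
        using f(2) star True x R_pos[OF P_space[OF star True]] unfolding regular_def by auto
      also have "\<dots> \<le> ennreal (exp L) * f 0 x"
        using L(1) d_le_1[of y x] by (intro mult_right_mono ennreal_leI) (auto intro!: mult_left_le)
      finally show ?thesis using True by simp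
    qed simp
  qed
  also have "\<dots> = ennreal (exp L) * f 0 x * emeasure m star"
    by (rule nn_integral_cmult_indicator) simp
  finally have "removal f \<le> ennreal \<theta> * (ennreal (exp L) * f 0 x * emeasure m star)"
    unfolding removal_def by (rule mult_left_mono) simp
  also have "\<dots> = ennreal (\<theta> * exp L) * f 0 x * emeasure m star"
    using \<theta> by (simp add: ennreal_mult mult_ac)
  also have "\<theta> * exp L = \<delta>" by (simp add: \<theta>_def mult_exp_exp mult.assoc)
  finally have "removal f / emeasure m star \<le> ennreal \<delta> * f 0 x * emeasure m star / emeasure m star"
    by (rule divide_right_mono_ennreal)
  also have "\<dots> = ennreal \<delta> * f 0 x" using star_emeasure by (intro ennreal_mult_divide_eq)
  finally show ?thesis using True by (simp add: \<kappa>_def ennreal_times_divide)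
qed (auto simp: \<kappa>_def)

lemma removal_le': "tmeas f \<Longrightarrow> regular L 0 (f 0) \<Longrightarrow> removal f * \<kappa> l x \<le> f l x"
  using removal_le[of f l x] \<delta> mult_right_mono[of "ennreal \<delta>" 1 "f l x"]
  by (simp add: ennreal_le_1 order_trans[OF removal_le])

lemma strip_add: "tmeas f \<Longrightarrow> regular L 0 (f 0) \<Longrightarrow> strip f l x + removal f * \<kappa> l x = f l x"
  unfolding strip_def by (intro diff_add_cancel_ennreal removal_le')

lemma strip_ge:
  assumes "tmeas f" "regular L 0 (f 0)"
  shows "ennreal (1 - \<delta>) * f l x \<le> strip f l x"
proof -
  have "ennreal (1 - \<delta>) * f l x + removal f * \<kappa> l x \<le> ennreal (1 - \<delta>) * f l x + ennreal \<delta> * f l x"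
    by (intro add_left_mono removal_le assms)
  also have "\<dots> = f l x" using \<delta> by (simp add: distrib_right[symmetric] ennreal_plus[symmetric] del: ennreal_plus)
  finally show ?thesis unfolding strip_def ennreal_le_minus_iff by simp
qed

lemma strip_le: "strip f l x \<le> f l x"
  unfolding strip_def by (rule diff_le_self_ennreal)

lemma tmeas_strip:
  assumes "tmeas f" shows "tmeas (strip f)"
proof -
  note [measurable] = tmeasD[OF assms] tmeasD[OF tmeas_\<kappa>]
  show ?thesis unfolding tmeas_def strip_def by measurable
qed

text \<open>
  Off \<open>star\<close> nothing changes. On \<open>star\<close> a constant, at most the fraction \<open>\<delta>\<close> of the density, is subtracted, and
  \<open>exp_stretch\<close> applies.
\<close>

lemma strip_regular:
  assumes f: "tmeas f" "regular L 0 (f 0)" "\<And>l. regular L' l (f l)"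
  shows "regular L' l (strip f l)"
  unfolding regular_def
proof (intro ballI impI)
  fix \<omega> x y assume \<omega>: "\<omega> \<in> P" and x: "x \<in> \<omega>" "y \<in> \<omega>" and lx: "l < R x"
  show "strip f l x \<le> ennreal (exp (L' * d x y)) * strip f l y"
  proof (cases "l = 0 \<and> \<omega> = star")
    case False
    then have "\<kappa> l x = 0" "\<kappa> l y = 0"
      using x \<omega> star P_disjoint by (auto simp: \<kappa>_def disjoint_def)
    then show ?thesis using f(3)[of l] \<omega> x lx by (auto simp: strip_def regular_def)
  next
    case True
    define c where "c = removal f * \<kappa> 0 x"
    have cy: "c = removal f * \<kappa> 0 y" using True x by (simp add: c_def \<kappa>_def)
    have fx: "f 0 x \<le> ennreal (exp (L * d x y)) * f 0 y"
      using f(2) \<omega> x lx True by (auto simp: regular_def)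
    have c_le: "c \<le> ennreal \<delta> * f 0 y" unfolding cy by (rule removal_le[OF f(1,2)])
    have "f 0 x - c \<le> ennreal (exp (L' * d x y)) * (f 0 y - c)"
    proof (cases "f 0 y = top")
      case True
      then show ?thesis by (simp add: ennreal_mult_top)
    next
      case False
      then obtain b where b: "f 0 y = ennreal b" "0 \<le> b" by (cases "f 0 y") auto
      have "c \<noteq> top" "f 0 x \<noteq> top"
        using c_le fx b by (auto simp: ennreal_mult[symmetric] top_unique ennreal_mult_eq_top_iff)
      then obtain a c' where a: "f 0 x = ennreal a" "0 \<le> a" and c': "c = ennreal c'" "0 \<le> c'"
        by (cases "f 0 x"; cases c) auto
      have "a \<le> exp (L * d x y) * b" using fx a b by (simp add: ennreal_mult[symmetric])
      moreover have "c' \<le> \<delta> * b" using c_le b c' \<delta> by (simp add: ennreal_mult[symmetric])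
      ultimately have "a - c' \<le> exp (L * d x y / (1 - \<delta>)) * (b - c')"
        using \<delta> L d_nonneg[of x y] c'(2) b by (intro exp_stretch) auto
      moreover have "c' \<le> b" using \<open>c' \<le> \<delta> * b\<close> b \<delta> mult_right_mono[of \<delta> 1 b] by simp
      ultimately show ?thesis
        using a b c' by (simp add: ennreal_minus ennreal_mult[symmetric] L'_def ennreal_leI)
    qed
    then show ?thesis using True by (simp add: strip_def cy[symmetric] c_def)
  qed
qed

definition standard :: "(nat \<Rightarrow> 'a \<Rightarrow> ennreal) \<Rightarrow> bool" where
  "standard f \<longleftrightarrow> tmeas f \<and> (\<forall>l. regular L' l (f l))"

lemma standard_push:
  assumes "standard f"
  shows "standard (push f)" "regular L 0 (push f 0)" "tmeas (push f)"
  using assms push_regular[of f] tmeas_push[of f] by (auto simp: standard_def)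

lemma standard_residual: "standard f \<Longrightarrow> standard (residual f n)"
proof (induction n)
  case (Suc n)
  note n = standard_push[OF Suc.IH[OF Suc.prems]]
  have "standard (strip (push (residual f n)))"
    unfolding standard_def using tmeas_strip[OF n(3)] strip_regular[OF n(3) n(2)] n(1) by (simp add: standard_def)
  then show ?case using n(1) by simp
qed simp

lemma residual_le: "residual f (Suc n) l x \<le> push (residual f n) l x"
  by (simp add: strip_le)

lemma residual_ge: "standard f \<Longrightarrow> ennreal (1 - \<delta>) * push (residual f n) l x \<le> residual f (Suc n) l x"
  using strip_ge[OF standard_push(3,2)[OF standard_residual]] \<delta> mult_right_mono[of "ennreal (1 - \<delta>)" 1 "push (residual f n) l x"]
  by (auto simp: ennreal_le_1)

lemma residual_add: "standard f \<Longrightarrow> residual f (Suc n) l x + removed f (Suc n) * \<kappa> l x = push (residual f n) l x"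
  using strip_add[OF standard_push(3,2)[OF standard_residual]] by (simp add: removed_def)

lemma standardD: "standard f \<Longrightarrow> tmeas f" by (simp add: standard_def)

lemma push_integral_step:
  assumes f: "standard f" and u: "tmeas u"
  shows "integ (\<lambda>l x. koopman u l x * residual f n l x) =
    integ (\<lambda>l x. u l x * residual f (Suc n) l x) + removed f (Suc n) * integ (\<lambda>l x. u l x * \<kappa> l x)"
proof -
  have "integ (\<lambda>l x. koopman u l x * residual f n l x) = integ (\<lambda>l x. u l x * push (residual f n) l x)"
    by (rule integ_dual[symmetric, OF u standardD[OF standard_residual[OF f]]])
  also have "\<dots> = integ (\<lambda>l x. u l x * residual f (Suc n) l x + removed f (Suc n) * (u l x * \<kappa> l x))"
    unfolding residual_add[OF f, symmetric] by (simp only: distrib_left mult_ac)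
  also have "\<dots> = integ (\<lambda>l x. u l x * residual f (Suc n) l x) + integ (\<lambda>l x. removed f (Suc n) * (u l x * \<kappa> l x))"
  proof (rule integ_add)
    show "tmeas (\<lambda>l x. u l x * residual f (Suc n) l x)"
      by (rule tmeas_mult[OF u standardD[OF standard_residual[OF f]]])
    have "tmeas (\<lambda>l x. removed f (Suc n))" by (simp add: tmeas_def)
    then show "tmeas (\<lambda>l x. removed f (Suc n) * (u l x * \<kappa> l x))"
      by (intro tmeas_mult u tmeas_\<kappa>)
  qed
  also have "integ (\<lambda>l x. removed f (Suc n) * (u l x * \<kappa> l x)) = removed f (Suc n) * integ (\<lambda>l x. u l x * \<kappa> l x)"
    by (rule integ_cmult[OF tmeas_mult[OF u tmeas_\<kappa>]])
  finally show ?thesis .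
qed

text \<open>
  The evolution of \<open>f\<close> is tested against \<open>u\<close>, so that only linearity of the integral is needed. The quantum released at time \<open>k\<close>
  evolves like \<open>\<kappa>\<close> during the remaining \<open>n - k\<close> steps.
\<close>

lemma decomposition:
  assumes f: "standard f" and u: "tmeas u"
  shows "integ (\<lambda>l x. (koopman ^^ n) u l x * f l x) = integ (\<lambda>l x. u l x * residual f n l x) +
    (\<Sum>k=1..n. removed f k * integ (\<lambda>l x. (koopman ^^ (n - k)) u l x * \<kappa> l x))"
  using u
proof (induction n arbitrary: u)
  case (Suc n)
  have "(koopman ^^ Suc n) u = (koopman ^^ n) (koopman u)" by (simp add: funpow_Suc_right del: funpow.simps)
  then have "integ (\<lambda>l x. (koopman ^^ Suc n) u l x * f l x) = integ (\<lambda>l x. koopman u l x * residual f n l x) +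
    (\<Sum>k=1..n. removed f k * integ (\<lambda>l x. (koopman ^^ (n - k)) (koopman u) l x * \<kappa> l x))"
    using Suc.IH[OF tmeas_koopman[OF Suc.prems]] by simp
  also have "(\<Sum>k=1..n. removed f k * integ (\<lambda>l x. (koopman ^^ (n - k)) (koopman u) l x * \<kappa> l x)) =
      (\<Sum>k=1..n. removed f k * integ (\<lambda>l x. (koopman ^^ (Suc n - k)) u l x * \<kappa> l x))"
  proof (intro sum.cong refl)
    fix k assume "k \<in> {1..n}"
    then have "(koopman ^^ (Suc n - k)) u = (koopman ^^ (n - k)) (koopman u)"
      by (simp add: Suc_diff_le funpow_Suc_right del: funpow.simps)
    then show "removed f k * integ (\<lambda>l x. (koopman ^^ (n - k)) (koopman u) l x * \<kappa> l x) =
        removed f k * integ (\<lambda>l x. (koopman ^^ (Suc n - k)) u l x * \<kappa> l x)" by simp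
  qed
  finally show ?case
    unfolding push_integral_step[OF f Suc.prems] by (simp add: add_ac)
qed simp

lemma koopman_1: "koopman (\<lambda>_ _. 1) = (\<lambda>_ _. 1)"
  by (intro ext) (simp add: koopman_def)

lemma tmeas_const: "tmeas (\<lambda>_ _. c)"
  by (simp add: tmeas_def)

lemma integ_\<kappa>: "integ \<kappa> = 1"
proof -
  have "integ \<kappa> = integ (\<lambda>l x. if l = 0 then 1 / emeasure m star * indicator star x else 0)"
    by (intro integ_cong) (auto simp: \<kappa>_def)
  also have "\<dots> = 1 / emeasure m star * emeasure m star"
    unfolding integ_base by (rule nn_integral_cmult_indicator[OF P_sets[OF star]])
  also have "\<dots> = 1" using star_emeasure by (simp add: ennreal_divide_times less_top)
  finally show ?thesis .
qed

lemma mass_step: "standard f \<Longrightarrow> integ (residual f n) = integ (residual f (Suc n)) + removed f (Suc n)"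
  using push_integral_step[of f "\<lambda>_ _. 1" n] tmeas_const by (simp add: koopman_1 integ_\<kappa> del: residual.simps)

lemma mass_push: "tmeas f \<Longrightarrow> integ (push f) = integ f"
  using integ_dual[OF tmeas_const[of 1], of f] by (simp add: koopman_1)

lemma base_le_integ: "(\<integral>\<^sup>+x. f 0 x \<partial>m) \<le> integ f"
proof -
  have "(\<integral>\<^sup>+x. f 0 x \<partial>m) = integ (\<lambda>l x. if l = 0 then f 0 x else 0)" by (simp add: integ_base)
  also have "\<dots> \<le> integ f" by (intro integ_mono) auto
  finally show ?thesis .
qed

text \<open>
  Mass on level \<open>l\<close> either was in the base \<open>l\<close> steps ago or has not visited it yet.
\<close>

lemma residual_level: "residual f n l x = (if n \<le> l then f (l - n) x else residual f (n - l) 0 x)"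
proof (induction n arbitrary: l)
  case (Suc n)
  show ?case
  proof (cases l)
    case (Suc k)
    have "residual f (Suc n) (Suc k) x = residual f n k x" by (simp add: strip_def push_def \<kappa>_def)
    then show ?thesis using Suc.IH[of k] Suc by simp
  qed simp
qed simp

definition arrivals :: "(nat \<Rightarrow> 'a \<Rightarrow> ennreal) \<Rightarrow> nat \<Rightarrow> ennreal" where
  "arrivals f k = (\<integral>\<^sup>+y. push (residual f (k - 1)) 0 y \<partial>m)"

text \<open>
  The mass that is not in the base at any of the times \<open>1, \<dots>, n\<close>.
\<close>

definition inflow :: "(nat \<Rightarrow> 'a \<Rightarrow> ennreal) \<Rightarrow> nat \<Rightarrow> ennreal" where
  "inflow f n = integ (\<lambda>l x. if n \<le> l then f (l - n) x else 0)"

definition late :: "nat \<Rightarrow> 'a set" where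
  "late j = {x \<in> space m. j < R x}"

lemma late_measurable [measurable]: "late j \<in> sets m"
  unfolding late_def by measurable

text \<open>
  The mass on level \<open>l\<close> comes from the arrivals \<open>l\<close> steps ago, whose density is at most a constant times
  their mass, restricted to the set where \<open>R > l\<close>.
\<close>

lemma mass_bound:
  assumes f: "standard f"
  shows "integ (residual f n) \<le> inflow f n + (\<Sum>k=1..n. emeasure m (late (n - k)) * (ennreal (exp L / \<delta>\<^sub>0) * arrivals f k))"
proof -
  let ?f1 = "\<lambda>l x. if n \<le> l then f (l - n) x else 0"
  let ?f2 = "\<lambda>l x. if l < n then residual f (n - l) 0 x else 0"
  have tm: "tmeas ?f1" "tmeas ?f2"
  proof -
    have "?f1 l \<in> borel_measurable m" "?f2 l \<in> borel_measurable m" for l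
      using tmeasD[OF standardD[OF f], of "l - n"] tmeasD[OF standardD[OF standard_residual[OF f, of "n - l"]], of 0]
      by (cases "n \<le> l"; simp)+
    then show "tmeas ?f1" "tmeas ?f2" by (simp_all add: tmeas_def)
  qed
  have "integ (residual f n) = integ (\<lambda>l x. ?f1 l x + ?f2 l x)"
    by (intro integ_cong) (subst residual_level, auto)
  also have "\<dots> = inflow f n + integ ?f2"
    unfolding inflow_def by (rule integ_add[OF tm])
  also have "integ ?f2 \<le> (\<integral>\<^sup>+x. (\<Sum>l<n. ennreal (exp L / \<delta>\<^sub>0) * arrivals f (n - l) * indicator (late l) x) \<partial>m)"
    unfolding integ_def
  proof (rule nn_integral_mono)
    fix x assume x: "x \<in> space m"
    have "(\<Sum>l<R x. ?f2 l x) = (\<Sum>l\<in>{..<R x} \<inter> {..<n}. residual f (n - l) 0 x)"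
      by (subst sum.inter_restrict) auto
    also have "\<dots> \<le> (\<Sum>l\<in>{..<R x} \<inter> {..<n}. ennreal (exp L / \<delta>\<^sub>0) * arrivals f (n - l))"
    proof (rule sum_mono)
      fix l assume "l \<in> {..<R x} \<inter> {..<n}"
      then obtain k where k: "n - l = Suc k" by (cases "n - l") auto
      have "ennreal \<delta>\<^sub>0 * push (residual f k) 0 x \<le> ennreal (exp L) * arrivals f (Suc k)"
        unfolding arrivals_def using transfer_bounded[of "residual f k" x] standard_residual[OF f, of k] by (simp add: standard_def)
      then have "ennreal (1 / \<delta>\<^sub>0) * (ennreal \<delta>\<^sub>0 * push (residual f k) 0 x) \<le> ennreal (1 / \<delta>\<^sub>0) * (ennreal (exp L) * arrivals f (Suc k))"
        by (rule mult_left_mono) simp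
      then have "push (residual f k) 0 x \<le> ennreal (exp L / \<delta>\<^sub>0) * arrivals f (Suc k)"
        using \<delta>\<^sub>0 by (simp add: mult.assoc[symmetric] ennreal_mult[symmetric])
      then show "residual f (n - l) 0 x \<le> ennreal (exp L / \<delta>\<^sub>0) * arrivals f (n - l)"
        unfolding k using residual_le[of f k 0 x] by (rule order_trans[rotated])
    qed
    also have "{..<R x} \<inter> {..<n} = {l \<in> {..<n}. l < R x}" by auto
    also have "(\<Sum>l\<in>\<dots>. ennreal (exp L / \<delta>\<^sub>0) * arrivals f (n - l)) =
        (\<Sum>l<n. if l < R x then ennreal (exp L / \<delta>\<^sub>0) * arrivals f (n - l) else 0)"
      by (rule sum.inter_filter) simp
    also have "\<dots> = (\<Sum>l<n. ennreal (exp L / \<delta>\<^sub>0) * arrivals f (n - l) * indicator (late l) x)"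
      using x by (intro sum.cong) (auto simp: late_def)
    finally show "(\<Sum>l<R x. ?f2 l x) \<le> (\<Sum>l<n. ennreal (exp L / \<delta>\<^sub>0) * arrivals f (n - l) * indicator (late l) x)" .
  qed
  also have "\<dots> = (\<Sum>l<n. ennreal (exp L / \<delta>\<^sub>0) * arrivals f (n - l) * emeasure m (late l))"
    by (subst nn_integral_sum) (auto simp: nn_integral_cmult_indicator)
  also have "\<dots> = (\<Sum>k=1..n. emeasure m (late (n - k)) * (ennreal (exp L / \<delta>\<^sub>0) * arrivals f k))"
    by (rule sum.reindex_bij_witness[of _ "\<lambda>k. n - k" "\<lambda>l. n - l"]) (auto simp: mult.commute)
  finally show ?thesis by simp
qed

text \<open>
  Each step keeps at least the fraction \<open>1 - \<delta>\<close> of the density, at every point.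
\<close>

lemma survive:
  assumes f: "standard f" and u: "tmeas u"
  shows "ennreal ((1 - \<delta>) ^ \<tau>) * integ (\<lambda>l x. (koopman ^^ \<tau>) u l x * push (residual f j) l x)
    \<le> integ (\<lambda>l x. u l x * push (residual f (j + \<tau>)) l x)"
  using u
proof (induction \<tau> arbitrary: u)
  case (Suc \<tau>)
  let ?g = "\<lambda>k. push (residual f k)"
  have "(koopman ^^ Suc \<tau>) u = (koopman ^^ \<tau>) (koopman u)" by (simp add: funpow_Suc_right del: funpow.simps)
  then have "ennreal ((1 - \<delta>) ^ Suc \<tau>) * integ (\<lambda>l x. (koopman ^^ Suc \<tau>) u l x * ?g j l x) =
      ennreal (1 - \<delta>) * (ennreal ((1 - \<delta>) ^ \<tau>) * integ (\<lambda>l x. (koopman ^^ \<tau>) (koopman u) l x * ?g j l x))"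
    using \<delta> by (simp add: ennreal_mult mult.assoc)
  also have "\<dots> \<le> ennreal (1 - \<delta>) * integ (\<lambda>l x. koopman u l x * ?g (j + \<tau>) l x)"
    by (intro mult_left_mono Suc.IH tmeas_koopman Suc.prems) simp
  also have "\<dots> = integ (\<lambda>l x. ennreal (1 - \<delta>) * (koopman u l x * ?g (j + \<tau>) l x))"
    by (rule integ_cmult[symmetric, OF tmeas_mult[OF tmeas_koopman[OF Suc.prems] standardD[OF standard_push(1)[OF standard_residual[OF f]]]]])
  also have "\<dots> \<le> integ (\<lambda>l x. koopman u l x * residual f (Suc (j + \<tau>)) l x)"
  proof (rule integ_mono)
    fix l x
    have "koopman u l x * (ennreal (1 - \<delta>) * ?g (j + \<tau>) l x) \<le> koopman u l x * residual f (Suc (j + \<tau>)) l x"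
      by (intro mult_left_mono residual_ge[OF f]) simp
    then show "ennreal (1 - \<delta>) * (koopman u l x * ?g (j + \<tau>) l x) \<le> koopman u l x * residual f (Suc (j + \<tau>)) l x"
      by (simp only: mult_ac)
  qed
  also have "\<dots> = integ (\<lambda>l x. u l x * ?g (j + Suc \<tau>) l x)"
    using integ_dual[OF Suc.prems standardD[OF standard_residual[OF f]], of "Suc (j + \<tau>)"] by simp
  finally show ?case .
qed simp

lemma integ_star_indicator: "integ (\<lambda>l x. star_indicator l x * g l x) = (\<integral>\<^sup>+x\<in>star. g 0 x \<partial>m)"
proof -
  have "integ (\<lambda>l x. star_indicator l x * g l x) = integ (\<lambda>l x. if l = 0 then g 0 x * indicator star x else 0)"
    by (intro integ_cong) (auto simp: star_indicator_def mult.commute)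
  then show ?thesis by (simp add: integ_base)
qed

lemma integ_koopman_star_indicator: "(\<integral>\<^sup>+x\<in>hits t. g 0 x \<partial>m) \<le> integ (\<lambda>l x. (koopman ^^ t) star_indicator l x * g l x)"
proof -
  have "(\<integral>\<^sup>+x\<in>hits t. g 0 x \<partial>m) = integ (\<lambda>l x. if l = 0 then g 0 x * indicator (hits t) x else 0)"
    by (simp add: integ_base)
  also have "\<dots> \<le> integ (\<lambda>l x. (koopman ^^ t) star_indicator l x * g l x)"
    by (intro integ_mono) (auto simp: koopman_star_indicator mult.commute)
  finally show ?thesis .
qed

text \<open>
  From any arrival, a fixed proportion is in \<open>star\<close> after \<open>\<tau>\<close> steps, where \<open>\<tau>\<close> is chosen such that \<open>k + \<tau>\<close> is a
  multiple of \<open>N\<close>; even if parts of it are released on the way, a fixed proportion is released then.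
\<close>

lemma removal_bound:
  assumes f: "standard f" and k: "1 \<le> k"
  shows "\<exists>\<tau>\<in>{N..<2*N}. ennreal (\<theta> * (1 - \<delta>) ^ (2 * N) * c\<^sub>1) * arrivals f k \<le> removed f (k + \<tau>)"
proof -
  obtain j where j: "k = Suc j" using k by (cases k) auto
  \<comment> \<open>\<open>k + \<tau>\<close> is the first multiple of \<open>N\<close> that is at least \<open>k + N\<close>.\<close>
  define \<tau> where "\<tau> = N + (N - 1 - (k + N - 1) mod N)"
  have "N dvd k + \<tau>"
  proof -
    have "(k + N - 1) mod N < N" using N by simp
    then have "k + \<tau> = (k + N - 1) - (k + N - 1) mod N + N"
      using N mod_less_eq_dividend[of "k + N - 1" N] unfolding \<tau>_def by linarith
    then show ?thesis by (simp add: minus_mod_eq_mult_div)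
  qed
  moreover have \<tau>: "\<tau> \<in> {N..<2*N}" using N by (auto simp: \<tau>_def)
  ultimately have "removed f (k + \<tau>) = removal (push (residual f (j + \<tau>)))"
    by (simp add: removed_def j)
  also have "\<dots> = ennreal \<theta> * integ (\<lambda>l x. star_indicator l x * push (residual f (j + \<tau>)) l x)"
    by (simp add: removal_def integ_star_indicator)
  finally have eq: "removed f (k + \<tau>) = ennreal \<theta> * integ (\<lambda>l x. star_indicator l x * push (residual f (j + \<tau>)) l x)" .
  have "ennreal (\<theta> * (1 - \<delta>) ^ (2 * N) * c\<^sub>1) * arrivals f k \<le> ennreal (\<theta> * (1 - \<delta>) ^ \<tau> * c\<^sub>1) * arrivals f k"
    using \<tau> \<theta> \<delta> c\<^sub>1 by (intro mult_right_mono ennreal_leI mult_right_mono mult_left_mono power_decreasing) auto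
  also have "\<dots> = ennreal \<theta> * (ennreal ((1 - \<delta>) ^ \<tau>) * (ennreal c\<^sub>1 * (\<integral>\<^sup>+y. push (residual f j) 0 y \<partial>m)))"
    using \<theta> \<delta> c\<^sub>1 by (simp add: arrivals_def j ennreal_mult mult.assoc)
  also have "\<dots> \<le> ennreal \<theta> * (ennreal ((1 - \<delta>) ^ \<tau>) * (\<integral>\<^sup>+y\<in>hits \<tau>. push (residual f j) 0 y \<partial>m))"
    using standard_residual[OF f, of j] by (intro mult_left_mono hit_block \<tau>) (auto simp: standard_def)
  also have "\<dots> \<le> ennreal \<theta> * (ennreal ((1 - \<delta>) ^ \<tau>) * integ (\<lambda>l x. (koopman ^^ \<tau>) star_indicator l x * push (residual f j) l x))"
    by (intro mult_left_mono integ_koopman_star_indicator) auto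
  also have "\<dots> \<le> removed f (k + \<tau>)"
    unfolding eq by (intro mult_left_mono survive[OF f tmeas_star_indicator]) simp
  finally show ?thesis using \<tau> by blast
qed

lemma standard_\<kappa>: "standard \<kappa>"
  unfolding standard_def
proof (intro conjI allI tmeas_\<kappa>)
  fix l show "regular L' l (\<kappa> l)"
    unfolding regular_def
  proof (intro ballI impI)
    fix \<omega> x y assume \<omega>: "\<omega> \<in> P" and x: "x \<in> \<omega>" "y \<in> \<omega>" and "l < R x"
    have "x \<in> star \<longleftrightarrow> y \<in> star" using x \<omega> star P_disjoint by (auto simp: disjoint_def)
    then have "\<kappa> l x = 1 * \<kappa> l y" by (simp add: \<kappa>_def)
    also have "\<dots> \<le> ennreal (exp (L' * d x y)) * \<kappa> l y"
      using L d_nonneg[of x y] by (intro mult_right_mono) (auto simp: ennreal_ge_1)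
    finally show "\<kappa> l x \<le> ennreal (exp (L' * d x y)) * \<kappa> l y" .
  qed
qed

text \<open>
  This makes the renewal process of released quanta aperiodic in units of \<open>N\<close>.
\<close>

lemma removed_\<kappa>_N: "0 < removed \<kappa> N"
proof -
  have "0 < ennreal \<theta> * (ennreal ((1 - \<delta>) ^ (N - 1)) * (1 / emeasure m star * emeasure m (star \<inter> hits N)))"
    using \<theta> \<delta> return star_emeasure
    by (auto simp: ennreal_zero_less_mult_iff ennreal_zero_less_divide emeasure_eq_measure less_top)
  also have "1 / emeasure m star * emeasure m (star \<inter> hits N) = (\<integral>\<^sup>+x\<in>hits N. \<kappa> 0 x \<partial>m)"
  proof -
    have "(\<integral>\<^sup>+x\<in>hits N. \<kappa> 0 x \<partial>m) = (\<integral>\<^sup>+x. 1 / emeasure m star * indicator (star \<inter> hits N) x \<partial>m)"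
      by (intro nn_integral_cong) (auto simp: \<kappa>_def split: split_indicator)
    also have "\<dots> = 1 / emeasure m star * emeasure m (star \<inter> hits N)"
      using P_sets[OF star] by (intro nn_integral_cmult_indicator) auto
    finally show ?thesis by simp
  qed
  also have "ennreal \<theta> * (ennreal ((1 - \<delta>) ^ (N - 1)) * (\<integral>\<^sup>+x\<in>hits N. \<kappa> 0 x \<partial>m)) \<le>
      ennreal \<theta> * (ennreal ((1 - \<delta>) ^ (N - 1)) * integ (\<lambda>l x. (koopman ^^ N) star_indicator l x * \<kappa> l x))"
    by (intro mult_left_mono integ_koopman_star_indicator) auto
  also have "(koopman ^^ N) star_indicator = koopman ((koopman ^^ (N - 1)) star_indicator)"
    using N by (cases N) auto
  also have "integ (\<lambda>l x. koopman ((koopman ^^ (N - 1)) star_indicator) l x * \<kappa> l x) =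
      integ (\<lambda>l x. (koopman ^^ (N - 1)) star_indicator l x * push (residual \<kappa> 0) l x)"
    using integ_dual[OF tmeas_koopman_pow[OF tmeas_star_indicator] tmeas_\<kappa>] by simp
  also have "ennreal \<theta> * (ennreal ((1 - \<delta>) ^ (N - 1)) * \<dots>) \<le>
      ennreal \<theta> * integ (\<lambda>l x. star_indicator l x * push (residual \<kappa> (0 + (N - 1))) l x)"
    by (intro mult_left_mono survive standard_\<kappa> tmeas_star_indicator) auto
  also have "\<dots> = removed \<kappa> N" using N by (simp add: removed_def removal_def integ_star_indicator)
  finally show ?thesis .
qed

end

section \<open>Convergence of evolved densities\<close>

lemma sum_multiples:
  fixes g :: "nat \<Rightarrow> real"
  assumes N: "1 \<le> N" and g: "\<And>i. \<not> N dvd i \<Longrightarrow> g i = 0"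
  shows "(\<Sum>i=0..n * N. g i) = (\<Sum>k=0..n. g (k * N))"
proof -
  have "(\<Sum>k=0..n. g (k * N)) = (\<Sum>i\<in>(\<lambda>k. k * N) ` {0..n}. g i)"
    using N by (subst sum.reindex) (auto simp: inj_on_def)
  also have "\<dots> = (\<Sum>i=0..n * N. g i)"
  proof (rule sum.mono_neutral_left)
    show "\<forall>i\<in>{0..n * N} - (\<lambda>k. k * N) ` {0..n}. g i = 0"
    proof
      fix i assume i: "i \<in> {0..n * N} - (\<lambda>k. k * N) ` {0..n}"
      have "\<not> N dvd i"
      proof
        assume "N dvd i"
        then obtain k where k: "i = k * N" by (metis dvd_def mult.commute)
        then have "k \<le> n" using i N by simp
        then show False using i k by auto
      qed
      then show "g i = 0" by (rule g)
    qed
  qed auto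
  finally show ?thesis by simp
qed

context blocked_tower begin

definition level_tail :: "nat \<Rightarrow> real" where "level_tail j = measure m (late j)"

definition bounded :: "real \<Rightarrow> (nat \<Rightarrow> 'a \<Rightarrow> ennreal) \<Rightarrow> bool" where
  "bounded D f \<longleftrightarrow> 0 \<le> D \<and> (\<forall>l x. f l x \<le> ennreal D)"

text \<open>
  Summation by columns: the column over \<open>x\<close> has \<open>R x - n\<close> levels from \<open>n\<close> on.
\<close>

lemma level_tail_sum_ennreal: "integ (\<lambda>l x. if n \<le> l then 1 else 0) = (\<Sum>i. emeasure m (late (i + n)))"
proof -
  have "integ (\<lambda>l x. if n \<le> l then 1 else 0) = (\<integral>\<^sup>+x. (\<Sum>i. indicator (late (i + n)) x) \<partial>m)"
    unfolding integ_def
  proof (rule nn_integral_cong)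
    fix x assume x: "x \<in> space m"
    have "(\<Sum>i. indicator (late (i + n)) x) = (\<Sum>i<R x - n. indicator (late (i + n)) x :: ennreal)"
      by (rule suminf_finite) (auto simp: late_def indicator_def)
    also have "\<dots> = (\<Sum>i<R x - n. 1)"
      using x by (intro sum.cong) (auto simp: late_def indicator_def)
    also have "\<dots> = (\<Sum>l\<in>{n..<R x}. 1)" by simp
    also have "{n..<R x} = {l \<in> {..<R x}. n \<le> l}" by auto
    also have "(\<Sum>l\<in>\<dots>. 1) = (\<Sum>l<R x. if n \<le> l then 1 else (0::ennreal))"
      by (rule sum.inter_filter) simp
    finally show "(\<Sum>l<R x. if n \<le> l then 1 else 0) = (\<Sum>i. indicator (late (i + n)) x :: ennreal)" by simp
  qed
  also have "\<dots> = (\<Sum>i. emeasure m (late (i + n)))"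
    by (subst nn_integral_suminf) auto
  finally show ?thesis .
qed

lemma total_finite: "integ (\<lambda>_ _. 1) < top"
proof -
  have "integ (\<lambda>_ _. 1) = (\<integral>\<^sup>+x. ennreal (real (R x)) \<partial>m)"
    unfolding integ_def by (simp add: ennreal_of_nat_eq_real_of_nat)
  also have "\<dots> < top" using R_integrable by (simp add: integrable_iff_bounded)
  finally show ?thesis .
qed

lemma level_tail_summable: "summable level_tail"
proof (rule summable_suminf_not_top)
  have "integ (\<lambda>l x. if 0 \<le> l then 1 else 0) \<noteq> top" using total_finite by simp
  then show "(\<Sum>i. ennreal (level_tail i)) \<noteq> top" using level_tail_sum_ennreal[of 0] by (simp add: level_tail_def emeasure_eq_measure)
qed (simp add: level_tail_def)

lemma level_tail_sum: "integ (\<lambda>l x. if n \<le> l then 1 else 0) = ennreal (\<Sum>i. level_tail (i + n))"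
proof -
  have "(\<Sum>i. ennreal (level_tail (i + n))) = ennreal (\<Sum>i. level_tail (i + n))"
    by (rule suminf_ennreal2) (auto simp: level_tail_def intro!: summable_ignore_initial_segment[OF level_tail_summable, unfolded level_tail_def])
  then show ?thesis unfolding level_tail_sum_ennreal by (simp add: level_tail_def emeasure_eq_measure)
qed

lemma level_tail_antimono: "antimono level_tail"
  unfolding level_tail_def by (intro antimonoI finite_measure_mono) (auto simp: late_def)

definition residual_mass :: "(nat \<Rightarrow> 'a \<Rightarrow> ennreal) \<Rightarrow> nat \<Rightarrow> real" where "residual_mass f n = enn2real (integ (residual f n))"
definition released :: "(nat \<Rightarrow> 'a \<Rightarrow> ennreal) \<Rightarrow> nat \<Rightarrow> real" where "released f n = enn2real (removed f n)"

lemma integ_finite: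
  assumes "bounded D f"
  shows "integ f < top"
proof -
  have "integ f \<le> integ (\<lambda>l x. ennreal D * 1)" using assms by (intro integ_mono) (simp add: bounded_def)
  also have "\<dots> = ennreal D * integ (\<lambda>_ _. 1)" by (rule integ_cmult[OF tmeas_const])
  also have "\<dots> < top" using total_finite by (simp add: ennreal_mult_less_top)
  finally show ?thesis .
qed

lemma inflow_bounded:
  assumes "bounded D f"
  shows "inflow f n \<le> ennreal (D * (\<Sum>i. level_tail (i + n)))"
proof -
  have "inflow f n \<le> integ (\<lambda>l x. ennreal D * (if n \<le> l then 1 else 0))"
    unfolding inflow_def using assms by (intro integ_mono) (simp add: bounded_def)
  also have "\<dots> = ennreal D * integ (\<lambda>l x. if n \<le> l then 1 else 0)"
    by (rule integ_cmult) (simp add: tmeas_def)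
  also have "\<dots> = ennreal (D * (\<Sum>i. level_tail (i + n)))"
    unfolding level_tail_sum using assms by (simp add: bounded_def ennreal_mult')
  finally show ?thesis .
qed

lemma integ_residual_le: "standard f \<Longrightarrow> integ (residual f n) \<le> integ f"
proof (induction n)
  case (Suc n)
  have "integ (residual f (Suc n)) \<le> integ (residual f n)" unfolding mass_step[OF Suc.prems, of n] by simp
  then show ?case using Suc by simp
qed simp

lemma integ_residual_finite: "standard f \<Longrightarrow> bounded D f \<Longrightarrow> integ (residual f n) < top"
  using integ_residual_le integ_finite by (meson le_less_trans)

lemma removed_le: "standard f \<Longrightarrow> removed f n \<le> integ f"
proof (cases n)
  case (Suc k)
  assume f: "standard f"
  have "removed f (Suc k) \<le> integ (residual f k)" unfolding mass_step[OF f, of k] by simp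
  then show ?thesis using integ_residual_le[OF f, of k] Suc by simp
qed (simp add: removed_def)

lemma residual_mass_step:
  assumes f: "standard f" "bounded D f"
  shows "residual_mass f n = residual_mass f (Suc n) + released f (Suc n)"
  unfolding residual_mass_def released_def mass_step[OF f(1), of n]
  by (rule enn2real_plus) (use integ_residual_finite[OF f] le_less_trans[OF removed_le[OF f(1)] integ_finite[OF f(2)]] in \<open>auto simp del: residual.simps\<close>)

lemma released_nonneg: "0 \<le> released f n" by (simp add: released_def)
lemma residual_mass_nonneg: "0 \<le> residual_mass f n" by (simp add: residual_mass_def)
lemma released_0: "released f 0 = 0" by (simp add: released_def removed_def)
lemma released_dvd: "\<not> N dvd n \<Longrightarrow> released f n = 0" by (simp add: released_def removed_def)

lemma residual_mass_sum:
  assumes f: "standard f" "bounded D f"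
  shows "residual_mass f 0 - (\<Sum>k=0..n. released f k) = residual_mass f n"
proof (induction n)
  case (Suc n)
  then show ?case using residual_mass_step[OF f, of n] by simp
qed (simp add: released_0)

lemma residual_mass_antimono:
  assumes f: "standard f" "bounded D f"
  shows "antimono (residual_mass f)"
proof (rule decseq_SucI)
  fix n show "residual_mass f (Suc n) \<le> residual_mass f n" using residual_mass_step[OF f, of n] released_nonneg[of f "Suc n"] by simp
qed

lemma arrivals_finite:
  assumes f: "standard f" "bounded D f"
  shows "arrivals f k < top"
proof -
  have "arrivals f k \<le> integ (push (residual f (k - 1)))" unfolding arrivals_def by (rule base_le_integ)
  also have "\<dots> = integ (residual f (k - 1))" by (rule mass_push[OF standardD[OF standard_residual[OF f(1)]]])
  also have "\<dots> < top" by (rule integ_residual_finite[OF f])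
  finally show ?thesis .
qed

abbreviation "c\<^sub>0 \<equiv> \<theta> * (1 - \<delta>) ^ (2 * N) * c\<^sub>1"

text \<open>
  The two bounds \<open>mass_bound\<close> and \<open>removal_bound\<close>, read as statements about the numbers \<open>residual_mass f n\<close>:
  what is released between the times \<open>k\<close> and \<open>k + 2 N\<close> is the loss of mass in this period.
\<close>

lemma draining_residual:
  assumes f: "standard f" "bounded D f"
  shows "draining level_tail (exp L / \<delta>\<^sub>0) c\<^sub>0 (2 * N) (residual_mass f) (\<lambda>k. enn2real (arrivals f k)) (\<lambda>n. enn2real (inflow f n))"
  unfolding draining_def
proof (intro conjI allI impI residual_mass_antimono[OF f] residual_mass_nonneg enn2real_nonneg)
  fix n
  have I: "inflow f n = ennreal (enn2real (inflow f n))"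
  proof -
    have "inflow f n < top" using inflow_bounded[OF f(2), of n] by (rule le_less_trans) simp
    then show ?thesis by simp
  qed
  have Bk: "arrivals f k = ennreal (enn2real (arrivals f k))" for k using arrivals_finite[OF f, of k] by simp
  have tm: "emeasure m (late j) * (ennreal (exp L / \<delta>\<^sub>0) * arrivals f k) = ennreal (level_tail j * ((exp L / \<delta>\<^sub>0) * enn2real (arrivals f k)))" for j k
    using \<delta>\<^sub>0 by (subst Bk) (simp add: level_tail_def emeasure_eq_measure ennreal_mult[symmetric])
  have "integ (residual f n) \<le> inflow f n + (\<Sum>k=1..n. emeasure m (late (n - k)) * (ennreal (exp L / \<delta>\<^sub>0) * arrivals f k))"
    by (rule mass_bound[OF f(1)])
  also have "\<dots> = ennreal (enn2real (inflow f n)) + (\<Sum>k=1..n. ennreal (level_tail (n - k) * ((exp L / \<delta>\<^sub>0) * enn2real (arrivals f k))))"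
    by (simp only: tm I[symmetric])
  also have "\<dots> = ennreal (enn2real (inflow f n) + (\<Sum>k=1..n. level_tail (n - k) * ((exp L / \<delta>\<^sub>0) * enn2real (arrivals f k))))"
    using \<delta>\<^sub>0 by (subst sum_ennreal) (auto simp: level_tail_def intro!: ennreal_plus[symmetric] sum_nonneg mult_nonneg_nonneg)
  finally have "residual_mass f n \<le> enn2real (inflow f n) + (\<Sum>k=1..n. level_tail (n - k) * ((exp L / \<delta>\<^sub>0) * enn2real (arrivals f k)))"
    unfolding residual_mass_def using \<delta>\<^sub>0
    by (intro enn2real_leI add_nonneg_nonneg sum_nonneg mult_nonneg_nonneg) (auto simp: level_tail_def)
  then show "residual_mass f n \<le> enn2real (inflow f n) + exp L / \<delta>\<^sub>0 * (\<Sum>k=1..n. level_tail (n - k) * enn2real (arrivals f k))"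
    by (simp add: sum_distrib_left mult_ac)
next
  fix k :: nat assume k: "1 \<le> k"
  obtain \<tau> where \<tau>: "\<tau> \<in> {N..<2*N}" "ennreal c\<^sub>0 * arrivals f k \<le> removed f (k + \<tau>)"
    using removal_bound[OF f(1) k] by blast
  have c0: "0 \<le> c\<^sub>0" using \<theta> \<delta> c\<^sub>1 by simp
  obtain j where j: "k + \<tau> = Suc j" using k by (cases "k + \<tau>") auto
  have "c\<^sub>0 * enn2real (arrivals f k) = enn2real (ennreal c\<^sub>0 * arrivals f k)"
    using c0 by (simp add: enn2real_mult)
  also have "\<dots> \<le> released f (k + \<tau>)"
    unfolding released_def using \<tau>(2) le_less_trans[OF removed_le[OF f(1)] integ_finite[OF f(2)]] by (rule enn2real_mono)
  also have "\<dots> = residual_mass f j - residual_mass f (Suc j)" using residual_mass_step[OF f, of j] j by simp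
  also have "\<dots> \<le> residual_mass f k - residual_mass f (k + 2 * N)"
    using \<tau>(1) N j antimonoD[OF residual_mass_antimono[OF f], of k j] antimonoD[OF residual_mass_antimono[OF f], of "Suc j" "k + 2 * N"] by simp
  finally show "c\<^sub>0 * enn2real (arrivals f k) \<le> residual_mass f k - residual_mass f (k + 2 * N)" .
qed

lemma bounded_\<kappa>: "bounded (1 / measure m star) \<kappa>"
  using star_pos by (auto simp: bounded_def \<kappa>_def star_emeasure(3) divide_ennreal simp flip: ennreal_1)

text \<open>
  As \<open>\<kappa>\<close> lives on the base, its inflow is a tail of \<open>R\<close> and not a sum of tails.
\<close>

lemma inflow_\<kappa>: "enn2real (inflow \<kappa> n) \<le> level_tail n / measure m star"
proof (rule enn2real_leI)
  have "inflow \<kappa> n \<le> (\<integral>\<^sup>+x. 1 / emeasure m star * indicator (late n) x \<partial>m)"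
    unfolding inflow_def integ_def
  proof (rule nn_integral_mono)
    fix x assume x: "x \<in> space m"
    have "(\<Sum>l<R x. if n \<le> l then \<kappa> (l - n) x else 0) \<le> (\<Sum>l<R x. if l = n then 1 / emeasure m star else 0)"
      by (intro sum_mono) (auto simp: \<kappa>_def)
    also have "\<dots> = 1 / emeasure m star * indicator (late n) x"
      using x by (simp add: sum.delta late_def)
    finally show "(\<Sum>l<R x. if n \<le> l then \<kappa> (l - n) x else 0) \<le> 1 / emeasure m star * indicator (late n) x" .
  qed
  also have "\<dots> = 1 / emeasure m star * emeasure m (late n)"
    by (rule nn_integral_cmult_indicator) simp
  also have "\<dots> = ennreal (level_tail n / measure m star)"
    using star_pos by (simp add: level_tail_def emeasure_eq_measure divide_ennreal ennreal_mult[symmetric] flip: ennreal_1)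
  finally show "inflow \<kappa> n \<le> ennreal (level_tail n / measure m star)" .
qed (simp add: level_tail_def)

text \<open>
  \<open>evolved f u n\<close> is the integral of \<open>u\<close> with respect to the image under \<open>T\<^sup>n\<close> of the measure with density
  \<open>f\<close>, and \<open>remainder f u n\<close> the contribution of the residual density to it.
\<close>

definition evolved :: "(nat \<Rightarrow> 'a \<Rightarrow> ennreal) \<Rightarrow> (nat \<Rightarrow> 'a \<Rightarrow> ennreal) \<Rightarrow> nat \<Rightarrow> real" where
  "evolved f u n = enn2real (integ (\<lambda>l x. (koopman ^^ n) u l x * f l x))"

definition remainder :: "(nat \<Rightarrow> 'a \<Rightarrow> ennreal) \<Rightarrow> (nat \<Rightarrow> 'a \<Rightarrow> ennreal) \<Rightarrow> nat \<Rightarrow> real" where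
  "remainder f u n = enn2real (integ (\<lambda>l x. u l x * residual f n l x))"

lemma koopman_pow_le_1: "(\<And>l x. u l x \<le> 1) \<Longrightarrow> (koopman ^^ n) u l x \<le> 1"
  by (simp add: koopman_pow split: prod.splits)

lemma weighted_finite:
  assumes "integ g < top" "\<And>l x. u l x \<le> 1"
  shows "integ (\<lambda>l x. u l x * g l x) < top"
proof -
  have "integ (\<lambda>l x. u l x * g l x) \<le> integ g"
    using mult_right_mono[OF assms(2)] by (intro integ_mono) simp
  then show ?thesis using assms(1) by simp
qed

lemma decomposition_real:
  assumes f: "standard f" "bounded D f" and u: "tmeas u" "\<And>l x. u l x \<le> 1"
  shows "evolved f u n = remainder f u n + (\<Sum>k=1..n. released f k * evolved \<kappa> u (n - k))"
proof -
  have fin: "integ (\<lambda>l x. u l x * residual f n l x) < top"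
    by (intro weighted_finite integ_residual_finite[OF f] u)
  have fin': "removed f k * integ (\<lambda>l x. (koopman ^^ (n - k)) u l x * \<kappa> l x) < top" for k
    using le_less_trans[OF removed_le[OF f(1)] integ_finite[OF f(2)]]
      weighted_finite[OF integ_finite[OF bounded_\<kappa>] koopman_pow_le_1[OF u(2)]]
    by (intro ennreal_mult_less_top[THEN iffD2]) auto
  have "evolved f u n = remainder f u n + enn2real (\<Sum>k=1..n. removed f k * integ (\<lambda>l x. (koopman ^^ (n - k)) u l x * \<kappa> l x))"
    unfolding evolved_def remainder_def decomposition[OF f(1) u(1)]
    by (rule enn2real_plus) (use fin fin' in auto)
  also have "enn2real (\<Sum>k=1..n. removed f k * integ (\<lambda>l x. (koopman ^^ (n - k)) u l x * \<kappa> l x)) =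
      (\<Sum>k=1..n. released f k * evolved \<kappa> u (n - k))"
    by (subst enn2real_sum) (use fin' in \<open>auto simp: released_def evolved_def enn2real_mult\<close>)
  finally show ?thesis .
qed

lemma decomposition_block:
  assumes f: "standard f" "bounded D f" and u: "tmeas u" "\<And>l x. u l x \<le> 1"
  shows "Abs_fps (\<lambda>j. evolved f u (j * N)) = Abs_fps (\<lambda>j. remainder f u (j * N)) +
    Abs_fps (\<lambda>j. released f (j * N)) * Abs_fps (\<lambda>j. evolved \<kappa> u (j * N))"
proof (rule fps_ext)
  fix j
  have "(\<Sum>k=1..j * N. released f k * evolved \<kappa> u (j * N - k)) = (\<Sum>k=0..j * N. released f k * evolved \<kappa> u (j * N - k))"
    by (subst sum.atLeast_Suc_atMost[of 0]) (auto simp: released_0)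
  also have "\<dots> = (\<Sum>k=0..j. released f (k * N) * evolved \<kappa> u (j * N - k * N))"
    by (rule sum_multiples[OF N]) (simp add: released_dvd)
  finally show "fps_nth (Abs_fps (\<lambda>j. evolved f u (j * N))) j = fps_nth (Abs_fps (\<lambda>j. remainder f u (j * N)) +
    Abs_fps (\<lambda>j. released f (j * N)) * Abs_fps (\<lambda>j. evolved \<kappa> u (j * N))) j"
    using decomposition_real[OF f u, of "j * N"] by (simp add: fps_mult_nth diff_mult_distrib)
qed

lemma sum_remainder_le:
  assumes f: "standard f" "bounded D f" and Q: "finite Q" and u: "\<And>a. a \<in> Q \<Longrightarrow> tmeas (u a)"
    and u1: "\<And>l x. (\<Sum>a\<in>Q. u a l x) \<le> 1"
  shows "(\<Sum>a\<in>Q. remainder f (u a) n) \<le> residual_mass f n"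
proof -
  note tp = standardD[OF standard_residual[OF f(1), of n]]
  have "(\<Sum>a\<in>Q. integ (\<lambda>l x. u a l x * residual f n l x)) = integ (\<lambda>l x. \<Sum>a\<in>Q. u a l x * residual f n l x)"
    by (rule integ_sum[symmetric, OF Q tmeas_mult[OF u tp]])
  also have "\<dots> \<le> integ (residual f n)"
    unfolding sum_distrib_right[symmetric] using mult_right_mono[OF u1] by (intro integ_mono) simp
  finally have le: "(\<Sum>a\<in>Q. integ (\<lambda>l x. u a l x * residual f n l x)) \<le> integ (residual f n)" .
  then have "(\<Sum>a\<in>Q. integ (\<lambda>l x. u a l x * residual f n l x)) < top"
    using integ_residual_finite[OF f, of n] by (rule le_less_trans)
  then have "(\<Sum>a\<in>Q. remainder f (u a) n) = enn2real (\<Sum>a\<in>Q. integ (\<lambda>l x. u a l x * residual f n l x))"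
    unfolding remainder_def using Q by (subst enn2real_sum) (auto simp: ennreal_sum_less_top)
  also have "\<dots> \<le> residual_mass f n" unfolding residual_mass_def using le integ_residual_finite[OF f] by (rule enn2real_mono)
  finally show ?thesis .
qed

text \<open>
  The functions \<open>u a\<close> are meant to be the indicators of a partition; the absolute values are estimated with weights
  that do not depend on \<open>a\<close>, so that summing over \<open>a\<close> costs nothing.
\<close>

theorem convergence:
  assumes rate: "rate_family \<Psi>" and \<psi>: "\<psi> \<in> \<Psi>" and A: "0 \<le> A" and tail: "\<And>n. (\<Sum>i. level_tail (i + n)) \<le> A * \<psi> n"
  shows "\<exists>\<psi>'\<in>\<Psi>. \<forall>f1 f2 D. standard f1 \<longrightarrow> standard f2 \<longrightarrow> bounded D f1 \<longrightarrow> bounded D f2 \<longrightarrow> integ f1 = integ f2 \<longrightarrow>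
    (\<exists>K\<ge>0. \<forall>n Q u. finite (Q :: 'b set) \<longrightarrow> (\<forall>a\<in>Q. tmeas (u a)) \<longrightarrow> (\<forall>l x. (\<Sum>a\<in>Q. u a l x) \<le> 1) \<longrightarrow>
       (\<Sum>a\<in>Q. \<bar>evolved f1 (u a) n - evolved f2 (u a) n\<bar>) \<le> K * \<psi>' n)"
proof -
  interpret rate_family \<Psi> by fact
  have c0: "0 < c\<^sub>0" using \<theta> \<delta> c\<^sub>1 by simp
  have t0: "\<And>n. 0 \<le> level_tail n" by (simp add: level_tail_def)
  obtain \<psi>1 where \<psi>1: "\<psi>1 \<in> \<Psi>" and drain: "\<forall>M B I D. draining level_tail (exp L / \<delta>\<^sub>0) c\<^sub>0 (2 * N) M B I \<longrightarrow> 0 \<le> D \<longrightarrow>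
     ((\<forall>n. I n \<le> D * \<psi> n) \<longrightarrow> (\<exists>K\<ge>0. \<forall>n. M n \<le> K * \<psi>1 n)) \<and>
     (summable I \<longrightarrow> (\<forall>n. (\<Sum>i. I (i + n)) \<le> D * \<psi> n) \<longrightarrow>
        summable M \<and> (\<exists>K\<ge>0. \<forall>n. (\<Sum>i. M (i + n)) \<le> K * \<psi>1 n))"
    using drain_rate[OF t0 level_tail_antimono level_tail_summable _ c0 _ \<psi> A tail, of "exp L / \<delta>\<^sub>0" "2 * N"] \<delta>\<^sub>0 N by auto
  have decay: "\<exists>K\<ge>0. \<forall>n. residual_mass f n \<le> K * \<psi>1 n" if f: "standard f" "bounded D f" for f D
  proof -
    have D: "0 \<le> D" using f(2) by (simp add: bounded_def)
    have "enn2real (inflow f n) \<le> D * A * \<psi> n" for n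
    proof (rule enn2real_leI)
      show "0 \<le> D * A * \<psi> n" using D A pos[OF \<psi>, of n] by simp
      have "inflow f n \<le> ennreal (D * (\<Sum>i. level_tail (i + n)))" by (rule inflow_bounded[OF f(2)])
      also have "\<dots> \<le> ennreal (D * A * \<psi> n)"
        using mult_left_mono[OF tail D, of n] by (intro ennreal_leI) (simp add: mult.assoc)
      finally show "inflow f n \<le> ennreal (D * A * \<psi> n)" .
    qed
    moreover have "0 \<le> D * A" using D A by simp
    ultimately show ?thesis using drain[rule_format, OF draining_residual[OF f], of "D * A"] by blast
  qed
  have \<kappa>: "standard \<kappa>" "bounded (1 / measure m star) \<kappa>" by (rule standard_\<kappa> bounded_\<kappa>)+
  have "summable (residual_mass \<kappa>) \<and> (\<exists>K\<ge>0. \<forall>n. (\<Sum>i. residual_mass \<kappa> (i + n)) \<le> K * \<psi>1 n)"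
  proof -
    let ?I = "\<lambda>n. enn2real (inflow \<kappa> n)"
    have s: "summable (\<lambda>n. level_tail n / measure m star)" using level_tail_summable by (rule summable_divide)
    have sI: "summable ?I"
      by (rule summable_comparison_test'[OF s]) (use inflow_\<kappa> in simp)
    have "(\<Sum>i. ?I (i + n)) \<le> A / measure m star * \<psi> n" for n
    proof -
      have "(\<Sum>i. ?I (i + n)) \<le> (\<Sum>i. level_tail (i + n) / measure m star)"
        by (intro suminf_le inflow_\<kappa> summable_ignore_initial_segment[OF sI] summable_ignore_initial_segment[OF s])
      also have "\<dots> = (\<Sum>i. level_tail (i + n)) / measure m star"
        by (rule suminf_divide) (intro summable_ignore_initial_segment level_tail_summable)
      also have "\<dots> \<le> A * \<psi> n / measure m star" by (intro divide_right_mono tail) simp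
      finally show ?thesis by simp
    qed
    moreover have "0 \<le> A / measure m star" using A by simp
    ultimately show ?thesis using sI drain[rule_format, OF draining_residual[OF \<kappa>], of "A / measure m star"] by blast
  qed
  then obtain K1 where sM: "summable (residual_mass \<kappa>)" and K1: "0 \<le> K1" "\<And>n. (\<Sum>i. residual_mass \<kappa> (i + n)) \<le> K1 * \<psi>1 n" by blast
  define q where "q = (\<lambda>j. released \<kappa> (j * N))"
  define tail\<kappa> where "tail\<kappa> = (\<lambda>j. residual_mass \<kappa> (j * N))"
  have M_block: "residual_mass f 0 - (\<Sum>k=0..n. released f (k * N)) = residual_mass f (n * N)" if "standard f" "bounded D f" for f D n
    using residual_mass_sum[OF that, of "n * N"] sum_multiples[OF N, of "released f" n] released_dvd by simp
  have M\<kappa>0: "residual_mass \<kappa> 0 = 1" by (simp add: residual_mass_def integ_\<kappa>)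
  have tail_le: "tail\<kappa> j \<le> residual_mass \<kappa> j" for j
    unfolding tail\<kappa>_def using N by (intro antimonoD[OF residual_mass_antimono[OF \<kappa>]]) simp
  have rp: "renewal_process q tail\<kappa>"
  proof
    show "0 < q 1"
      using removed_\<kappa>_N le_less_trans[OF removed_le[OF \<kappa>(1)] integ_finite[OF \<kappa>(2)]]
      by (simp add: q_def released_def enn2real_positive_iff)
    show "tail\<kappa> n = 1 - (\<Sum>k=0..n. q k)" for n
      using M_block[OF \<kappa>, of n] by (simp add: M\<kappa>0 q_def tail\<kappa>_def)
    show "summable tail\<kappa>"
      by (rule summable_comparison_test'[OF sM]) (use tail_le residual_mass_nonneg in \<open>simp add: tail\<kappa>_def\<close>)
  qed (auto simp: q_def tail\<kappa>_def released_nonneg released_0 residual_mass_nonneg)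
  interpret renewal_process q tail\<kappa> by (rule rp)
  have ts: "tail_sum n \<le> K1 * \<psi>1 n" for n
  proof -
    have "tail_sum n \<le> (\<Sum>i. residual_mass \<kappa> (i + n))"
      unfolding tail_sum_def
      by (intro suminf_le tail_le summable_ignore_initial_segment tail_summable sM)
    then show ?thesis using K1(2)[of n] by simp
  qed
  obtain \<psi>2 where \<psi>2: "\<psi>2 \<in> \<Psi>" and couple: "\<forall>p1 p2 X D. 0 \<le> D \<longrightarrow> (\<forall>k. 0 \<le> p1 k \<and> 0 \<le> p2 k) \<longrightarrow>
     (\<forall>n. 0 \<le> X - (\<Sum>k=0..n. p1 k) \<and> X - (\<Sum>k=0..n. p1 k) \<le> D * \<psi>1 n) \<longrightarrow>
     (\<forall>n. 0 \<le> X - (\<Sum>k=0..n. p2 k) \<and> X - (\<Sum>k=0..n. p2 k) \<le> D * \<psi>1 n) \<longrightarrow>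
     (\<exists>K\<ge>0. \<forall>n. (\<Sum>i=0..n. \<bar>fps_nth ((Abs_fps p1 - Abs_fps p2) * renewal_fps q) i\<bar> * tail\<kappa> (n - i)) \<le> K * \<psi>2 n)"
    using renewal_coupling[OF rp \<psi>1 K1(1) ts \<psi>1] by blast
  obtain \<psi>3 C3 where \<psi>3: "\<psi>3 \<in> \<Psi>" "0 < C3" "\<And>n. \<psi>1 (n div N) \<le> C3 * \<psi>3 n" "\<And>n. \<psi>2 (n div N) \<le> C3 * \<psi>3 n"
    using common_rate[OF \<psi>1 \<psi>2 N] by fastforce
  show ?thesis
  proof (intro bexI[OF _ \<psi>3(1)] allI impI)
    fix f1 f2 D assume f: "standard f1" "standard f2" "bounded D f1" "bounded D f2" and eq: "integ f1 = integ f2"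
    obtain D1 D2 where D1: "0 \<le> D1" "\<And>n. residual_mass f1 n \<le> D1 * \<psi>1 n" and D2: "0 \<le> D2" "\<And>n. residual_mass f2 n \<le> D2 * \<psi>1 n"
      using decay[OF f(1,3)] decay[OF f(2,4)] by blast
    define D' where "D' = D1 + D2"
    have D': "0 \<le> D'" using D1 D2 by (simp add: D'_def)
    have M_le: "residual_mass f1 n \<le> D' * \<psi>1 n" "residual_mass f2 n \<le> D' * \<psi>1 n" for n
    proof -
      have "D1 * \<psi>1 n \<le> D' * \<psi>1 n" "D2 * \<psi>1 n \<le> D' * \<psi>1 n"
        using pos[OF \<psi>1, of n] D1 D2 by (auto simp: D'_def)
      then show "residual_mass f1 n \<le> D' * \<psi>1 n" "residual_mass f2 n \<le> D' * \<psi>1 n" using D1(2)[of n] D2(2)[of n] by linarith+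
    qed
    have M_blk: "residual_mass f1 (n * N) \<le> D' * \<psi>1 n" "residual_mass f2 (n * N) \<le> D' * \<psi>1 n" for n
    proof -
      have "D' * \<psi>1 (n * N) \<le> D' * \<psi>1 n" using N by (intro mult_left_mono D' antimono[OF \<psi>1]) simp
      then show "residual_mass f1 (n * N) \<le> D' * \<psi>1 n" "residual_mass f2 (n * N) \<le> D' * \<psi>1 n" using M_le[of "n * N"] by linarith+
    qed
    have M0: "residual_mass f2 0 = residual_mass f1 0" by (simp add: residual_mass_def eq)
    let ?w = "(Abs_fps (\<lambda>j. released f1 (j * N)) - Abs_fps (\<lambda>j. released f2 (j * N))) * renewal_fps q"
    obtain K where K: "0 \<le> K" "\<And>n. (\<Sum>i=0..n. \<bar>fps_nth ?w i\<bar> * tail\<kappa> (n - i)) \<le> K * \<psi>2 n"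
    proof -
      have "\<exists>K\<ge>0. \<forall>n. (\<Sum>i=0..n. \<bar>fps_nth ?w i\<bar> * tail\<kappa> (n - i)) \<le> K * \<psi>2 n"
        by (rule couple[THEN spec, THEN spec, THEN spec[of _ "residual_mass f1 0"], THEN spec, THEN mp, OF D', THEN mp, THEN mp, THEN mp])
          (use released_nonneg residual_mass_nonneg M_blk M_block[OF f(1,3)] M_block[OF f(2,4), unfolded M0] in auto)
      then show ?thesis using that by blast
    qed
    show "\<exists>K\<ge>0. \<forall>n Q u. finite (Q :: 'b set) \<longrightarrow> (\<forall>a\<in>Q. tmeas (u a)) \<longrightarrow> (\<forall>l x. (\<Sum>a\<in>Q. u a l x) \<le> 1) \<longrightarrow>
       (\<Sum>a\<in>Q. \<bar>evolved f1 (u a) n - evolved f2 (u a) n\<bar>) \<le> K * \<psi>3 n"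
    proof (intro exI[of _ "(2 * D' + K) * C3"] conjI allI impI)
      show "0 \<le> (2 * D' + K) * C3" using D' K \<psi>3 by simp
      fix n :: nat and Q :: "'b set" and u
      assume Q: "finite Q" and u: "\<forall>a\<in>Q. tmeas (u a)" and u1: "\<forall>l x. (\<Sum>a\<in>Q. u a l x) \<le> 1"
      \<comment> \<open>Only multiples of \<open>N\<close> need to be considered: the remaining \<open>r < N\<close> steps are absorbed in the test functions.\<close>
      define j r where "j = n div N" and "r = n mod N"
      have n: "n = j * N + r" by (simp add: j_def r_def)
      define v where "v = (\<lambda>a. (koopman ^^ r) (u a))"
      have v: "tmeas (v a)" if "a \<in> Q" for a unfolding v_def using u that by (intro tmeas_koopman_pow) auto
      have v1: "(\<Sum>a\<in>Q. v a l x) \<le> 1" for l x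
        using u1 by (simp add: v_def koopman_pow case_prod_beta)
      have v1': "v a l x \<le> 1" if "a \<in> Q" for a l x
        using v1[of l x] member_le_sum[OF that, of "\<lambda>a. v a l x"] Q by (meson order_trans zero_le)
      have Xn: "evolved f (u a) n = evolved f (v a) (j * N)" for f a
        by (simp add: evolved_def n v_def funpow_add)
      have "\<bar>evolved f1 (u a) n - evolved f2 (u a) n\<bar> \<le> remainder f1 (v a) (j * N) + remainder f2 (v a) (j * N) +
          (\<Sum>i=0..j. \<bar>fps_nth ?w i\<bar> * remainder \<kappa> (v a) ((j - i) * N))" if a: "a \<in> Q" for a
      proof -
        let ?X = "\<lambda>f. Abs_fps (\<lambda>j. evolved f (v a) (j * N))"
        let ?E = "\<lambda>f. Abs_fps (\<lambda>j. remainder f (v a) (j * N))"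
        have X\<kappa>: "?X \<kappa> = renewal_fps q * ?E \<kappa>"
          using decomposition_block[OF \<kappa> v[OF a] v1'[OF a]]
          by (intro renewal_equation_solution) (simp add: q_def)
        have "?X f1 - ?X f2 = ?E f1 - ?E f2 + ?w * ?E \<kappa>"
          unfolding decomposition_block[OF f(1,3) v[OF a] v1'[OF a]] decomposition_block[OF f(2,4) v[OF a] v1'[OF a]] X\<kappa>
          by (simp add: algebra_simps)
        then have "fps_nth (?X f1 - ?X f2) j = fps_nth (?E f1 - ?E f2 + ?w * ?E \<kappa>) j" by simp
        then have "evolved f1 (u a) n - evolved f2 (u a) n = remainder f1 (v a) (j * N) - remainder f2 (v a) (j * N) +
            (\<Sum>i=0..j. fps_nth ?w i * remainder \<kappa> (v a) ((j - i) * N))"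
          unfolding Xn by (simp add: fps_mult_nth[of ?w])
        moreover have "\<bar>\<Sum>i=0..j. fps_nth ?w i * remainder \<kappa> (v a) ((j - i) * N)\<bar> \<le> (\<Sum>i=0..j. \<bar>fps_nth ?w i\<bar> * remainder \<kappa> (v a) ((j - i) * N))"
          by (rule order_trans[OF sum_abs]) (simp add: remainder_def abs_mult)
        moreover have "0 \<le> remainder f1 (v a) (j * N)" "0 \<le> remainder f2 (v a) (j * N)" by (simp_all add: remainder_def)
        ultimately show ?thesis by linarith
      qed
      then have "(\<Sum>a\<in>Q. \<bar>evolved f1 (u a) n - evolved f2 (u a) n\<bar>) \<le> (\<Sum>a\<in>Q. remainder f1 (v a) (j * N) + remainder f2 (v a) (j * N) +
          (\<Sum>i=0..j. \<bar>fps_nth ?w i\<bar> * remainder \<kappa> (v a) ((j - i) * N)))"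
        by (rule sum_mono)
      also have "\<dots> = (\<Sum>a\<in>Q. remainder f1 (v a) (j * N)) + (\<Sum>a\<in>Q. remainder f2 (v a) (j * N)) +
          (\<Sum>i=0..j. \<bar>fps_nth ?w i\<bar> * (\<Sum>a\<in>Q. remainder \<kappa> (v a) ((j - i) * N)))"
        unfolding sum.distrib sum_distrib_left by (rule arg_cong2[where f = "(+)", OF refl sum.swap])
      also have "(\<Sum>i=0..j. \<bar>fps_nth ?w i\<bar> * (\<Sum>a\<in>Q. remainder \<kappa> (v a) ((j - i) * N))) \<le> (\<Sum>i=0..j. \<bar>fps_nth ?w i\<bar> * tail\<kappa> (j - i))"
        unfolding tail\<kappa>_def by (intro sum_mono mult_left_mono sum_remainder_le[OF \<kappa> Q v v1]) auto
      also have "\<dots> \<le> K * \<psi>2 j" by (rule K(2))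
      also have "\<dots> \<le> K * (C3 * \<psi>3 n)" unfolding j_def by (intro mult_left_mono K \<psi>3)
      also have "(\<Sum>a\<in>Q. remainder f1 (v a) (j * N)) \<le> D' * (C3 * \<psi>3 n)"
      proof -
        have "(\<Sum>a\<in>Q. remainder f1 (v a) (j * N)) \<le> residual_mass f1 (j * N)" by (rule sum_remainder_le[OF f(1,3) Q v v1])
        also have "\<dots> \<le> D' * \<psi>1 j" by (rule M_blk)
        also have "\<dots> \<le> D' * (C3 * \<psi>3 n)" unfolding j_def by (intro mult_left_mono D' \<psi>3)
        finally show ?thesis .
      qed
      also have "(\<Sum>a\<in>Q. remainder f2 (v a) (j * N)) \<le> D' * (C3 * \<psi>3 n)"
      proof -
        have "(\<Sum>a\<in>Q. remainder f2 (v a) (j * N)) \<le> residual_mass f2 (j * N)" by (rule sum_remainder_le[OF f(2,4) Q v v1])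
        also have "\<dots> \<le> D' * \<psi>1 j" by (rule M_blk)
        also have "\<dots> \<le> D' * (C3 * \<psi>3 n)" unfolding j_def by (intro mult_left_mono D' \<psi>3)
        finally show ?thesis .
      qed
      finally show "(\<Sum>a\<in>Q. \<bar>evolved f1 (u a) n - evolved f2 (u a) n\<bar>) \<le> (2 * D' + K) * C3 * \<psi>3 n"
        by (simp add: algebra_simps)
    qed
  qed
qed

end

section \<open>Exact Markov cells and hitting times from mixing\<close>

lemma sep_time_sym: "sep_time F P x y = sep_time F P y x"
  unfolding sep_time_def by (simp add: conj_commute)

text \<open>
  Two points of a common cell are separated one step later than their images.
\<close>

lemma sep_time_Suc_le:
  assumes "\<omega> \<in> P" "x \<in> \<omega>" "y \<in> \<omega>"
  shows "eSuc (sep_time F P (F x) (F y)) \<le> sep_time F P x y"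
  unfolding sep_time_def[of F P x y]
proof (rule Inf_greatest)
  fix s assume "s \<in> {enat n | n. \<not> (\<exists>\<omega>\<in>P. (F ^^ n) x \<in> \<omega> \<and> (F ^^ n) y \<in> \<omega>)}"
  then obtain n where s: "s = enat n" and n: "\<not> (\<exists>\<omega>\<in>P. (F ^^ n) x \<in> \<omega> \<and> (F ^^ n) y \<in> \<omega>)" by auto
  obtain k where k: "n = Suc k" using n assms by (cases n) auto
  have "sep_time F P (F x) (F y) \<le> enat k"
    unfolding sep_time_def using n by (intro Inf_lower) (auto simp: k funpow_Suc_right simp del: funpow.simps)
  then show "eSuc (sep_time F P (F x) (F y)) \<le> s" by (simp add: s k flip: eSuc_enat)
qed

lemma enat_power_bounds: "0 < \<beta> \<Longrightarrow> \<beta> < 1 \<Longrightarrow> 0 \<le> enat_power \<beta> s" "0 < \<beta> \<Longrightarrow> \<beta> < 1 \<Longrightarrow> enat_power \<beta> s \<le> 1"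
  by (auto simp: enat_power_def power_le_one split: enat.splits)

lemma enat_power_antimono: "0 < \<beta> \<Longrightarrow> \<beta> < 1 \<Longrightarrow> s \<le> s' \<Longrightarrow> enat_power \<beta> s' \<le> enat_power \<beta> s"
  by (auto simp: enat_power_def power_decreasing split: enat.splits)

lemma enat_power_eSuc: "enat_power \<beta> (eSuc s) = \<beta> * enat_power \<beta> s"
  by (auto simp: enat_power_def eSuc_enat split: enat.splits)

lemma enat_power_mono: "0 < \<beta> \<Longrightarrow> \<beta> \<le> \<beta>' \<Longrightarrow> enat_power \<beta> s \<le> enat_power \<beta>' s"
  by (auto simp: enat_power_def power_mono split: enat.splits)

lemma wgm_image_sets:
  assumes "invertibility_domain m F \<omega>" "\<omega> \<in> sets m" "A \<in> sets m" "A \<subseteq> \<omega>"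
  shows "F ` A \<in> sets m"
proof -
  have inj: "inj_on F \<omega>" and F\<omega>: "F ` \<omega> \<in> sets m"
    and inv: "the_inv_into \<omega> F \<in> restrict_space m (F ` \<omega>) \<rightarrow>\<^sub>M restrict_space m \<omega>"
    using assms(1) by (auto simp: invertibility_domain_def)
  have "A \<in> sets (restrict_space m \<omega>)" using assms by (auto simp: sets_restrict_space)
  then have "the_inv_into \<omega> F -` A \<inter> space (restrict_space m (F ` \<omega>)) \<in> sets (restrict_space m (F ` \<omega>))"
    by (rule measurable_sets[OF inv])
  also have "the_inv_into \<omega> F -` A \<inter> space (restrict_space m (F ` \<omega>)) = F ` A"
    using sets.sets_into_space[OF F\<omega>] assms(4) inj
    by (auto simp: space_restrict_space the_inv_into_f_f subset_iff)
  finally show ?thesis using F\<omega> by (auto simp: sets_restrict_space)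
qed

text \<open>
  Collect the points outside all cells and, for each pair of cells, the null set on which the image of the first fails to
  contain or to avoid the second one. The smallest set containing these points and closed under forward images
  is still null, because \<open>F\<close> maps null subsets of cells to null sets, and its complement \<open>G\<close> has the required
  property: preimages in cells of points of \<open>G\<close> lie in \<open>G\<close>.
\<close>

lemma exact_markov_part:
  assumes wgm: "wgm_map m F P" and jac: "is_jacobian m F P J"
  shows "\<exists>G\<in>sets m. space m - G \<in> null_sets m \<and> G \<subseteq> \<Union>P \<and>
     (\<forall>\<omega>\<in>P. \<forall>\<omega>'\<in>P. \<omega>' \<inter> G \<subseteq> F ` (\<omega> \<inter> G) \<or> (\<omega>' \<inter> G) \<inter> F ` (\<omega> \<inter> G) = {})"
proof -
  have P: "countable P" "\<And>\<omega>. \<omega> \<in> P \<Longrightarrow> \<omega> \<in> sets m" "disjoint P" "space m - \<Union>P \<in> null_sets m"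
    using wgm by (auto simp: wgm_map_def mod0_partition_def)
  have inv: "invertibility_domain m F \<omega>" if "\<omega> \<in> P" for \<omega> using wgm that by (auto simp: wgm_map_def)
  have mk: "\<exists>Q\<subseteq>P. (F ` \<omega> - \<Union>Q) \<union> (\<Union>Q - F ` \<omega>) \<in> null_sets m" if "\<omega> \<in> P" for \<omega>
    using wgm that unfolding wgm_map_def markov_property_def by blast
  have img: "F ` A \<in> sets m" if "\<omega> \<in> P" "A \<in> sets m" "A \<subseteq> \<omega>" for A \<omega>
    using wgm_image_sets[OF inv] that P by blast
  have img_null: "F ` (A \<inter> \<omega>) \<in> null_sets m" if "\<omega> \<in> P" "A \<in> null_sets m" for A \<omega>
  proof -
    have A: "A \<inter> \<omega> \<in> null_sets m" using that P(2) by (intro null_set_Int2) auto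
    have "emeasure m (F ` (A \<inter> \<omega>)) = (\<integral>\<^sup>+x\<in>A \<inter> \<omega>. ennreal (J x) \<partial>m)"
      using jac that(1) A unfolding is_jacobian_def by blast
    also have "\<dots> = 0" using A by (rule nn_integral_null_set)
    finally show ?thesis using img[OF that(1), of "A \<inter> \<omega>"] A by auto
  qed
  define bad where "bad = (\<lambda>\<omega> \<omega>'. if \<omega>' \<inter> F ` \<omega> \<in> null_sets m then \<omega>' \<inter> F ` \<omega> else \<omega>' - F ` \<omega>)"
  have bad: "bad \<omega> \<omega>' \<in> null_sets m" if \<omega>: "\<omega> \<in> P" "\<omega>' \<in> P" for \<omega> \<omega>'
  proof (cases "\<omega>' \<inter> F ` \<omega> \<in> null_sets m")
    case False
    obtain Q where Q: "Q \<subseteq> P" "(F ` \<omega> - \<Union>Q) \<union> (\<Union>Q - F ` \<omega>) \<in> null_sets m" using mk[OF \<omega>(1)] by blast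
    have F\<omega>: "F ` \<omega> \<in> sets m" using img[OF \<omega>(1) P(2)[OF \<omega>(1)]] by simp
    have "\<omega>' \<in> Q"
    proof (rule ccontr)
      assume "\<omega>' \<notin> Q"
      then have "\<omega>' \<inter> \<omega>'' = {}" if "\<omega>'' \<in> Q" for \<omega>''
        using disjointD[OF P(3), of \<omega>' \<omega>''] that Q(1) \<omega>(2) by auto
      then have sub: "\<omega>' \<inter> F ` \<omega> \<subseteq> (F ` \<omega> - \<Union>Q) \<union> (\<Union>Q - F ` \<omega>)" by auto
      have "\<omega>' \<inter> F ` \<omega> \<in> null_sets m"
        by (rule null_sets_subset[OF Q(2) _ sub]) (use P(2)[OF \<omega>(2)] F\<omega> in auto)
      then show False using False by simp
    qed
    then have sub: "\<omega>' - F ` \<omega> \<subseteq> (F ` \<omega> - \<Union>Q) \<union> (\<Union>Q - F ` \<omega>)" by auto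
    have "\<omega>' - F ` \<omega> \<in> null_sets m"
      by (rule null_sets_subset[OF Q(2) _ sub]) (use P(2)[OF \<omega>(2)] F\<omega> in auto)
    then show ?thesis using False by (simp add: bad_def)
  qed (simp add: bad_def)
  define Z where "Z = rec_nat ((space m - \<Union>P) \<union> (\<Union>\<omega>\<in>P. \<Union>\<omega>'\<in>P. bad \<omega> \<omega>')) (\<lambda>n A. \<Union>\<omega>\<in>P. F ` (A \<inter> \<omega>))"
  have Z_0: "Z 0 = (space m - \<Union>P) \<union> (\<Union>\<omega>\<in>P. \<Union>\<omega>'\<in>P. bad \<omega> \<omega>')"
    and Z_Suc: "Z (Suc n) = (\<Union>\<omega>\<in>P. F ` (Z n \<inter> \<omega>))" for n by (simp_all add: Z_def)
  have Z: "Z n \<in> null_sets m" for n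
  proof (induction n)
    case 0
    show ?case unfolding Z_0
      by (intro null_sets.Un P null_sets_UN' bad) auto
  next
    case (Suc n)
    then show ?case unfolding Z_Suc by (intro null_sets_UN' P img_null) auto
  qed
  define Z' where "Z' = (\<Union>n. Z n)"
  have Z': "Z' \<in> null_sets m" unfolding Z'_def by (intro null_sets_UN Z)
  have Z'_F: "F x \<in> Z'" if x: "x \<in> \<omega>" "\<omega> \<in> P" "x \<in> Z'" for x \<omega>
  proof -
    obtain n where "x \<in> Z n" using x(3) by (auto simp: Z'_def)
    then have "F x \<in> Z (Suc n)" unfolding Z_Suc using x by blast
    then show ?thesis by (auto simp: Z'_def)
  qed
  define G where "G = space m - Z'"
  have Z0_sub: "Z 0 \<subseteq> Z'" by (auto simp: Z'_def)
  show ?thesis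
  proof (intro bexI[of _ G] conjI ballI)
    show "G \<in> sets m" using Z' by (auto simp: G_def)
    have "space m - G = Z'" using Z' sets.sets_into_space by (fastforce simp: G_def)
    then show "space m - G \<in> null_sets m" using Z' by simp
    show "G \<subseteq> \<Union>P" using Z0_sub by (auto simp: G_def Z_0)
    fix \<omega> \<omega>' assume \<omega>: "\<omega> \<in> P" "\<omega>' \<in> P"
    have b: "bad \<omega> \<omega>' \<subseteq> Z'" using Z0_sub \<omega> unfolding Z_0 by blast
    show "\<omega>' \<inter> G \<subseteq> F ` (\<omega> \<inter> G) \<or> (\<omega>' \<inter> G) \<inter> F ` (\<omega> \<inter> G) = {}"
    proof (cases "\<omega>' \<inter> F ` \<omega> \<in> null_sets m")
      case True
      then show ?thesis using b by (auto simp: bad_def G_def)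
    next
      case False
      then have sub: "\<omega>' \<inter> G \<subseteq> F ` \<omega>" using b by (auto simp: bad_def G_def)
      have "\<omega>' \<inter> G \<subseteq> F ` (\<omega> \<inter> G)"
      proof
        fix y assume y: "y \<in> \<omega>' \<inter> G"
        then obtain x where x: "x \<in> \<omega>" "y = F x" using sub by blast
        have "x \<notin> Z'" using Z'_F[OF x(1) \<omega>(1)] y x(2) by (auto simp: G_def)
        moreover have "x \<in> space m" using sets.sets_into_space[OF P(2)[OF \<omega>(1)]] x by auto
        ultimately show "y \<in> F ` (\<omega> \<inter> G)" using x by (auto simp: G_def)
      qed
      then show ?thesis ..
    qed
  qed
qed

lemma tower_set_sets:
  fixes m :: "'a measure"
  assumes R [measurable]: "R \<in> m \<rightarrow>\<^sub>M count_space UNIV"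
  shows "tower_set (space m) R \<in> sets (m \<Otimes>\<^sub>M count_space UNIV)"
proof -
  have "tower_set (space m) R = {p \<in> space (m \<Otimes>\<^sub>M count_space UNIV). snd p < R (fst p)}"
    by (auto simp: tower_set_def space_pair_measure)
  then show ?thesis using measurable_level_less[OF R, of 0] by simp
qed

lemma nn_integral_tower:
  fixes m :: "'a measure"
  assumes fin: "finite_measure m" and R [measurable]: "R \<in> m \<rightarrow>\<^sub>M count_space UNIV"
    and g: "g \<in> borel_measurable (tower_measure m R)"
  shows "(\<integral>\<^sup>+z. g z \<partial>tower_measure m R) = (\<integral>\<^sup>+x. (\<Sum>l<R x. g (x, l)) \<partial>m)"
    and "(\<lambda>x. if l < R x then g (x, l) else (0::ennreal)) \<in> borel_measurable m"
proof -
  interpret finite_measure m by fact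
  interpret N: sigma_finite_measure "count_space (UNIV :: nat set)"
    by (rule sigma_finite_measure_count_space)
  let ?D = "tower_set (space m) R" and ?N = "m \<Otimes>\<^sub>M count_space (UNIV :: nat set)"
  have D: "?D \<inter> space ?N \<in> sets ?N"
    using tower_set_sets[OF R] by auto
  define h where "h = (\<lambda>z. g z * indicator ?D z)"
  have h [measurable]: "h \<in> borel_measurable ?N"
    using g D unfolding tower_measure_def h_def by (subst (asm) borel_measurable_restrict_space_iff_ennreal) auto
  have "(\<integral>\<^sup>+z. g z \<partial>tower_measure m R) = (\<integral>\<^sup>+z. h z \<partial>?N)"
    unfolding tower_measure_def h_def by (rule nn_integral_restrict_space[OF D])
  also have "\<dots> = (\<integral>\<^sup>+x. \<integral>\<^sup>+l. h (x, l) \<partial>count_space UNIV \<partial>m)"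
    by (rule N.nn_integral_fst[symmetric]) simp
  also have "\<dots> = (\<integral>\<^sup>+x. (\<Sum>l<R x. g (x, l)) \<partial>m)"
  proof (rule nn_integral_cong)
    fix x assume x: "x \<in> space m"
    have "(\<integral>\<^sup>+l. h (x, l) \<partial>count_space UNIV) = (\<integral>\<^sup>+l. g (x, l) * indicator {..<R x} l \<partial>count_space UNIV)"
      using x by (intro nn_integral_cong) (auto simp: h_def tower_set_def split: split_indicator)
    also have "\<dots> = (\<integral>\<^sup>+l. g (x, l) \<partial>count_space {..<R x})"
      by (rule nn_integral_count_space_indicator[symmetric]) simp
    also have "\<dots> = (\<Sum>l<R x. g (x, l))" by (rule nn_integral_count_space_finite) simp
    finally show "(\<integral>\<^sup>+l. h (x, l) \<partial>count_space UNIV) = (\<Sum>l<R x. g (x, l))" .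
  qed
  finally show "(\<integral>\<^sup>+z. g z \<partial>tower_measure m R) = (\<integral>\<^sup>+x. (\<Sum>l<R x. g (x, l)) \<partial>m)" .
  have "(\<lambda>x. h (x, l)) \<in> borel_measurable m" by measurable
  then show "(\<lambda>x. if l < R x then g (x, l) else 0) \<in> borel_measurable m"
    by (rule measurable_cong[THEN iffD1, rotated]) (auto simp: h_def tower_set_def)
qed

lemma emeasure_tower_level_0:
  fixes m :: "'a measure"
  assumes fin: "finite_measure m" and R [measurable]: "R \<in> m \<rightarrow>\<^sub>M count_space UNIV"
    and pos: "\<And>x. x \<in> space m \<Longrightarrow> 1 \<le> R x" and S: "S \<in> sets m"
  shows "S \<times> {0} \<in> sets (tower_measure m R)" "emeasure (tower_measure m R) (S \<times> {0}) = emeasure m S"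
proof -
  have sub: "S \<subseteq> space m" using sets.sets_into_space[OF S] .
  have D: "tower_set (space m) R \<inter> space (m \<Otimes>\<^sub>M count_space (UNIV :: nat set)) \<in> sets (m \<Otimes>\<^sub>M count_space UNIV)"
    using tower_set_sets[OF R] by auto
  have "S \<times> {0::nat} \<in> sets (m \<Otimes>\<^sub>M count_space UNIV)" using S by auto
  moreover have "S \<times> {0} \<subseteq> tower_set (space m) R" using pos sub by (fastforce simp: tower_set_def)
  ultimately show mem: "S \<times> {0} \<in> sets (tower_measure m R)"
    unfolding tower_measure_def using tower_set_sets[OF R]
    by (auto simp: sets_restrict_space_iff)
  have "emeasure (tower_measure m R) (S \<times> {0}) = (\<integral>\<^sup>+z. indicator (S \<times> {0}) z \<partial>tower_measure m R)"
    using mem by simp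
  also have "\<dots> = (\<integral>\<^sup>+x. (\<Sum>l<R x. indicator (S \<times> {0}) (x, l)) \<partial>m)"
    by (rule nn_integral_tower(1)[OF fin R]) (use mem in measurable)
  also have "\<dots> = (\<integral>\<^sup>+x. indicator S x \<partial>m)"
  proof (rule nn_integral_cong)
    fix x assume "x \<in> space m"
    then have "0 < R x" using pos[of x] by simp
    have "(\<Sum>l<R x. indicator (S \<times> {0}) (x, l)) = (\<Sum>l<R x. if l = 0 then indicator S x else (0::ennreal))"
      by (intro sum.cong) (auto split: split_indicator)
    then show "(\<Sum>l<R x. indicator (S \<times> {0}) (x, l)) = (indicator S x :: ennreal)"
      using \<open>0 < R x\<close> by (simp add: sum.delta)
  qed
  finally show "emeasure (tower_measure m R) (S \<times> {0}) = emeasure m S" using S by simp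
qed

text \<open>
  Mixing makes the \<open>\<nu>\<close>-measure of the points of \<open>S\<close> that visit \<open>S'\<close> at time \<open>t\<close> converge to a positive number, and
  \<open>\<nu>\<close> is absolutely continuous.
\<close>

lemma mixing_hits:
  fixes m :: "'a measure" and \<nu> :: "('a \<times> nat) measure"
  assumes fin: "finite_measure m" and F: "F \<in> m \<rightarrow>\<^sub>M m" and R: "R \<in> m \<rightarrow>\<^sub>M count_space UNIV"
    and pos: "\<And>x. x \<in> space m \<Longrightarrow> 1 \<le> R x"
    and \<nu>: "mixing_measure (tower_map F R) \<nu>" "\<nu> = density (tower_measure m R) (\<lambda>z. ennreal (\<phi> z))"
    and \<phi>: "\<phi> \<in> borel_measurable (tower_measure m R)" and \<nu>_prob: "prob_space \<nu>"
    and S: "S \<in> sets m" "0 < emeasure m S" "\<And>x. x \<in> S \<Longrightarrow> 0 < \<phi> (x, 0)"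
    and S': "S' \<in> sets m" "0 < emeasure m S'" "\<And>x. x \<in> S' \<Longrightarrow> 0 < \<phi> (x, 0)"
  shows "\<exists>n\<^sub>0. \<forall>t\<ge>n\<^sub>0. 0 < measure m {x \<in> S. (tower_map F R ^^ t) (x, 0) \<in> S' \<times> {0}}"
proof -
  let ?\<mu> = "tower_measure m R" and ?T = "tower_map F R"
  interpret finite_measure m by fact
  interpret \<nu>: prob_space \<nu> by fact
  note [measurable] = R
  have sets_\<nu>: "sets \<nu> = sets ?\<mu>" by (simp add: \<nu>(2))
  have null: "emeasure ?\<mu> A = 0" if "emeasure \<nu> A = 0" "A \<in> sets ?\<mu>" "\<And>z. z \<in> A \<Longrightarrow> 0 < \<phi> z" for A
  proof -
    have "(\<integral>\<^sup>+z. ennreal (\<phi> z) * indicator A z \<partial>?\<mu>) = 0"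
      using that \<phi> by (simp add: \<nu>(2) emeasure_density)
    then have "AE z in ?\<mu>. ennreal (\<phi> z) * indicator A z = 0"
      using that(2) \<phi> by (subst (asm) nn_integral_0_iff_AE) auto
    then have "AE z in ?\<mu>. z \<notin> A"
      using that(3) by (auto simp: ennreal_eq_0_iff not_le[symmetric] split: split_indicator_asm elim!: eventually_mono)
    then show ?thesis using that(2) by (subst (asm) AE_iff_measurable[of A]) (auto dest: sets.sets_into_space)
  qed
  have ac: "emeasure \<nu> A = 0" if "emeasure ?\<mu> A = 0" "A \<in> sets ?\<mu>" for A
  proof -
    have "A \<in> null_sets ?\<mu>" using that by auto
    then show ?thesis using \<phi> that by (simp add: \<nu>(2) emeasure_density nn_integral_null_set)
  qed
  have posi: "0 < measure \<nu> (B \<times> {0})" if B: "B \<in> sets m" "0 < emeasure m B" "\<And>x. x \<in> B \<Longrightarrow> 0 < \<phi> (x, 0)" for B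
  proof (rule ccontr)
    assume "\<not> 0 < measure \<nu> (B \<times> {0})"
    then have "emeasure \<nu> (B \<times> {0}) = 0"
      by (simp add: \<nu>.emeasure_eq_measure not_less measure_le_0_iff)
    then have "emeasure ?\<mu> (B \<times> {0}) = 0"
      using emeasure_tower_level_0(1)[OF fin R pos B(1)] B(3) by (intro null) auto
    then show False using emeasure_tower_level_0(2)[OF fin R pos B(1)] B(2) by simp
  qed
  have "(\<lambda>n. measure \<nu> ((S \<times> {0}) \<inter> (?T ^^ n) -` (S' \<times> {0}))) \<longlonglongrightarrow> measure \<nu> (S \<times> {0}) * measure \<nu> (S' \<times> {0})"
    using \<nu>(1) emeasure_tower_level_0(1)[OF fin R pos] S(1) S'(1) unfolding mixing_measure_def sets_\<nu> by blast
  moreover have "0 < measure \<nu> (S \<times> {0}) * measure \<nu> (S' \<times> {0})" using posi[OF S] posi[OF S'] by simp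
  ultimately have "eventually (\<lambda>n. 0 < measure \<nu> ((S \<times> {0}) \<inter> (?T ^^ n) -` (S' \<times> {0}))) sequentially"
    by (rule order_tendstoD(1))
  then obtain n0 where n0: "\<And>n. n \<ge> n0 \<Longrightarrow> 0 < measure \<nu> ((S \<times> {0}) \<inter> (?T ^^ n) -` (S' \<times> {0}))"
    by (auto simp: eventually_sequentially)
  have "0 < measure m {x \<in> S. (?T ^^ n) (x, 0) \<in> S' \<times> {0}}" if n: "n \<ge> n0" for n
  proof -
    define A where "A = {x \<in> S. (?T ^^ n) (x, 0) \<in> S' \<times> {0}}"
    have eq: "(S \<times> {0}) \<inter> (?T ^^ n) -` (S' \<times> {0}) = A \<times> {0}" by (auto simp: A_def)
    have T: "?T ^^ n \<in> ?\<mu> \<rightarrow>\<^sub>M ?\<mu>"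
      by (intro measurable_compose_n measurable_tower_map F R pos)
    have vi: "(?T ^^ n) -` (S' \<times> {0}) \<inter> space ?\<mu> \<in> sets ?\<mu>"
      by (rule measurable_sets[OF T emeasure_tower_level_0(1)[OF fin R pos S'(1)]])
    have "(S \<times> {0}) \<inter> ((?T ^^ n) -` (S' \<times> {0}) \<inter> space ?\<mu>) \<in> sets ?\<mu>"
      by (rule sets.Int[OF emeasure_tower_level_0(1)[OF fin R pos S(1)] vi])
    also have "(S \<times> {0}) \<inter> ((?T ^^ n) -` (S' \<times> {0}) \<inter> space ?\<mu>) = A \<times> {0}"
      using eq sets.sets_into_space[OF emeasure_tower_level_0(1)[OF fin R pos S(1)]] by blast
    finally have A0: "A \<times> {0} \<in> sets ?\<mu>" .
    have A: "A \<in> sets m"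
    proof -
      have "(\<lambda>x. if 0 < R x then indicator (A \<times> {0}) (x, 0::nat) else (0::ennreal)) \<in> borel_measurable m"
        by (rule nn_integral_tower(2)[OF fin R borel_measurable_indicator[OF A0], of 0])
      then have "(indicator A :: 'a \<Rightarrow> ennreal) \<in> borel_measurable m"
        by (rule measurable_cong[THEN iffD1, rotated]) (use pos in \<open>force split: split_indicator\<close>)
      then have "A \<inter> space m \<in> sets m" by (simp add: borel_measurable_indicator_iff)
      moreover have "A \<inter> space m = A" using sets.sets_into_space[OF S(1)] by (auto simp: A_def)
      ultimately show ?thesis by simp
    qed
    have "0 < measure \<nu> (A \<times> {0})" using n0[OF n] unfolding eq .
    then have "emeasure ?\<mu> (A \<times> {0}) \<noteq> 0" using ac[OF _ A0] by (auto simp: measure_def)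
    then have "emeasure m A \<noteq> 0" using emeasure_tower_level_0(2)[OF fin R pos A] by simp
    then show ?thesis unfolding A_def[symmetric] by (simp add: emeasure_eq_measure less_le)
  qed
  then show ?thesis by blast
qed

section \<open>Weak Gibbs Markov towers\<close>

text \<open>
  Intersecting all cells with the set \<open>G\<close> of \<open>exact_markov_part\<close> changes no measure and makes the Markov property exact.
\<close>

lemma markov_tower_instance:
  fixes M m :: "'a measure" and \<Delta>\<^sub>0 :: "'a set" and f F :: "'a \<Rightarrow> 'a" and P :: "'a set set"
    and R :: "'a \<Rightarrow> nat" and J :: "'a \<Rightarrow> real" and \<beta>\<^sub>0 b :: real
    and \<nu> :: "('a \<times> nat) measure"
  assumes induced: "induced_map M f \<Delta>\<^sub>0 F P R"
    and m_eq: "m = restrict_space M \<Delta>\<^sub>0"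
    and wgm: "wgm_map m F P"
    and R_int: "integrable m (\<lambda>x. real (R x))"
    and gibbs: "is_jacobian m F P J" "gibbs_property F P J \<beta>\<^sub>0"
    and \<nu>: "prob_space \<nu>" "mixing_measure (tower_map F R) \<nu>"
      "has_density_in \<nu> (tower_measure m R) (F_plus_space \<Delta>\<^sub>0 F P R \<beta>\<^sub>0)"
    and b: "0 < \<beta>\<^sub>0" "\<beta>\<^sub>0 \<le> b" "b < 1"
  shows "\<exists>G C \<delta>\<^sub>0 star. markov_tower m F ((\<lambda>\<omega>. \<omega> \<inter> G) ` P) R J (\<lambda>x y. enat_power b (sep_time F P x y)) b C \<delta>\<^sub>0 star"
proof -
  have b01: "0 < b" "b < 1" using b by auto
  have space_m: "space m = \<Delta>\<^sub>0"
  proof -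
    have "\<Delta>\<^sub>0 \<in> sets M" using induced by (simp add: induced_map_def)
    then show ?thesis using sets.sets_into_space by (auto simp: m_eq space_restrict_space)
  qed
  have P: "countable P" "\<And>\<omega>. \<omega> \<in> P \<Longrightarrow> \<omega> \<in> sets m" "disjoint P" "space m - \<Union>P \<in> null_sets m"
    using wgm by (auto simp: wgm_map_def mod0_partition_def)
  have inv: "invertibility_domain m F \<omega>" if "\<omega> \<in> P" for \<omega> using wgm that by (auto simp: wgm_map_def)
  have fin: "finite_measure m" using wgm by (auto simp: wgm_map_def intro!: finite_measureI)
  interpret finite_measure m by (rule fin)
  have F_meas: "F \<in> m \<rightarrow>\<^sub>M m" using wgm by (simp add: wgm_map_def)
  have R_meas: "R \<in> m \<rightarrow>\<^sub>M count_space UNIV" using induced by (simp add: induced_map_def m_eq)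
  have R_pos: "1 \<le> R x" if "x \<in> space m" for x
    using induced that unfolding space_m induced_map_def by blast
  have jac: "emeasure m (F ` A) = (\<integral>\<^sup>+x\<in>A. ennreal (J x) \<partial>m)" if "\<omega> \<in> P" "A \<in> sets m" "A \<subseteq> \<omega>" for A \<omega>
    using gibbs(1) that unfolding is_jacobian_def by blast
  have J_pos: "0 < J x" if "x \<in> space m" for x using gibbs(1) that by (simp add: is_jacobian_def)
  have img: "F ` A \<in> sets m" if "\<omega> \<in> P" "A \<in> sets m" "A \<subseteq> \<omega>" for A \<omega>
    using wgm_image_sets[OF inv[OF that(1)] P(2)[OF that(1)] that(2,3)] .
  obtain G where G0: "G \<in> sets m" "space m - G \<in> null_sets m \<and> G \<subseteq> \<Union>P \<and>
     (\<forall>\<omega>\<in>P. \<forall>\<omega>'\<in>P. \<omega>' \<inter> G \<subseteq> F ` (\<omega> \<inter> G) \<or> (\<omega>' \<inter> G) \<inter> F ` (\<omega> \<inter> G) = {})"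
    using exact_markov_part[OF wgm gibbs(1)] by (rule bexE)
  note G = G0(1) G0(2)[THEN conjunct1] G0(2)[THEN conjunct2, THEN conjunct1]
  note G_markov = G0(2)[THEN conjunct2, THEN conjunct2, THEN bspec, THEN bspec]
  obtain C where C: "0 < C" and gb: "\<And>\<omega> x y. \<omega> \<in> P \<Longrightarrow> x \<in> \<omega> \<Longrightarrow> y \<in> \<omega> \<Longrightarrow>
      ln (J x / J y) \<le> C * enat_power \<beta>\<^sub>0 (sep_time F P (F x) (F y))"
    using gibbs(2) unfolding gibbs_property_def by blast
  obtain \<delta>\<^sub>0 where \<delta>\<^sub>0: "0 < \<delta>\<^sub>0" and long: "\<And>\<omega>. \<omega> \<in> P \<Longrightarrow> \<delta>\<^sub>0 \<le> measure m (F ` \<omega>)"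
    using wgm unfolding wgm_map_def long_branches_def by blast
  have null_part: "\<omega> - G \<in> null_sets m" if "\<omega> \<in> P" for \<omega>
    by (rule null_sets_subset[OF G(2)]) (use that P(2) G(1) sets.sets_into_space in auto)
  have emeasure_part: "emeasure m (\<omega> \<inter> G) = emeasure m \<omega>" if "\<omega> \<in> P" for \<omega>
    using emeasure_Un_null_set[OF _ null_part[OF that], of "\<omega> \<inter> G"] P(2)[OF that] G(1)
    by (simp add: Un_Diff_Int Int_Diff_Un)
  have long_part: "measure m (F ` (\<omega> \<inter> G)) = measure m (F ` \<omega>)" if \<omega>: "\<omega> \<in> P" for \<omega>
  proof -
    have "emeasure m (F ` (\<omega> - G)) = (\<integral>\<^sup>+x\<in>\<omega> - G. ennreal (J x) \<partial>m)"
      using null_part[OF \<omega>] by (intro jac[OF \<omega>]) auto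
    also have "\<dots> = 0" by (rule nn_integral_null_set[OF null_part[OF \<omega>]])
    finally have "F ` (\<omega> - G) \<in> null_sets m"
      using img[OF \<omega>, of "\<omega> - G"] null_part[OF \<omega>] by auto
    moreover have "F ` (\<omega> \<inter> G) \<in> sets m" using P(2)[OF \<omega>] G(1) by (intro img[OF \<omega>]) auto
    ultimately have "measure m (F ` (\<omega> \<inter> G) \<union> F ` (\<omega> - G)) = measure m (F ` (\<omega> \<inter> G))"
      by (intro measure_Un_null_set)
    then show ?thesis by (simp add: image_Un[symmetric] Int_Diff_Un)
  qed
  have cell_pos: "0 < emeasure m \<omega>" if \<omega>: "\<omega> \<in> P" for \<omega>
  proof (rule ccontr)
    assume "\<not> 0 < emeasure m \<omega>"
    then have "\<omega> \<in> null_sets m" using P(2)[OF \<omega>] by auto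
    then have "emeasure m (F ` \<omega>) = 0"
      using jac[OF \<omega> P(2)[OF \<omega>] order_refl] by (simp add: nn_integral_null_set)
    then show False using long[OF \<omega>] \<delta>\<^sub>0 by (simp add: measure_def)
  qed
  have "P \<noteq> {}"
  proof
    assume "P = {}"
    then have "emeasure m (space m) = 0" using P(4) by auto
    then show False using wgm by (simp add: wgm_map_def)
  qed
  then obtain \<omega>s where \<omega>s: "\<omega>s \<in> P" by auto
  obtain \<phi> where \<phi>: "\<phi> \<in> F_plus_space \<Delta>\<^sub>0 F P R \<beta>\<^sub>0" "\<phi> \<in> borel_measurable (tower_measure m R)"
    and \<nu>_eq: "\<nu> = density (tower_measure m R) (\<lambda>z. ennreal (\<phi> z))"
    using \<nu>(3) unfolding has_density_in_def by blast
  have \<phi>_pos: "0 < \<phi> (x, 0)" if "\<omega> \<in> P" "x \<in> \<omega>" for x \<omega>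
  proof -
    have "x \<in> space m" using sets.sets_into_space[OF P(2)[OF that(1)]] that(2) by auto
    then have mem: "(x, 0) \<in> tower_set \<Delta>\<^sub>0 R \<inter> (\<omega> \<times> {0})"
      using R_pos[of x] that by (auto simp: tower_set_def space_m)
    have cell: "tower_set \<Delta>\<^sub>0 R \<inter> (\<omega> \<times> {0}) \<in> tower_partition \<Delta>\<^sub>0 P R"
      using that unfolding tower_partition_def by blast
    obtain C where "\<forall>\<omega>\<in>tower_partition \<Delta>\<^sub>0 P R. \<forall>x\<in>\<omega>. \<forall>y\<in>\<omega>.
        0 < \<phi> x \<and> \<bar>\<phi> x / \<phi> y - 1\<bar> \<le> C * enat_power \<beta>\<^sub>0 (tower_sep_time F P x y)"
      using \<phi>(1) unfolding F_plus_space_def by auto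
    from this[THEN bspec, OF cell, THEN bspec, OF mem, THEN bspec, OF mem] show ?thesis ..
  qed
  have "markov_tower m F ((\<lambda>\<omega>. \<omega> \<inter> G) ` P) R J (\<lambda>x y. enat_power b (sep_time F P x y)) b C \<delta>\<^sub>0 (\<omega>s \<inter> G)"
  proof unfold_locales
    show "disjoint ((\<lambda>\<omega>. \<omega> \<inter> G) ` P)"
      using P(3) by (fastforce simp: disjoint_def)
    have "space m - \<Union>((\<lambda>\<omega>. \<omega> \<inter> G) ` P) = space m - G" using G(3) by auto
    then show "space m - \<Union>((\<lambda>\<omega>. \<omega> \<inter> G) ` P) \<in> null_sets m" using G(2) by simp
    show "integrable m (\<lambda>x. real (R x))" by (rule R_int)
    show "J \<in> borel_measurable m" using gibbs(1) by (simp add: is_jacobian_def)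
    show "\<omega>s \<inter> G \<in> (\<lambda>\<omega>. \<omega> \<inter> G) ` P" using \<omega>s by auto
    fix x y
    show "enat_power b (sep_time F P x y) = enat_power b (sep_time F P y x)" by (simp add: sep_time_sym)
    show "0 \<le> enat_power b (sep_time F P x y)" "enat_power b (sep_time F P x y) \<le> 1"
      using enat_power_bounds b01 by auto
    fix \<sigma> assume "\<sigma> \<in> (\<lambda>\<omega>. \<omega> \<inter> G) ` P"
    then obtain \<omega> where \<omega>: "\<omega> \<in> P" "\<sigma> = \<omega> \<inter> G" by auto
    show \<sigma>_sets: "\<sigma> \<in> sets m" using \<omega> P(2) G(1) by auto
    show "inj_on F \<sigma>" using inv[OF \<omega>(1)] \<omega>(2) by (auto simp: invertibility_domain_def intro: inj_on_subset)
    show "\<delta>\<^sub>0 \<le> measure m (F ` \<sigma>)" using long[OF \<omega>(1)] long_part[OF \<omega>(1)] \<omega>(2) by simp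
    show "F ` A \<in> sets m" if "A \<in> sets m" "A \<subseteq> \<sigma>" for A using img[OF \<omega>(1) that(1)] that(2) \<omega>(2) by auto
    show "emeasure m (F ` A) = (\<integral>\<^sup>+x\<in>A. ennreal (J x) \<partial>m)" if "A \<in> sets m" "A \<subseteq> \<sigma>" for A
      using jac[OF \<omega>(1) that(1)] that(2) \<omega>(2) by auto
    show "\<sigma>' \<subseteq> F ` \<sigma> \<or> \<sigma>' \<inter> F ` \<sigma> = {}" if "\<sigma>' \<in> (\<lambda>\<omega>. \<omega> \<inter> G) ` P" for \<sigma>'
      using that G_markov[OF \<omega>(1)] \<omega>(2) by auto
    show "\<exists>n\<^sub>0. \<forall>t\<ge>n\<^sub>0. 0 < measure m {x \<in> \<sigma>. (tower_map F R ^^ t) (x, 0) \<in> (\<omega>s \<inter> G) \<times> {0}}"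
      using \<omega> \<omega>s P(2) G(1) cell_pos \<phi>_pos
      by (intro mixing_hits[OF fin F_meas R_meas R_pos \<nu>(2) \<nu>_eq \<phi>(2) \<nu>(1)]) (auto simp: emeasure_part)
    assume x: "x \<in> \<sigma>" and y: "y \<in> \<sigma>"
    show "R x = R y"
    proof -
      have "\<forall>\<omega>\<in>P. \<exists>k. \<forall>x\<in>\<omega>. R x = k \<and> F x = (f ^^ k) x" using induced unfolding induced_map_def by blast
      then show ?thesis using x y \<omega> by fastforce
    qed
    have "enat_power b (sep_time F P x y) \<le> enat_power b (eSuc (sep_time F P (F x) (F y)))"
      using x y \<omega> by (intro enat_power_antimono b01 sep_time_Suc_le[of \<omega>]) auto
    then show "enat_power b (sep_time F P x y) \<le> b * enat_power b (sep_time F P (F x) (F y))"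
      by (simp add: enat_power_eSuc)
    have Jp: "0 < J x" "0 < J y" using J_pos sets.sets_into_space[OF \<sigma>_sets] x y by auto
    have "ln (J x / J y) \<le> C * enat_power \<beta>\<^sub>0 (sep_time F P (F x) (F y))"
      using gb[OF \<omega>(1)] x y \<omega>(2) by auto
    also have "\<dots> \<le> C * enat_power b (sep_time F P (F x) (F y))"
      using C b by (intro mult_left_mono enat_power_mono) auto
    finally have "exp (ln (J x / J y)) \<le> exp (C * enat_power b (sep_time F P (F x) (F y)))"
      by (rule exp_le_cancel_iff[THEN iffD2])
    then have "J x / J y \<le> exp (C * enat_power b (sep_time F P (F x) (F y)))"
      using Jp by simp
    then show "J x \<le> exp (C * enat_power b (sep_time F P (F x) (F y))) * J y"
      using Jp by (simp add: divide_le_eq)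
  qed (use P(1) b01 C \<delta>\<^sub>0 F_meas R_meas R_pos J_pos in auto)
  then show ?thesis by blast
qed

context blocked_tower begin

definition density_fun :: "('a \<times> nat \<Rightarrow> real) \<Rightarrow> nat \<Rightarrow> 'a \<Rightarrow> ennreal" where
  "density_fun \<phi> l x = (if (x, l) \<in> tower_set (space m) R then ennreal (\<phi> (x, l)) else 0)"

text \<open>
  Adding the same constant to two densities does not change their difference but flattens their logarithms. For
  densities that are positive on cells, the truncation at \<open>0\<close> inherent in \<open>ennreal\<close> affects only points outside the cells.
\<close>

definition shifted :: "real \<Rightarrow> ('a \<times> nat \<Rightarrow> real) \<Rightarrow> nat \<Rightarrow> 'a \<Rightarrow> ennreal" where
  "shifted a \<phi> l x = ennreal (1 / a) * density_fun \<phi> l x + 1"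

lemma tmeas_tower:
  assumes "g \<in> borel_measurable (tower_measure m R)"
  shows "tmeas (\<lambda>l x. if (x, l) \<in> tower_set (space m) R then g (x, l) else 0)"
  unfolding tmeas_def
proof
  fix l
  show "(\<lambda>x. if (x, l) \<in> tower_set (space m) R then g (x, l) else 0) \<in> borel_measurable m"
    by (rule measurable_cong[THEN iffD1, OF _ nn_integral_tower(2)[OF finite_measure_axioms R_measurable assms, of l]])
      (simp add: tower_set_def)
qed

lemma integ_tower:
  assumes "g \<in> borel_measurable (tower_measure m R)"
  shows "(\<integral>\<^sup>+z. g z \<partial>tower_measure m R) = integ (\<lambda>l x. g (x, l))"
  unfolding integ_def by (rule nn_integral_tower(1)[OF finite_measure_axioms R_measurable assms])

lemma tmeas_density_fun:
  assumes [measurable]: "\<phi> \<in> borel_measurable (tower_measure m R)"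
  shows "tmeas (density_fun \<phi>)"
  unfolding density_fun_def by (rule tmeas_tower) measurable

text \<open>
  From \<open>w(x) \<le> w(y) + (C / a) d(x, y)\<close> for \<open>w = max 0 \<phi> / a\<close> one gets
  \<open>1 + w(x) \<le> (1 + L' d(x, y)) (1 + w(y))\<close> as soon as \<open>C \<le> a L'\<close>.
\<close>

lemma standard_shifted:
  assumes \<phi>: "\<phi> \<in> borel_measurable (tower_measure m R)"
    and lip: "\<And>\<omega> x y l. \<omega> \<in> P \<Longrightarrow> x \<in> \<omega> \<Longrightarrow> y \<in> \<omega> \<Longrightarrow> l < R x \<Longrightarrow> \<phi> (x, l) - \<phi> (y, l) \<le> C * d x y"
    and a: "0 < a" "C \<le> a * L'" "0 \<le> C"
  shows "standard (shifted a \<phi>)"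
  unfolding standard_def
proof (intro conjI allI)
  note [measurable] = tmeasD[OF tmeas_density_fun[OF \<phi>]]
  show "tmeas (shifted a \<phi>)" unfolding tmeas_def shifted_def by measurable
  fix l show "regular L' l (shifted a \<phi> l)"
    unfolding regular_def
  proof (intro ballI impI)
    fix \<omega> x y assume \<omega>: "\<omega> \<in> P" and x: "x \<in> \<omega>" "y \<in> \<omega>" and l: "l < R x"
    have mem: "(x, l) \<in> tower_set (space m) R" "(y, l) \<in> tower_set (space m) R"
      using x l R_const[OF \<omega> x] P_space[OF \<omega>] by (auto simp: tower_set_def)
    define w where "w = (\<lambda>z. max 0 (\<phi> z) / a)"
    have sh: "shifted a \<phi> l z = ennreal (w (z, l) + 1)" if "(z, l) \<in> tower_set (space m) R" for z
      using a that by (simp add: shifted_def density_fun_def w_def ennreal_plus ennreal_mult'[symmetric] max_def ennreal_neg divide_nonpos_pos)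
    have w0: "0 \<le> w z" for z using a by (simp add: w_def)
    have "max 0 (\<phi> (x, l)) - max 0 (\<phi> (y, l)) \<le> C * d x y"
      using lip[OF \<omega> x l] mult_nonneg_nonneg[OF a(3) d_nonneg[of x y]] by (auto simp: max_def not_le)
    also have "\<dots> \<le> a * L' * d x y" using a(2) d_nonneg by (intro mult_right_mono) auto
    finally have "(max 0 (\<phi> (x, l)) - max 0 (\<phi> (y, l))) / a \<le> L' * d x y"
      using a(1) by (simp add: divide_le_eq mult_ac)
    then have "w (x, l) + 1 \<le> w (y, l) + 1 + L' * d x y" by (simp add: w_def diff_divide_distrib)
    also have "\<dots> \<le> (1 + L' * d x y) * (w (y, l) + 1)"
      using w0[of "(y, l)"] d_nonneg[of x y] L by (simp add: algebra_simps)
    also have "\<dots> \<le> exp (L' * d x y) * (w (y, l) + 1)"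
      using w0[of "(y, l)"] exp_ge_add_one_self[of "L' * d x y"] by (intro mult_right_mono) auto
    finally show "shifted a \<phi> l x \<le> ennreal (exp (L' * d x y)) * shifted a \<phi> l y"
      unfolding sh[OF mem(1)] sh[OF mem(2)] using w0
      by (subst ennreal_mult[symmetric]) (auto intro!: ennreal_leI simp del: ennreal_plus)
  qed
qed

lemma bounded_shifted:
  assumes "\<And>z. z \<in> tower_set (space m) R \<Longrightarrow> \<phi> z \<le> b" and a: "0 < a" and b: "0 \<le> b"
  shows "bounded (b / a + 1) (shifted a \<phi>)"
  unfolding bounded_def
proof (intro conjI allI)
  show "0 \<le> b / a + 1" using a b by simp
  fix l x
  have "density_fun \<phi> l x \<le> ennreal b" using assms(1) by (auto simp: density_fun_def ennreal_leI)
  then have "shifted a \<phi> l x \<le> ennreal (1 / a) * ennreal b + 1"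
    unfolding shifted_def by (intro add_right_mono mult_left_mono) auto
  also have "\<dots> = ennreal (b / a + 1)"
    using a b by (simp add: ennreal_plus ennreal_mult'[symmetric])
  finally show "shifted a \<phi> l x \<le> ennreal (b / a + 1)" .
qed

lemma integ_shifted:
  assumes \<phi>: "\<phi> \<in> borel_measurable (tower_measure m R)" and v: "tmeas v"
  shows "integ (\<lambda>l x. v l x * shifted a \<phi> l x) = ennreal (1 / a) * integ (\<lambda>l x. v l x * density_fun \<phi> l x) + integ v"
proof -
  have "integ (\<lambda>l x. v l x * shifted a \<phi> l x) = integ (\<lambda>l x. ennreal (1 / a) * (v l x * density_fun \<phi> l x) + v l x)"
    by (simp add: shifted_def distrib_left mult_ac)
  also have "\<dots> = integ (\<lambda>l x. ennreal (1 / a) * (v l x * density_fun \<phi> l x)) + integ v"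
  proof (rule integ_add[OF _ v])
    show "tmeas (\<lambda>l x. ennreal (1 / a) * (v l x * density_fun \<phi> l x))"
      using tmeas_const[of "ennreal (1 / a)"] by (rule tmeas_mult[OF _ tmeas_mult[OF v tmeas_density_fun[OF \<phi>]]])
  qed
  also have "integ (\<lambda>l x. ennreal (1 / a) * (v l x * density_fun \<phi> l x)) = ennreal (1 / a) * integ (\<lambda>l x. v l x * density_fun \<phi> l x)"
    by (rule integ_cmult[OF tmeas_mult[OF v tmeas_density_fun[OF \<phi>]]])
  finally show ?thesis .
qed

lemma integ_density_fun:
  assumes \<phi> [measurable]: "\<phi> \<in> borel_measurable (tower_measure m R)" and A: "A \<in> sets (tower_measure m R)"
    and xi: "\<xi> = density (tower_measure m R) (\<lambda>z. ennreal (\<phi> z))"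
  shows "integ (\<lambda>l x. (koopman ^^ n) (\<lambda>l x. indicator A (x, l)) l x * density_fun \<phi> l x)
    = emeasure (distr \<xi> (tower_measure m R) (tower_map F R ^^ n)) A"
proof -
  let ?\<mu> = "tower_measure m R" and ?T = "tower_map F R ^^ n"
  have T [measurable]: "?T \<in> ?\<mu> \<rightarrow>\<^sub>M ?\<mu>"
    by (intro measurable_compose_n measurable_tower_map F_measurable R_measurable R_pos)
  note [measurable] = A
  have "emeasure (distr \<xi> ?\<mu> ?T) A = emeasure \<xi> (?T -` A \<inter> space ?\<mu>)"
    using T by (subst emeasure_distr) (auto simp: xi)
  also have "\<dots> = (\<integral>\<^sup>+z. ennreal (\<phi> z) * indicator (?T -` A \<inter> space ?\<mu>) z \<partial>?\<mu>)"
    unfolding xi by (rule emeasure_density) measurable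
  also have "\<dots> = (\<integral>\<^sup>+z. indicator A (?T z) * ennreal (\<phi> z) \<partial>?\<mu>)"
    by (intro nn_integral_cong) (auto split: split_indicator simp: mult.commute)
  also have "\<dots> = integ (\<lambda>l x. indicator A (?T (x, l)) * ennreal (\<phi> (x, l)))"
    by (rule integ_tower) measurable
  also have "\<dots> = integ (\<lambda>l x. (koopman ^^ n) (\<lambda>l x. indicator A (x, l)) l x * density_fun \<phi> l x)"
    by (intro integ_cong) (auto simp: koopman_pow density_fun_def tower_set_def split: prod.splits)
  finally show ?thesis by simp
qed

lemma tmeas_indicator:
  assumes A: "A \<in> sets (tower_measure m R)"
  shows "tmeas (\<lambda>l x. indicator A (x, l))"
proof -
  have "A \<subseteq> tower_set (space m) R" using sets.sets_into_space[OF A] by (simp add: space_tower_measure)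
  then have "(\<lambda>l x. if (x, l) \<in> tower_set (space m) R then indicator A (x, l) else 0) = (\<lambda>l x. indicator A (x, l) :: ennreal)"
    by (intro ext) (auto split: split_indicator)
  then show ?thesis using tmeas_tower[OF borel_measurable_indicator[OF A]] by simp
qed

lemma evolved_shifted:
  assumes \<phi>: "\<phi> \<in> borel_measurable (tower_measure m R)" and A: "A \<in> sets (tower_measure m R)"
    and xi: "\<xi> = density (tower_measure m R) (\<lambda>z. ennreal (\<phi> z))" and prob: "prob_space \<xi>" and a: "0 < a"
  shows "evolved (shifted a \<phi>) (\<lambda>l x. indicator A (x, l)) n =
    measure (distr \<xi> (tower_measure m R) (tower_map F R ^^ n)) A / a
      + enn2real (integ ((koopman ^^ n) (\<lambda>l x. indicator A (x, l))))"
proof -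
  let ?v = "(koopman ^^ n) (\<lambda>l x. indicator A (x, l) :: ennreal)"
  interpret prob_space \<xi> by fact
  have v: "tmeas ?v" by (intro tmeas_koopman_pow tmeas_indicator A)
  have "?v l x \<le> 1" for l x by (rule koopman_pow_le_1) (simp add: indicator_def)
  then have "integ ?v \<le> integ (\<lambda>_ _. 1)" by (intro integ_mono)
  then have fin: "integ ?v < top" using total_finite by (rule le_less_trans)
  have T: "tower_map F R ^^ n \<in> \<xi> \<rightarrow>\<^sub>M tower_measure m R"
    unfolding xi using measurable_compose_n[OF measurable_tower_map[OF F_measurable R_measurable R_pos], of n] by simp
  interpret D: prob_space "distr \<xi> (tower_measure m R) (tower_map F R ^^ n)"
    by (rule prob_space_distr[OF T])
  show ?thesis
    unfolding evolved_def integ_shifted[OF \<phi> v] integ_density_fun[OF \<phi> A xi] D.emeasure_eq_measure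
    using fin a by (subst enn2real_plus) (auto simp: ennreal_mult'[symmetric])
qed

lemma integ_shifted_total:
  assumes \<phi>: "\<phi> \<in> borel_measurable (tower_measure m R)"
    and xi: "\<xi> = density (tower_measure m R) (\<lambda>z. ennreal (\<phi> z))" and prob: "prob_space \<xi>"
  shows "integ (shifted a \<phi>) = ennreal (1 / a) + integ (\<lambda>_ _. 1)"
proof -
  interpret prob_space \<xi> by fact
  have "integ (density_fun \<phi>) = integ (\<lambda>l x. ennreal (\<phi> (x, l)))"
    by (intro integ_cong) (simp add: density_fun_def tower_set_def)
  also have "\<dots> = (\<integral>\<^sup>+z. ennreal (\<phi> z) \<partial>tower_measure m R)"
    by (rule integ_tower[symmetric]) (use \<phi> in measurable)
  also have "\<dots> = emeasure \<xi> (space \<xi>)"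
    unfolding xi using \<phi> by (simp add: emeasure_density cong: nn_integral_cong)
  finally show ?thesis
    using integ_shifted[OF \<phi> tmeas_const[of 1], of a] by (simp add: emeasure_space_1)
qed

end

lemma sum_indicator_disjoint_le_1:
  assumes "finite Q" "disjoint Q"
  shows "(\<Sum>A\<in>Q. indicator A z) \<le> (1::ennreal)"
proof -
  have "(indicator (\<Union>(id ` Q)) z :: ennreal) = (\<Sum>A\<in>Q. indicator (id A) z)"
    by (rule indicator_UN_disjoint) (use assms in \<open>auto simp: disjoint_family_on_def disjoint_def\<close>)
  then have "(\<Sum>A\<in>Q. indicator A z) = (indicator (\<Union>Q) z :: ennreal)" by simp
  also have "\<dots> \<le> 1" by (simp add: indicator_def)
  finally show ?thesis .
qed

lemma invariant_measure_iterate: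
  assumes inv: "invariant_measure T \<nu>" and T: "T \<in> \<mu> \<rightarrow>\<^sub>M \<mu>" and sets: "sets \<nu> = sets \<mu>"
  shows "distr \<nu> \<mu> (T ^^ n) = \<nu>"
proof (induction n)
  case 0
  have "distr \<nu> \<mu> (\<lambda>x. x) = distr \<nu> \<nu> (\<lambda>x. x)" by (rule distr_cong) (use sets in auto)
  then show ?case by (simp add: distr_id id_def)
next
  case (Suc n)
  have T\<nu>: "T \<in> \<nu> \<rightarrow>\<^sub>M \<mu>" using T sets by (simp cong: measurable_cong_sets)
  have "distr \<nu> \<mu> (T ^^ Suc n) = distr \<nu> \<mu> ((T ^^ n) \<circ> T)" by (simp add: funpow_Suc_right del: funpow.simps)
  also have "\<dots> = distr (distr \<nu> \<mu> T) \<mu> (T ^^ n)"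
    by (rule distr_distr[symmetric, OF measurable_compose_n[OF T] T\<nu>])
  also have "distr \<nu> \<mu> T = distr \<nu> \<nu> T" by (rule distr_cong) (use sets in auto)
  also have "\<dots> = \<nu>" using inv by (simp add: invariant_measure_def)
  finally show ?case using Suc.IH by simp
qed

text \<open>
  \<open>\<psi>'\<close> is chosen before \<open>L\<close>; the density of \<open>L\<close> determines the constant \<open>a\<close> in \<open>shifted\<close>, and with it \<open>K\<close>.
\<close>

lemma tower_decay:
  fixes M m :: "'a measure" and \<Delta>\<^sub>0 :: "'a set" and f F :: "'a \<Rightarrow> 'a" and P :: "'a set set"
    and R :: "'a \<Rightarrow> nat" and J :: "'a \<Rightarrow> real" and \<beta>\<^sub>0 \<beta> :: real
    and T :: "'a \<times> nat \<Rightarrow> 'a \<times> nat" and \<mu> \<nu> :: "('a \<times> nat) measure"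
  assumes induced: "induced_map M f \<Delta>\<^sub>0 F P R"
    and m_eq: "m = restrict_space M \<Delta>\<^sub>0"
    and wgm: "wgm_map m F P"
    and R_int: "integrable m (\<lambda>x. real (R x))"
    and \<beta>\<^sub>0: "0 < \<beta>\<^sub>0" "\<beta>\<^sub>0 < 1"
    and gibbs: "is_jacobian m F P J" "gibbs_property F P J \<beta>\<^sub>0"
    and T_eq: "T = tower_map F R"
    and \<mu>_eq: "\<mu> = tower_measure m R"
    and \<nu>: "prob_space \<nu>" "invariant_measure T \<nu>" "mixing_measure T \<nu>"
      "has_density_in \<nu> \<mu> (F_plus_space \<Delta>\<^sub>0 F P R \<beta>\<^sub>0)"
    and \<beta>: "0 < \<beta>" "\<beta> < 1"
    and rate: "rate_family \<Psi>" and \<psi>: "\<psi> \<in> \<Psi>" and A: "0 \<le> A"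
    and tail: "\<And>n. (\<Sum>i. measure m {x \<in> \<Delta>\<^sub>0. i + n < R x}) \<le> A * \<psi> n"
  shows "\<exists>\<psi>'\<in>\<Psi>. \<forall>L. prob_space L \<and> has_density_in L \<mu> (F_plus_space \<Delta>\<^sub>0 F P R \<beta>) \<longrightarrow>
    (\<exists>K\<ge>0. \<forall>n. tv_norm \<mu> (\<lambda>A. measure (distr L \<mu> (T ^^ n)) A - measure \<nu> A) \<le> ennreal (K * \<psi>' n))"
proof -
  \<comment> \<open>Both densities and the Jacobian are Hoelder with respect to the larger of the two bases.\<close>
  define b where "b = max \<beta> \<beta>\<^sub>0"
  have b: "0 < \<beta>\<^sub>0" "\<beta>\<^sub>0 \<le> b" "b < 1" "\<beta> \<le> b" using \<beta> \<beta>\<^sub>0 by (auto simp: b_def)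
  have "\<Delta>\<^sub>0 \<in> sets M" using induced by (simp add: induced_map_def)
  then have space_m: "space m = \<Delta>\<^sub>0" using sets.sets_into_space by (auto simp: m_eq space_restrict_space)
  obtain G C \<delta>\<^sub>0 star where mt: "markov_tower m F ((\<lambda>\<omega>. \<omega> \<inter> G) ` P) R J (\<lambda>x y. enat_power b (sep_time F P x y)) b C \<delta>\<^sub>0 star"
    using markov_tower_instance[OF induced m_eq wgm R_int gibbs \<nu>(1) \<nu>(3)[unfolded T_eq] \<nu>(4)[unfolded \<mu>_eq] b(1-3)] by blast
  interpret mt: markov_tower m F "(\<lambda>\<omega>. \<omega> \<inter> G) ` P" R J "\<lambda>x y. enat_power b (sep_time F P x y)" b C \<delta>\<^sub>0 star
    by (rule mt)
  obtain N c\<^sub>1 where N: "1 \<le> N" "0 < c\<^sub>1" and hit: "\<forall>t\<in>{N..<2*N}. \<forall>f. mt.tmeas f \<longrightarrow> (\<forall>l. mt.regular mt.L' l (f l)) \<longrightarrow>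
     ennreal c\<^sub>1 * (\<integral>\<^sup>+y. mt.push f 0 y \<partial>m) \<le> (\<integral>\<^sup>+y\<in>mt.hits t. mt.push f 0 y \<partial>m)"
    and ret: "0 < measure m (star \<inter> mt.hits N)"
    using mt.hitting by blast
  interpret bt: blocked_tower m F "(\<lambda>\<omega>. \<omega> \<inter> G) ` P" R J "\<lambda>x y. enat_power b (sep_time F P x y)" b C \<delta>\<^sub>0 star N c\<^sub>1
    by unfold_locales (use N hit ret in auto)
  have "\<And>n. (\<Sum>i. bt.level_tail (i + n)) \<le> A * \<psi> n"
    using tail by (simp add: bt.level_tail_def bt.late_def space_m)
  from bt.convergence[OF rate \<psi> A this, where 'b = "('a \<times> nat) set"]
  obtain \<psi>' where \<psi>': "\<psi>' \<in> \<Psi>" and conv: "\<And>f1 f2 D. bt.standard f1 \<Longrightarrow> bt.standard f2 \<Longrightarrow> bt.bounded D f1 \<Longrightarrow> bt.bounded D f2 \<Longrightarrow>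
      mt.integ f1 = mt.integ f2 \<Longrightarrow>
    (\<exists>K\<ge>0. \<forall>n Q u. finite (Q :: ('a \<times> nat) set set) \<longrightarrow> (\<forall>a\<in>Q. mt.tmeas (u a)) \<longrightarrow> (\<forall>l x. (\<Sum>a\<in>Q. u a l x) \<le> 1) \<longrightarrow>
       (\<Sum>a\<in>Q. \<bar>bt.evolved f1 (u a) n - bt.evolved f2 (u a) n\<bar>) \<le> K * \<psi>' n)"
    by blast
  obtain \<phi>2 where \<phi>2: "\<phi>2 \<in> F_plus_space \<Delta>\<^sub>0 F P R \<beta>\<^sub>0" "\<phi>2 \<in> borel_measurable (tower_measure m R)"
    and \<nu>_eq: "\<nu> = density (tower_measure m R) (\<lambda>z. ennreal (\<phi>2 z))"
    using \<nu>(4) unfolding has_density_in_def \<mu>_eq by blast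
  have lip: "\<exists>C>0. \<forall>x\<in>tower_set \<Delta>\<^sub>0 R. \<forall>y\<in>tower_set \<Delta>\<^sub>0 R. \<bar>\<phi> x - \<phi> y\<bar> \<le> C * enat_power b (tower_sep_time F P x y)"
    if ph: "\<phi> \<in> F_plus_space \<Delta>\<^sub>0 F P R \<gamma>" "0 < \<gamma>" "\<gamma> \<le> b" for \<phi> \<gamma>
  proof -
    obtain C where C: "0 < C" "\<forall>x\<in>tower_set \<Delta>\<^sub>0 R. \<forall>y\<in>tower_set \<Delta>\<^sub>0 R. \<bar>\<phi> x - \<phi> y\<bar> \<le> C * enat_power \<gamma> (tower_sep_time F P x y)"
      using ph(1) unfolding F_plus_space_def F_space_def by auto
    have "C * enat_power \<gamma> s \<le> C * enat_power b s" for s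
      using C(1) ph(2,3) by (intro mult_left_mono enat_power_mono) auto
    then show ?thesis using C by (meson order_trans)
  qed
  have T: "T \<in> \<mu> \<rightarrow>\<^sub>M \<mu>"
    unfolding T_eq \<mu>_eq by (intro measurable_tower_map mt.F_measurable mt.R_measurable mt.R_pos)
  show ?thesis
  proof (intro bexI[OF _ \<psi>'] allI impI)
    fix L assume "prob_space L \<and> has_density_in L \<mu> (F_plus_space \<Delta>\<^sub>0 F P R \<beta>)"
    then obtain \<phi>1 where L: "prob_space L" and \<phi>1: "\<phi>1 \<in> F_plus_space \<Delta>\<^sub>0 F P R \<beta>" "\<phi>1 \<in> borel_measurable (tower_measure m R)"
      and L_eq: "L = density (tower_measure m R) (\<lambda>z. ennreal (\<phi>1 z))"
      unfolding has_density_in_def \<mu>_eq by blast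
    obtain C1 where C1: "0 < C1" "\<forall>x\<in>tower_set \<Delta>\<^sub>0 R. \<forall>y\<in>tower_set \<Delta>\<^sub>0 R. \<bar>\<phi>1 x - \<phi>1 y\<bar> \<le> C1 * enat_power b (tower_sep_time F P x y)"
      using lip[OF \<phi>1(1) \<beta>(1) b(4)] by blast
    obtain C2 where C2: "0 < C2" "\<forall>x\<in>tower_set \<Delta>\<^sub>0 R. \<forall>y\<in>tower_set \<Delta>\<^sub>0 R. \<bar>\<phi>2 x - \<phi>2 y\<bar> \<le> C2 * enat_power b (tower_sep_time F P x y)"
      using lip[OF \<phi>2(1) b(1,2)] by blast
    have L'0: "0 < mt.L'" using mt.L by linarith
    \<comment> \<open>The same constant is added to both densities, and it is large enough for both.\<close>
    define a where "a = (C1 + C2) / mt.L'"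
    have a: "0 < a" "C1 \<le> a * mt.L'" "C2 \<le> a * mt.L'" using C1 C2 L'0 by (auto simp: a_def)
    obtain x0 where x0: "x0 \<in> space m" using mt.space_m_pos by fastforce
    define z0 where "z0 = (x0, 0::nat)"
    have z0: "z0 \<in> tower_set \<Delta>\<^sub>0 R" using x0 mt.R_pos[OF x0] by (simp add: z0_def tower_set_def space_m)
    define B where "B = \<bar>\<phi>1 z0\<bar> + \<bar>\<phi>2 z0\<bar> + C1 + C2"
    have B0: "0 \<le> B" using C1 C2 by (simp add: B_def)
    have B: "\<phi>1 z \<le> B" "\<phi>2 z \<le> B" if "z \<in> tower_set (space m) R" for z
    proof -
      have z: "z \<in> tower_set \<Delta>\<^sub>0 R" using that by (simp add: space_m)
      have e: "enat_power b (tower_sep_time F P z z0) \<le> 1" using b by (intro enat_power_bounds) auto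
      have "\<bar>\<phi>1 z - \<phi>1 z0\<bar> \<le> C1 * enat_power b (tower_sep_time F P z z0)" using C1(2) z z0 by blast
      also have "\<dots> \<le> C1" using e C1(1) by (simp add: mult_left_le)
      finally show "\<phi>1 z \<le> B" using C1 C2 by (simp add: B_def)
      have "\<bar>\<phi>2 z - \<phi>2 z0\<bar> \<le> C2 * enat_power b (tower_sep_time F P z z0)" using C2(2) z z0 by blast
      also have "\<dots> \<le> C2" using e C2(1) by (simp add: mult_left_le)
      finally show "\<phi>2 z \<le> B" using C1 C2 by (simp add: B_def)
    qed
    have mem: "(x, l) \<in> tower_set \<Delta>\<^sub>0 R" "(y, l) \<in> tower_set \<Delta>\<^sub>0 R"
      if "\<omega> \<in> (\<lambda>\<omega>. \<omega> \<inter> G) ` P" "x \<in> \<omega>" "y \<in> \<omega>" "l < R x" for \<omega> x y l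
      using that mt.P_space mt.R_const[OF that(1-3)] space_m by (auto simp: tower_set_def)
    have l1: "\<phi>1 (x, l) - \<phi>1 (y, l) \<le> C1 * enat_power b (sep_time F P x y)"
      if "\<omega> \<in> (\<lambda>\<omega>. \<omega> \<inter> G) ` P" "x \<in> \<omega>" "y \<in> \<omega>" "l < R x" for \<omega> x y l
      using C1(2)[THEN bspec, OF mem(1)[OF that], THEN bspec, OF mem(2)[OF that]] by (simp add: tower_sep_time_def)
    have l2: "\<phi>2 (x, l) - \<phi>2 (y, l) \<le> C2 * enat_power b (sep_time F P x y)"
      if "\<omega> \<in> (\<lambda>\<omega>. \<omega> \<inter> G) ` P" "x \<in> \<omega>" "y \<in> \<omega>" "l < R x" for \<omega> x y l
      using C2(2)[THEN bspec, OF mem(1)[OF that], THEN bspec, OF mem(2)[OF that]] by (simp add: tower_sep_time_def)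
    let ?f1 = "bt.shifted a \<phi>1" and ?f2 = "bt.shifted a \<phi>2"
    have n1: "bt.standard ?f1" by (rule bt.standard_shifted[OF \<phi>1(2) l1 a(1,2) less_imp_le[OF C1(1)]])
    have n2: "bt.standard ?f2" by (rule bt.standard_shifted[OF \<phi>2(2) l2 a(1,3) less_imp_le[OF C2(1)]])
    have b1: "bt.bounded (B / a + 1) ?f1" by (rule bt.bounded_shifted[OF B(1) a(1) B0])
    have b2: "bt.bounded (B / a + 1) ?f2" by (rule bt.bounded_shifted[OF B(2) a(1) B0])
    have eq: "mt.integ ?f1 = mt.integ ?f2"
      unfolding bt.integ_shifted_total[OF \<phi>1(2) L_eq L] bt.integ_shifted_total[OF \<phi>2(2) \<nu>_eq \<nu>(1)] ..
    obtain K where K: "0 \<le> K" and Kb: "\<And>n Q u. finite (Q :: ('a \<times> nat) set set) \<Longrightarrow> (\<forall>a\<in>Q. mt.tmeas (u a)) \<Longrightarrow>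
        (\<forall>l x. (\<Sum>a\<in>Q. u a l x) \<le> 1) \<Longrightarrow> (\<Sum>a\<in>Q. \<bar>bt.evolved ?f1 (u a) n - bt.evolved ?f2 (u a) n\<bar>) \<le> K * \<psi>' n"
      using conv[OF n1 n2 b1 b2 eq] by blast
    have "tv_norm \<mu> (\<lambda>A. measure (distr L \<mu> (T ^^ n)) A - measure \<nu> A) \<le> ennreal (a * K * \<psi>' n)" for n
      unfolding tv_norm_def
    proof (rule SUP_least)
      fix Q assume "Q \<in> {Q. finite Q \<and> disjoint Q \<and> Q \<subseteq> sets \<mu> \<and> \<Union>Q = space \<mu>}"
      then have Q: "finite Q" "disjoint Q" "Q \<subseteq> sets (tower_measure m R)" by (auto simp: \<mu>_eq)
      let ?u = "\<lambda>A l x. indicator A (x, l) :: ennreal"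
      have diff: "measure (distr L \<mu> (T ^^ n)) A - measure \<nu> A = a * (bt.evolved ?f1 (?u A) n - bt.evolved ?f2 (?u A) n)"
        if "A \<in> Q" for A
      proof -
        have As: "A \<in> sets (tower_measure m R)" using Q that by auto
        have "distr \<nu> \<mu> (T ^^ n) = \<nu>"
          by (rule invariant_measure_iterate[OF \<nu>(2) T]) (simp add: \<nu>_eq \<mu>_eq)
        then show ?thesis
          unfolding bt.evolved_shifted[OF \<phi>1(2) As L_eq L a(1)] bt.evolved_shifted[OF \<phi>2(2) As \<nu>_eq \<nu>(1) a(1)] T_eq \<mu>_eq
          using a(1) by (simp add: field_simps)
      qed
      have "(\<Sum>A\<in>Q. \<bar>measure (distr L \<mu> (T ^^ n)) A - measure \<nu> A\<bar>) = a * (\<Sum>A\<in>Q. \<bar>bt.evolved ?f1 (?u A) n - bt.evolved ?f2 (?u A) n\<bar>)"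
        unfolding sum_distrib_left using diff a(1) by (intro sum.cong) (auto simp: abs_mult)
      also have "\<dots> \<le> a * (K * \<psi>' n)"
        using a(1) Q bt.tmeas_indicator sum_indicator_disjoint_le_1[OF Q(1,2)]
        by (intro mult_left_mono Kb) auto
      finally show "ennreal (\<Sum>A\<in>Q. \<bar>measure (distr L \<mu> (T ^^ n)) A - measure \<nu> A\<bar>) \<le> ennreal (a * K * \<psi>' n)"
        by (intro ennreal_leI) (simp add: mult.assoc)
    qed
    moreover have "0 \<le> a * K" using a(1) K by simp
    ultimately show "\<exists>K\<ge>0. \<forall>n. tv_norm \<mu> (\<lambda>A. measure (distr L \<mu> (T ^^ n)) A - measure \<nu> A) \<le> ennreal (K * \<psi>' n)"
      by blast
  qed
qed

theorem proposition5p3: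
  fixes M m :: "'a measure" and \<Delta>\<^sub>0 :: "'a set" and f F :: "'a \<Rightarrow> 'a" and P :: "'a set set"
    and R :: "'a \<Rightarrow> nat" and J :: "'a \<Rightarrow> real" and \<beta>\<^sub>0 \<beta> :: real
    and T :: "'a \<times> nat \<Rightarrow> 'a \<times> nat" and \<mu> \<nu> :: "('a \<times> nat) measure"
  assumes induced: "induced_map M f \<Delta>\<^sub>0 F P R"
    and m_eq: "m = restrict_space M \<Delta>\<^sub>0"
    and wgm: "wgm_map m F P"
    and aper: "aperiodic m F P"
    and block: "coprime_block m F P R"
    and R_int: "integrable m (\<lambda>x. real (R x))"
    and \<beta>\<^sub>0: "0 < \<beta>\<^sub>0" "\<beta>\<^sub>0 < 1"
    and gibbs: "is_jacobian m F P J" "gibbs_property F P J \<beta>\<^sub>0"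
    and T_eq: "T = tower_map F R"
    and \<mu>_eq: "\<mu> = tower_measure m R"
    and \<nu>: "prob_space \<nu>" "invariant_measure T \<nu>" "mixing_measure T \<nu>"
      "has_density_in \<nu> \<mu> (F_plus_space \<Delta>\<^sub>0 F P R \<beta>\<^sub>0)"
    and \<beta>: "0 < \<beta>" "\<beta> < 1"
  shows
    "(\<forall>C a. 0 < C \<and> 1 < a \<and>
        (\<forall>n\<ge>1. measure m {x \<in> \<Delta>\<^sub>0. n < R x} \<le> C * real n powr (- a)) \<longrightarrow>
        (\<forall>L. prob_space L \<and> has_density_in L \<mu> (F_plus_space \<Delta>\<^sub>0 F P R \<beta>) \<longrightarrow>
           (\<exists>C'>0. \<forall>n\<ge>1.
              tv_norm \<mu> (\<lambda>A. measure (distr L \<mu> (T ^^ n)) A - measure \<nu> A)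
                \<le> ennreal (C' * real n powr (- a + 1)))))
     \<and>
     (\<forall>C c a. 0 < C \<and> 0 < c \<and> 0 < a \<and> a \<le> 1 \<and>
        (\<forall>n\<ge>1. measure m {x \<in> \<Delta>\<^sub>0. n < R x} \<le> C * exp (- c * real n powr a)) \<longrightarrow>
        (\<exists>c'>0. \<forall>L. prob_space L \<and> has_density_in L \<mu> (F_plus_space \<Delta>\<^sub>0 F P R \<beta>) \<longrightarrow>
           (\<exists>C'>0. \<forall>n\<ge>1.
              tv_norm \<mu> (\<lambda>A. measure (distr L \<mu> (T ^^ n)) A - measure \<nu> A)
                \<le> ennreal (C' * exp (- c' * real n powr a)))))"
proof (intro conjI allI impI)
  fix C a
  assume h: "0 < C \<and> 1 < a \<and> (\<forall>n\<ge>1. measure m {x \<in> \<Delta>\<^sub>0. n < R x} \<le> C * real n powr (- a))"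
  fix L assume L: "prob_space L \<and> has_density_in L \<mu> (F_plus_space \<Delta>\<^sub>0 F P R \<beta>)"
  obtain D where D: "0 \<le> D" "\<And>n. (\<Sum>i. measure m {x \<in> \<Delta>\<^sub>0. i + n < R x}) \<le> D * real (n + 1) powr (- (a - 1))"
    using polynomial_tail_sum[of a C "\<lambda>n. measure m {x \<in> \<Delta>\<^sub>0. n < R x}"] h by auto
  have rate: "rate_family {\<lambda>n. real (n + 1) powr (- (a - 1))}"
    using h by (intro polynomial_rate_family) auto
  obtain K where K: "0 \<le> K" "\<And>n. tv_norm \<mu> (\<lambda>A. measure (distr L \<mu> (T ^^ n)) A - measure \<nu> A) \<le> ennreal (K * real (n + 1) powr (- (a - 1)))"
    using tower_decay[OF induced m_eq wgm R_int \<beta>\<^sub>0 gibbs T_eq \<mu>_eq \<nu> \<beta> rate _ D] L by blast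
  show "\<exists>C'>0. \<forall>n\<ge>1. tv_norm \<mu> (\<lambda>A. measure (distr L \<mu> (T ^^ n)) A - measure \<nu> A)
      \<le> ennreal (C' * real n powr (- a + 1))"
  proof (intro exI[of _ "K + 1"] conjI allI impI)
    show "0 < K + 1" using K by simp
    fix n :: nat assume n: "1 \<le> n"
    have "real (n + 1) powr (- (a - 1)) \<le> real n powr (- (a - 1))"
      using n h by (intro powr_mono2') auto
    then have "K * real (n + 1) powr (- (a - 1)) \<le> (K + 1) * real n powr (- a + 1)"
      using K(1) by (intro mult_mono) auto
    then show "tv_norm \<mu> (\<lambda>A. measure (distr L \<mu> (T ^^ n)) A - measure \<nu> A) \<le> ennreal ((K + 1) * real n powr (- a + 1))"
      using K(2)[of n] by (meson ennreal_leI order_trans)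
  qed
next
  fix C c a
  assume h: "0 < C \<and> 0 < c \<and> 0 < a \<and> a \<le> 1 \<and> (\<forall>n\<ge>1. measure m {x \<in> \<Delta>\<^sub>0. n < R x} \<le> C * exp (- c * real n powr a))"
  obtain D where D: "0 \<le> D" "\<And>n. (\<Sum>i. measure m {x \<in> \<Delta>\<^sub>0. i + n < R x}) \<le> D * exp (- (c / 2) * real n powr a)"
    using stretched_exponential_tail_sum[of a c C "\<lambda>n. measure m {x \<in> \<Delta>\<^sub>0. n < R x}"] h by auto
  have rate: "rate_family {\<lambda>n. exp (- c * real n powr a) | c. 0 < c}"
    using h by (intro stretched_exponential_rate_family) auto
  have mem: "(\<lambda>n. exp (- (c / 2) * real n powr a)) \<in> {\<lambda>n. exp (- c * real n powr a) | c. 0 < c}"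
    using h by (intro CollectI exI[of _ "c / 2"]) auto
  obtain c' where c': "0 < c'" and decay: "\<And>L. prob_space L \<and> has_density_in L \<mu> (F_plus_space \<Delta>\<^sub>0 F P R \<beta>) \<Longrightarrow>
      \<exists>K\<ge>0. \<forall>n. tv_norm \<mu> (\<lambda>A. measure (distr L \<mu> (T ^^ n)) A - measure \<nu> A) \<le> ennreal (K * exp (- c' * real n powr a))"
    using tower_decay[OF induced m_eq wgm R_int \<beta>\<^sub>0 gibbs T_eq \<mu>_eq \<nu> \<beta> rate mem D] by blast
  show "\<exists>c'>0. \<forall>L. prob_space L \<and> has_density_in L \<mu> (F_plus_space \<Delta>\<^sub>0 F P R \<beta>) \<longrightarrow>
           (\<exists>C'>0. \<forall>n\<ge>1.
              tv_norm \<mu> (\<lambda>A. measure (distr L \<mu> (T ^^ n)) A - measure \<nu> A)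
                \<le> ennreal (C' * exp (- c' * real n powr a)))"
  proof (rule exI[of _ c'], rule conjI[OF c'], intro allI impI)
    fix L assume "prob_space L \<and> has_density_in L \<mu> (F_plus_space \<Delta>\<^sub>0 F P R \<beta>)"
    then obtain K where K: "0 \<le> K" "\<And>n. tv_norm \<mu> (\<lambda>A. measure (distr L \<mu> (T ^^ n)) A - measure \<nu> A) \<le> ennreal (K * exp (- c' * real n powr a))"
      using decay by blast
    have "ennreal (K * exp (- c' * real n powr a)) \<le> ennreal ((K + 1) * exp (- c' * real n powr a))" for n
      by (intro ennreal_leI mult_right_mono) auto
    then have "\<forall>n\<ge>1. tv_norm \<mu> (\<lambda>A. measure (distr L \<mu> (T ^^ n)) A - measure \<nu> A) \<le> ennreal ((K + 1) * exp (- c' * real n powr a))"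
      using K(2) order_trans by blast
    then show "\<exists>C'>0. \<forall>n\<ge>1. tv_norm \<mu> (\<lambda>A. measure (distr L \<mu> (T ^^ n)) A - measure \<nu> A)
                \<le> ennreal (C' * exp (- c' * real n powr a))"
      using K(1) by (intro exI[of _ "K + 1"]) auto
  qed
qed

end
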